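(* Let $Q(x,y)=ax^2+bxy+cy^2$ with $a,b,c\in\mathbb{Z}$ be a primitive positive-definite binary quadratic form. Then the proper representation counting function $r_Q^+:\mathbb{Z}_{\ge0}\to\mathbb{Z}_{\ge0}$ is surjective.
   Context: $Q$ is primitive if $\gcd(a,b,c)=1$, and positive-definite if $Q(x,y)>0$ for all $(x,y)\in\mathbb{Z}^2\setminus\{(0,0)\}$. $\mathrm{Aut}(Q)$ is the group of matrices $\begin{pmatrix}p&q\\ r&s\end{pmatrix}\in\mathrm{GL}_2(\mathbb{Z})$ with $Q(px+qy,rx+sy)=Q(x,y)$ for all $x,y\in\mathbb{Z}$, and $\mathrm{Aut}^+(Q)=\mathrm{Aut}(Q)\cap\mathrm{SL}_2(\mathbb{Z})$ (proper automorphisms). For $n\in\mathbb{Z}_{\ge0}$, $r_Q^+(n)$ is the number of representations of $n$ by $Q$ up to proper automorphism, i.e. the number of orbits of $\mathrm{Aut}^+(Q)$ acting on $\{(x,y)\in\mathbb{Z}^2: Q(x,y)=n\}$. *)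

theory Defs
  imports "HOL-Analysis.Determinants" "HOL-Algebra.Group_Action"
begin

definition binary_form :: "int \<Rightarrow> int \<Rightarrow> int \<Rightarrow> int ^ 2 \<Rightarrow> int" where
  "binary_form a b c v = a * (v $ 1)\<^sup>2 + b * (v $ 1) * (v $ 2) + c * (v $ 2)\<^sup>2"

definition primitive_form :: "int \<Rightarrow> int \<Rightarrow> int \<Rightarrow> bool" where
  "primitive_form a b c \<longleftrightarrow> Gcd {a, b, c} = 1"

definition positive_definite :: "(int ^ 2 \<Rightarrow> int) \<Rightarrow> bool" where
  "positive_definite Q \<longleftrightarrow> (\<forall>v. v \<noteq> 0 \<longrightarrow> Q v > 0)"

text \<open>
  For square matrices over the integers, \<^const>\<open>invertible\<close> asks for a two-sided inverse
  with integer entries, so the carrier below consists of elements of $GL_2(\mathbf{Z})$.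
\<close>

definition Aut :: "(int ^ 2 \<Rightarrow> int) \<Rightarrow> (int ^ 2 ^ 2) monoid" where
  "Aut Q = \<lparr>carrier = {A. invertible A \<and> (\<forall>v. Q (A *v v) = Q v)},
            monoid.mult = (**), one = mat 1\<rparr>"

definition proper_Aut :: "(int ^ 2 \<Rightarrow> int) \<Rightarrow> (int ^ 2 ^ 2) monoid" where
  "proper_Aut Q = (Aut Q)\<lparr>carrier := {A \<in> carrier (Aut Q). det A = 1}\<rparr>"

definition representations :: "(int ^ 2 \<Rightarrow> int) \<Rightarrow> nat \<Rightarrow> (int ^ 2) set" where
  "representations Q n = {v. Q v = int n}"

text \<open>
  If \<open>Q\<close> is a positive-definite binary quadratic form, every integer has only finitely many
  representations, so that \<^const>\<open>card\<close> is the true number of orbits.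
\<close>

definition proper_rep_count :: "(int ^ 2 \<Rightarrow> int) \<Rightarrow> nat \<Rightarrow> nat" where
  "proper_rep_count Q n = card (orbits (proper_Aut Q) (representations Q n) (*v))"

lemma group_Aut: "group (Aut Q)"
proof (rule groupI)
  fix A assume "A \<in> carrier (Aut Q)"
  then obtain B where B: "A ** B = mat 1" "B ** A = mat 1" and Q: "\<And>v. Q (A *v v) = Q v"
    by (auto simp: Aut_def invertible_def)
  have "Q (B *v v) = Q v" for v
    using Q[of "B *v v"] B by (simp add: matrix_vector_mul_assoc)
  with B have "B \<in> carrier (Aut Q)" by (auto simp: Aut_def invertible_def)
  with B show "\<exists>B\<in>carrier (Aut Q). B \<otimes>\<^bsub>Aut Q\<^esub> A = \<one>\<^bsub>Aut Q\<^esub>"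
    by (auto simp: Aut_def)
qed (auto simp: Aut_def matrix_mul_assoc invertible_mult simp flip: matrix_vector_mul_assoc,
     auto simp: invertible_def intro!: exI[of _ "mat 1"])

lemma subgroup_proper_Aut: "subgroup (carrier (proper_Aut Q)) (Aut Q)"
proof (rule group.subgroupI[OF group_Aut])
  show "carrier (proper_Aut Q) \<noteq> {}"
    using group.is_monoid[OF group_Aut, THEN monoid.one_closed, of Q]
    by (auto simp: proper_Aut_def Aut_def intro!: exI[of _ "mat 1"])
next
  fix A assume A: "A \<in> carrier (proper_Aut Q)"
  let ?B = "inv\<^bsub>Aut Q\<^esub> A"
  have AA: "A \<in> carrier (Aut Q)" using A by (simp add: proper_Aut_def)
  have B: "?B \<in> carrier (Aut Q)" "?B \<otimes>\<^bsub>Aut Q\<^esub> A = \<one>\<^bsub>Aut Q\<^esub>"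
    using group.inv_closed[OF group_Aut AA] group.l_inv[OF group_Aut AA] by auto
  have "det (?B ** A) = 1" using B(2) by (simp add: Aut_def)
  then have "det ?B = 1" using A by (simp add: det_mul proper_Aut_def)
  with B(1) show "?B \<in> carrier (proper_Aut Q)" by (simp add: proper_Aut_def)
next
  fix A B assume "A \<in> carrier (proper_Aut Q)" "B \<in> carrier (proper_Aut Q)"
  moreover from this have "A \<otimes>\<^bsub>Aut Q\<^esub> B \<in> carrier (Aut Q)"
    by (auto simp: proper_Aut_def intro!: monoid.m_closed group.is_monoid group_Aut)
  ultimately show "A \<otimes>\<^bsub>Aut Q\<^esub> B \<in> carrier (proper_Aut Q)"
    by (auto simp: proper_Aut_def Aut_def det_mul)
qed (auto simp: proper_Aut_def)

end

theory Submission
  imports Defs "HOL-Number_Theory.Number_Theory"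
begin

text \<open>
  Let $D = b^2 - 4ac < 0$ and let $\mathcal O$ be the quadratic order of discriminant $D$ in
  $\mathbf C$. For $n > 0$ the number $r_Q^+(n)$ counts the integral invertible ideals of norm $n$
  in a fixed ideal class $X$. Let $P$ lie over a split prime $p$ and let $h$ be least such
  that $P^{2h}$ is principal.

  Suppose first that every ambiguous class contains an integral ideal $K$, of norm $d$ say, that
  contains every integral ideal whose norm is divisible by $d$; then the numbers for $X$ at $dn$
  and for $XK^{-1}$ at $n$ agree, so $X$ may be changed by ambiguous classes. Among all classes
  $X A P^s$ with $A$ ambiguous, take an integral ideal $J$ of least norm $m$ coprime to $2D$. If
  $J'$ is another ideal of norm $m$ whose class differs from that of $J$ by an even power of $P$,
  then $J = UV$ and $J' = U \overline V$ with $U = J + J'$, so $V^2$ is equivalent to an even power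
  of $P$, hence $V$ is a power of $P$ times an ambiguous class; then $U$ contradicts minimality.
  Hence the ideals of norm $p^s m$ in the class of $P^s J$ are the $P^i \overline P^{s-i} J$ with
  $h \mid i \le s$. As $P^h$ is ambiguous, $s$ may be shifted by multiples of $h$, so that there
  are exactly $k$ of them.

  The supposition on ambiguous classes can fail at primes $q$ dividing the conductor. For these,
  $r_Q^+(q^2 n)$ equals the corresponding number for the order of discriminant $D/q^2$, unless the
  latter has additional units; in those exceptional cases the supposition still holds.
  The value $0$ is attained because no form of this kind represents all of $1, 2, 3, 5$.
\<close>

section \<open>Additive subgroups of the complex numbers\<close>

text \<open>Since P times its conjugate is principal, the class of P^i conj(P)^(s-i) J depends on i
  only through the even power P^(2i). Hence the order of P^2, not that of P, governs the count, and
  ambiguous classes enter because V ~ conj(V) P^(2t) can be halved only up to classes of order two.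
  The exponent s belonging to the minimal J is not free: multiples of h can be shifted, while s mod
  h remains and is too small to admit a further multiple of h. Coprimality to 2D makes J + J'
  invertible even if the order is not maximal. Ambiguous classes are realised by ideals whose norms
  avoid the conductor. A prime of the conductor is removed by extending ideals to the larger order;
  ideals of one class with equal extensions differ by a unit of that order, so only the
  discriminants -3 and -4 obstruct. In those cases a single prime divides the conductor, and one of
  two ideals in each ambiguous class avoids it. The equation L conj(L) = N O carries the norm, so
  that no index of lattices has to be computed.\<close>

definition is_zmod :: "complex set \<Rightarrow> bool" where
  "is_zmod S \<longleftrightarrow> 0 \<in> S \<and> (\<forall>x\<in>S. \<forall>y\<in>S. x - y \<in> S)"

typedef zmod = "{S. is_zmod S}" morphisms elts Abs_zmod
  by (rule exI[of _ UNIV]) (simp add: is_zmod_def)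

lemma elts_zero [simp]: "0 \<in> elts A"
  using elts[of A] by (simp add: is_zmod_def)

lemma elts_diff: "x \<in> elts A \<Longrightarrow> y \<in> elts A \<Longrightarrow> x - y \<in> elts A"
  using elts[of A] by (simp add: is_zmod_def)

lemma elts_uminus: "x \<in> elts A \<Longrightarrow> - x \<in> elts A"
  using elts_diff[of 0 A x] by simp

lemma elts_add: "x \<in> elts A \<Longrightarrow> y \<in> elts A \<Longrightarrow> x + y \<in> elts A"
  using elts_diff[of x A "-y"] elts_uminus[of y A] by simp

lemma elts_of_nat: "x \<in> elts A \<Longrightarrow> of_nat n * x \<in> elts A"
  by (induction n) (auto simp: distrib_right intro: elts_add)

lemma elts_of_int: "of_int k * x \<in> elts A" if "x \<in> elts A"
proof (cases k)
  case (neg n)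
  then show ?thesis
    using elts_uminus[OF elts_of_nat[of x A "Suc n"]] that by (simp del: of_nat_Suc)
qed (use elts_of_nat that in simp)

lemma elts_Abs: "is_zmod S \<Longrightarrow> elts (Abs_zmod S) = S"
  by (simp add: Abs_zmod_inverse)

inductive_set zspan :: "complex set \<Rightarrow> complex set" for S where
  zero: "0 \<in> zspan S"
| base: "x \<in> S \<Longrightarrow> x \<in> zspan S"
| diff: "x \<in> zspan S \<Longrightarrow> y \<in> zspan S \<Longrightarrow> x - y \<in> zspan S"

lemma is_zmod_zspan: "is_zmod (zspan S)"
  by (auto simp: is_zmod_def intro: zspan.intros)

lemma zspan_subset_iff: "zspan S \<subseteq> elts A \<longleftrightarrow> S \<subseteq> elts A"
proof
  assume S: "S \<subseteq> elts A"
  show "zspan S \<subseteq> elts A"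
  proof
    fix x assume "x \<in> zspan S"
    then show "x \<in> elts A" by induction (use S in \<open>auto intro: elts_diff\<close>)
  qed
qed (auto intro: zspan.intros)

instantiation zmod :: order
begin

definition less_eq_zmod :: "zmod \<Rightarrow> zmod \<Rightarrow> bool" where
  "A \<le> B \<longleftrightarrow> elts A \<subseteq> elts B"

definition less_zmod :: "zmod \<Rightarrow> zmod \<Rightarrow> bool" where
  "A < B \<longleftrightarrow> elts A \<subset> elts B"

instance
  by standard (auto simp: less_eq_zmod_def less_zmod_def elts_inject)

end

lemma zmod_leI: "(\<And>x. x \<in> elts A \<Longrightarrow> x \<in> elts B) \<Longrightarrow> A \<le> B"
  by (auto simp: less_eq_zmod_def)

lemma zmod_leD: "A \<le> B \<Longrightarrow> x \<in> elts A \<Longrightarrow> x \<in> elts B"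
  by (auto simp: less_eq_zmod_def)

text \<open>Scalars enter the semiring as cyclic groups: \<open>zgen z * A\<close> is
  \<open>A\<close> scaled by \<open>z\<close>, so scalings, ideals and their products obey one
  commutative algebra.\<close>

definition zgen :: "complex \<Rightarrow> zmod" where
  "zgen z = Abs_zmod (range (\<lambda>k::int. of_int k * z))"

lemma elts_zgen: "elts (zgen z) = range (\<lambda>k::int. of_int k * z)"
  unfolding zgen_def
proof (rule elts_Abs)
  show "is_zmod (range (\<lambda>k::int. of_int k * z))"
    unfolding is_zmod_def
    by (auto simp: image_iff simp flip: left_diff_distrib of_int_diff intro: exI[of _ 0])
qed

lemma zgen_le_iff: "zgen z \<le> A \<longleftrightarrow> z \<in> elts A"
proof
  show "zgen z \<le> A \<Longrightarrow> z \<in> elts A"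
    using zmod_leD[of "zgen z" A z] by (auto simp: elts_zgen image_iff intro: exI[of _ 1])
qed (auto simp: less_eq_zmod_def elts_zgen intro: elts_of_int)

instantiation zmod :: comm_semiring_1
begin

definition "0 = zgen 0"

definition "1 = zgen 1"

definition "A + B = Abs_zmod {a + b | a b. a \<in> elts A \<and> b \<in> elts B}"

definition "A * B = Abs_zmod (zspan {a * b | a b. a \<in> elts A \<and> b \<in> elts B})"

lemma elts_plus: "elts (A + B) = {a + b | a b. a \<in> elts A \<and> b \<in> elts B}"
  unfolding plus_zmod_def
proof (rule elts_Abs)
  have "a + b - (a' + b') \<in> {a + b | a b. a \<in> elts A \<and> b \<in> elts B}"
    if "a \<in> elts A" "b \<in> elts B" "a' \<in> elts A" "b' \<in> elts B" for a b a' b'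
    using elts_diff[of a A a'] elts_diff[of b B b'] that
    by (intro CollectI exI[of _ "a - a'"] exI[of _ "b - b'"]) simp
  then show "is_zmod {a + b | a b. a \<in> elts A \<and> b \<in> elts B}"
    unfolding is_zmod_def by (auto intro: exI[of _ 0])
qed

lemma mult_le_iff: "A * B \<le> C \<longleftrightarrow> (\<forall>a\<in>elts A. \<forall>b\<in>elts B. a * b \<in> elts C)" for A B C :: zmod
proof -
  have "A * B \<le> C \<longleftrightarrow> zspan {a * b | a b. a \<in> elts A \<and> b \<in> elts B} \<subseteq> elts C"
    by (simp add: less_eq_zmod_def times_zmod_def elts_Abs is_zmod_zspan)
  then show ?thesis by (auto simp: zspan_subset_iff)
qed

lemma plus_le_iff: "A + B \<le> C \<longleftrightarrow> A \<le> C \<and> B \<le> C" for A B C :: zmod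
proof
  assume *: "A + B \<le> C"
  have "elts A \<subseteq> elts (A + B)"  "elts B \<subseteq> elts (A + B)"
    by (force simp: elts_plus)+
  with * show "A \<le> C \<and> B \<le> C" by (auto simp: less_eq_zmod_def)
qed (auto simp: less_eq_zmod_def elts_plus intro!: elts_add)

lemma elts_mult: "a \<in> elts A \<Longrightarrow> b \<in> elts B \<Longrightarrow> a * b \<in> elts (A * B)"
  using mult_le_iff[of A B "A * B"] by simp

text \<open>Equality is tested through upper bounds. Sums and products are characterised by
  \<open>plus_le_iff\<close> and \<open>mult_le_iff\<close>, so identities follow without describing
  the elements of a product.\<close>

lemma zmod_eqI: "(\<And>C. A \<le> C \<longleftrightarrow> B \<le> C) \<Longrightarrow> A = B" for A B :: zmod
  by (metis order_antisym order_refl)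

text \<open>The multipliers that carry \<open>C\<close> into \<open>D\<close> form a subgroup, so
  the last factor can be moved to the other side of the inclusion.\<close>

lemma mult_mult_le_iff:
  "A * B * C \<le> D \<longleftrightarrow> (\<forall>a\<in>elts A. \<forall>b\<in>elts B. \<forall>c\<in>elts C. a * b * c \<in> elts D)" for A B C D :: zmod
proof -
  let ?S = "{x. \<forall>c\<in>elts C. x * c \<in> elts D}"
  have "is_zmod ?S"
    by (auto simp: is_zmod_def left_diff_distrib intro: elts_diff)
  then have "A * B * C \<le> D \<longleftrightarrow> A * B \<le> Abs_zmod ?S"
    by (subst mult_le_iff) (auto simp: less_eq_zmod_def elts_Abs)
  also have "\<dots> \<longleftrightarrow> (\<forall>a\<in>elts A. \<forall>b\<in>elts B. \<forall>c\<in>elts C. a * b * c \<in> elts D)"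
    using \<open>is_zmod ?S\<close> by (simp add: mult_le_iff elts_Abs)
  finally show ?thesis .
qed

instance
proof
  fix A B C :: zmod
  have "A * B \<le> B * A" for A B :: zmod
    unfolding mult_le_iff by (metis elts_mult mult.commute)
  then show comm: "A * B = B * A" for A B :: zmod
    by (simp add: order_antisym)
  show "A * B * C = A * (B * C)"
  proof (rule order_antisym)
    have le: "A * B * C \<le> A * (B * C)" for A B C :: zmod
      unfolding mult_mult_le_iff by (simp add: elts_mult mult.assoc)
    show "A * B * C \<le> A * (B * C)" by (rule le)
    show "A * (B * C) \<le> A * B * C"
      using le[of C B A] by (simp add: comm)
  qed
  show "A + B = B + A"
    by (rule zmod_eqI) (auto simp: plus_le_iff)
  show "A + B + C = A + (B + C)"
    by (rule zmod_eqI) (auto simp: plus_le_iff)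
  show "0 + A = A"
    by (rule zmod_eqI) (auto simp: plus_le_iff zero_zmod_def zgen_le_iff)
  show "1 * A = A"
  proof (rule order_antisym)
    show "1 * A \<le> A"
      by (auto simp: mult_le_iff one_zmod_def elts_zgen intro: elts_of_int)
    have "1 \<in> elts 1"
      by (simp add: one_zmod_def flip: zgen_le_iff)
    then have "x \<in> elts (1 * A)" if "x \<in> elts A" for x
      using elts_mult[OF _ that, of 1 1] by simp
    then show "A \<le> 1 * A"
      by (rule zmod_leI)
  qed
  have "0 * A \<le> 0"
    by (simp add: mult_le_iff zero_zmod_def elts_zgen)
  then show zero: "0 * A = 0"
    by (simp add: order_antisym zero_zmod_def zgen_le_iff)
  show "A * 0 = 0"
    by (simp only: comm[of A 0] zero)
  show "(A + B) * C = A * C + B * C"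
  proof (rule order_antisym)
    show "(A + B) * C \<le> A * C + B * C"
    proof -
      have "(a + b) * c \<in> elts (A * C + B * C)"
        if "a \<in> elts A" "b \<in> elts B" "c \<in> elts C" for a b c
        using elts_mult[OF that(1,3)] elts_mult[OF that(2,3)]
        by (auto simp: elts_plus distrib_right)
      then show ?thesis
        unfolding mult_le_iff by (auto simp: elts_plus[of A B])
    qed
    have "A \<le> A + B" "B \<le> A + B"
      using plus_le_iff[of A B "A + B"] by auto
    then have "A * C \<le> (A + B) * C" "B * C \<le> (A + B) * C"
      unfolding mult_le_iff[of A C] mult_le_iff[of B C] by (auto intro: elts_mult zmod_leD)
    then show "A * C + B * C \<le> (A + B) * C"
      by (simp add: plus_le_iff)
  qed
  show "(0::zmod) \<noteq> 1"
  proof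
    assume "(0::zmod) = 1"
    then have "(1::complex) \<in> elts (zgen 0)" by (simp add: zero_zmod_def one_zmod_def flip: zgen_le_iff)
    then show False by (simp add: elts_zgen)
  qed
qed

end

lemma zmod_mult_mono: "A \<le> B \<Longrightarrow> C \<le> E \<Longrightarrow> A * C \<le> B * E" for A B C E :: zmod
  by (meson mult_le_iff elts_mult zmod_leD)

lemma zmod_le_plus: "A \<le> A + B" "B \<le> A + B" for A B :: zmod
  using plus_le_iff[of A B "A + B"] by auto

lemma zgen_mult: "zgen x * zgen y = zgen (x * y)"
proof (rule zmod_eqI)
  fix C
  have "of_int k * x * (of_int l * y) \<in> elts C" if "x * y \<in> elts C" for k l
    using elts_of_int[OF that, of "k * l"] by (simp add: mult_ac)
  then show "zgen x * zgen y \<le> C \<longleftrightarrow> zgen (x * y) \<le> C"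
    by (auto simp: mult_le_iff zgen_le_iff elts_zgen dest!: spec[of _ 1])
qed

lemma elts_zgen_mult: "elts (zgen z * A) = (*) z ` elts A"
proof -
  have *: "is_zmod ((*) z ` elts A)"
    unfolding is_zmod_def
    by (auto simp: image_iff simp flip: right_diff_distrib intro: elts_diff)
  have "zgen z * A \<le> Abs_zmod ((*) z ` elts A)"
    unfolding mult_le_iff elts_Abs[OF *]
    by (auto simp: elts_zgen) (metis elts_of_int image_eqI mult.assoc mult.commute)
  moreover have "z \<in> elts (zgen z)" by (simp flip: zgen_le_iff)
  ultimately show ?thesis
    by (auto simp: less_eq_zmod_def elts_Abs[OF *] intro: elts_mult)
qed

lemma zgen_one: "zgen 1 = 1"
  by (simp add: one_zmod_def)

lemma elts_zgen_plus_zgen: "x \<in> elts (zgen a + zgen b) \<longleftrightarrow> (\<exists>i j::int. x = of_int i * a + of_int j * b)"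
  by (auto simp: elts_plus elts_zgen)

section \<open>Complex conjugation of subgroups\<close>

definition cj :: "zmod \<Rightarrow> zmod" where
  "cj A = Abs_zmod (cnj ` elts A)"

lemma elts_cj: "elts (cj A) = cnj ` elts A"
  unfolding cj_def
proof (rule elts_Abs)
  show "is_zmod (cnj ` elts A)"
    unfolding is_zmod_def
    by (auto simp: image_iff simp flip: complex_cnj_diff intro: elts_diff)
qed

lemma cnj_in_cj: "cnj x \<in> elts (cj A) \<longleftrightarrow> x \<in> elts A"
  by (auto simp: elts_cj image_iff)

lemma cj_cj [simp]: "cj (cj A) = A"
  by (simp add: elts_cj image_image flip: elts_inject)

lemma cj_le_iff: "cj A \<le> B \<longleftrightarrow> A \<le> cj B"
  unfolding less_eq_zmod_def subset_iff
  by (metis cj_cj cnj_in_cj complex_cnj_cnj)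

lemma cj_mono: "A \<le> B \<Longrightarrow> cj A \<le> cj B"
  by (simp add: cj_le_iff)

lemma cj_plus: "cj (A + B) = cj A + cj B"
  by (rule zmod_eqI) (auto simp: cj_le_iff plus_le_iff)

lemma cj_zgen: "cj (zgen z) = zgen (cnj z)"
  by (rule zmod_eqI) (metis cj_le_iff zgen_le_iff cnj_in_cj complex_cnj_cnj)

lemma cj_mult: "cj (A * B) = cj A * cj B"
proof (rule zmod_eqI)
  fix C
  show "cj (A * B) \<le> C \<longleftrightarrow> cj A * cj B \<le> C"
    by (simp add: mult_le_iff cj_le_iff elts_cj image_iff)
       (metis cj_cj cnj_in_cj complex_cnj_mult complex_cnj_cnj)
qed

lemma cj_one [simp]: "cj 1 = 1"
  by (simp add: cj_zgen flip: zgen_one)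

lemma cj_power: "cj (A ^ n) = cj A ^ n"
  by (induction n) (simp_all add: cj_mult)

section \<open>Invertible lattices over a quadratic order\<close>

definition disc :: "int \<Rightarrow> bool" where
  "disc D \<longleftrightarrow> D < 0 \<and> (D mod 4 = 0 \<or> D mod 4 = 1)"

text \<open>The generator (D + sqrt D) / 2 serves both residues of \<open>D\<close> modulo 4; its
  trace is \<open>D\<close> and its norm is (D^2 - D) / 4.\<close>

definition om :: "int \<Rightarrow> complex" where
  "om D = Complex (of_int D / 2) (sqrt (- of_int D) / 2)"

definition qord :: "int \<Rightarrow> zmod" where
  "qord D = 1 + zgen (om D)"

lemma elts_qord: "x \<in> elts (qord D) \<longleftrightarrow> (\<exists>i j::int. x = of_int i + of_int j * om D)"
  by (simp add: qord_def elts_zgen_plus_zgen flip: zgen_one)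

lemma disc_neg: "disc D \<Longrightarrow> D < 0"
  by (simp add: disc_def)

lemma disc_four_dvd: "4 dvd D * D - D" if "disc D"
proof -
  define k where "k = D div 4"
  have "D = 4 * k \<or> D = 4 * k + 1"
    using that unfolding disc_def k_def by presburger
  then have "D * D - D = 4 * (k * (D - 1)) \<or> D * D - D = 4 * (k * D)"
    by (elim disjE) (simp_all add: algebra_simps)
  then show ?thesis by (metis dvd_triv_left)
qed

lemma Im_om_pos: "disc D \<Longrightarrow> Im (om D) > 0"
  by (simp add: om_def disc_def)

lemma cnj_om: "cnj (om D) = of_int D - om D"
  by (simp add: complex_eq_iff om_def)

lemma om_mult_cnj: "om D * cnj (om D) = of_int ((D * D - D) div 4)" if assms: "disc D"
proof -
  obtain k where k: "D * D - D = 4 * k"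
    using disc_four_dvd[OF assms] by (auto simp: dvd_def)
  have "om D * cnj (om D) = (of_int (D * D - D) :: complex) / 4"
    using disc_neg[OF assms] by (simp add: om_def complex_eq_iff field_simps)
  then show ?thesis
    unfolding k by simp
qed

lemma om_square: "om D * om D = of_int D * om D - of_int ((D * D - D) div 4)" if "disc D"
  using om_mult_cnj[OF that] by (simp add: cnj_om algebra_simps)

lemma one_in_qord [simp]: "1 \<in> elts (qord D)"
  unfolding elts_qord by (rule exI[of _ 1]) (auto intro: exI[of _ 0])

lemma of_int_in_qord [simp]: "of_int k \<in> elts (qord D)"
  unfolding elts_qord by (rule exI[of _ k]) (auto intro: exI[of _ 0])

lemma om_in_qord [simp]: "om D \<in> elts (qord D)"
  unfolding elts_qord by (rule exI[of _ 0]) (auto intro: exI[of _ 1])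

lemma one_le_qord: "1 \<le> qord D"
  by (simp add: zgen_le_iff flip: zgen_one)

lemma qord_mult: "qord D * qord D = qord D" if "disc D"
proof -
  have "om D * om D \<in> elts (qord D)"
    unfolding om_square[OF that] by (intro elts_diff elts_of_int) auto
  then have "zgen (om D) * zgen (om D) \<le> qord D"
    by (simp add: zgen_mult zgen_le_iff)
  moreover have "qord D * qord D = 1 + zgen (om D) + (zgen (om D) + zgen (om D) * zgen (om D))"
    by (simp add: qord_def algebra_simps)
  ultimately have "qord D * qord D \<le> qord D"
    by (simp add: plus_le_iff zgen_le_iff one_le_qord)
  moreover have "qord D * 1 \<le> qord D * qord D"
    by (intro zmod_mult_mono one_le_qord) simp
  ultimately show ?thesis by simp
qed

lemma cj_qord [simp]: "cj (qord D) = qord D"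
proof -
  have "cj (qord D) \<le> qord D"
    unfolding qord_def[of D] cj_plus cj_zgen cj_one cnj_om plus_le_iff
    unfolding qord_def[symmetric] by (simp add: zgen_le_iff one_le_qord elts_diff)
  then show ?thesis
    using cj_mono[of "cj (qord D)" "qord D"] by simp
qed

lemma real_in_qord:
  assumes "disc D" "x \<in> elts (qord D)" "Im x = 0"
  shows "\<exists>k. x = of_int k"
  using assms Im_om_pos[OF assms(1)] by (auto simp: elts_qord)

text \<open>
  These are the invertible fractional ideals \<open>L\<close> of the order, together with their norm \<open>N\<close>:
  the last condition says that the inverse of \<open>L\<close> is \<open>cj L\<close> scaled by \<open>1 / N\<close>.
\<close>

definition lat :: "int \<Rightarrow> real \<Rightarrow> zmod \<Rightarrow> bool" where
  "lat D N L \<longleftrightarrow> N > 0 \<and> qord D * L = L \<and> L * cj L = zgen (of_real N) * qord D"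

lemma lat_pos: "lat D N L \<Longrightarrow> N > 0"
  and lat_qord_mult: "lat D N L \<Longrightarrow> qord D * L = L"
  and lat_mult_cj: "lat D N L \<Longrightarrow> L * cj L = zgen (of_real N) * qord D"
  by (simp_all add: lat_def)

lemma lat_qord: "disc D \<Longrightarrow> lat D 1 (qord D)"
  by (simp add: lat_def qord_mult zgen_one)

lemma lat_mult: "lat D (M * N) (K * L)" if "disc D" "lat D M K" "lat D N L"
proof -
  have "K * L * cj (K * L) = (K * cj K) * (L * cj L)"
    by (simp add: cj_mult mult_ac)
  also have "\<dots> = (zgen (of_real M) * zgen (of_real N)) * (qord D * qord D)"
    by (simp add: lat_mult_cj[OF that(2)] lat_mult_cj[OF that(3)] mult_ac)
  also have "\<dots> = zgen (of_real (M * N)) * qord D"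
    by (simp add: qord_mult[OF that(1)] zgen_mult)
  finally show ?thesis
    using that by (simp add: lat_def flip: mult.assoc)
qed

lemma lat_cj: "lat D N L \<Longrightarrow> lat D N (cj L)"
  using cj_mult[of "qord D" L] by (simp add: lat_def mult.commute[of "cj L"])

lemma lat_zgen: "lat D (N * (cmod z)\<^sup>2) (zgen z * L)" if "lat D N L" "z \<noteq> 0"
proof -
  have "zgen z * L * cj (zgen z * L) = (zgen z * zgen (cnj z)) * (L * cj L)"
    by (simp add: cj_mult cj_zgen mult_ac)
  also have "\<dots> = zgen (of_real (N * (cmod z)\<^sup>2)) * qord D"
  proof -
    have "zgen z * zgen (cnj z) * zgen (of_real N) = zgen (of_real (N * (cmod z)\<^sup>2))"
      unfolding zgen_mult of_real_mult complex_norm_square by (simp only: mult_ac)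
    then show ?thesis
      unfolding lat_mult_cj[OF that(1)] mult.assoc[symmetric] by (simp only:)
  qed
  finally show ?thesis
    using that by (simp add: lat_def mult.left_commute[of "qord D"])
qed

lemma lat_power: "disc D \<Longrightarrow> lat D N L \<Longrightarrow> lat D (N ^ n) (qord D * L ^ n)"
proof (induction n)
  case (Suc n)
  show ?case
    using lat_mult[OF Suc.prems Suc.IH[OF Suc.prems]] by (simp add: mult_ac)
qed (simp add: lat_qord)

definition linv :: "real \<Rightarrow> zmod \<Rightarrow> zmod" where
  "linv N L = zgen (of_real (1 / N)) * cj L"

lemma zgen_inverse_cancel: "z \<noteq> 0 \<Longrightarrow> zgen (1 / z) * (zgen z * A) = A"
  by (simp add: zgen_mult zgen_one flip: mult.assoc)

lemma lat_mult_linv: "lat D N L \<Longrightarrow> L * linv N L = qord D"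
  using zgen_inverse_cancel[of "of_real N" "qord D"] lat_pos[of D N L]
  by (simp add: linv_def mult.left_commute[of L] lat_mult_cj)

lemma lat_linv: "lat D (1 / N) (linv N L)" if "lat D N L"
  using lat_zgen[OF lat_cj[OF that], of "of_real (1 / N)"] lat_pos[OF that]
  by (simp add: linv_def power2_eq_square norm_divide)

lemma lat_mult_le_cancel:
  assumes "lat D N L" "L * A \<le> L * B" "qord D * A = A" "qord D * B = B"
  shows "A \<le> B"
proof -
  have "linv N L * (L * A) \<le> linv N L * (L * B)"
    by (rule zmod_mult_mono[OF order_refl assms(2)])
  then show ?thesis
    by (simp add: mult.assoc[symmetric] mult.commute[of "linv N L"] lat_mult_linv[OF assms(1)] assms)
qed

lemma lat_mult_cancel:
  assumes "lat D N L" "L * A = L * B" "qord D * A = A" "qord D * B = B"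
  shows "A = B"
  using lat_mult_le_cancel[OF assms(1) _ assms(3,4)] lat_mult_le_cancel[OF assms(1) _ assms(4,3)] assms(2)
  by (auto intro: order_antisym)

section \<open>Norms, integrality and division of lattices\<close>

lemma zgen_of_real_mult_qord_real:
  assumes "disc D" "N > 0" "x \<in> elts (zgen (of_real N) * qord D)" "Im x = 0"
  shows "\<exists>k. x = of_int k * of_real N"
proof -
  from assms(3) obtain y where y: "y \<in> elts (qord D)" "x = of_real N * y"
    by (auto simp: elts_zgen_mult)
  with assms(2,4) have "Im y = 0" by simp
  with real_in_qord[OF assms(1) y(1)] y(2) show ?thesis by (auto simp: mult.commute)
qed

text \<open>\<open>v * cnj v\<close> is a real element of \<open>L * cj L\<close>, hence an integer
  multiple of \<open>N\<close>, because the real elements of the order are integers. The multiples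
  are the values of the quadratic form attached to \<open>L\<close>.\<close>

lemma lat_norm_int:
  assumes "disc D" "lat D N L" "v \<in> elts L"
  shows "\<exists>n::nat. (cmod v)\<^sup>2 = n * N"
proof -
  have "v * cnj v \<in> elts (zgen (of_real N) * qord D)"
    using elts_mult[of v L "cnj v" "cj L"] assms by (simp add: lat_mult_cj cnj_in_cj)
  moreover have "Im (v * cnj v) = 0" by simp
  ultimately obtain k where k: "v * cnj v = of_int k * of_real N"
    using zgen_of_real_mult_qord_real[OF assms(1) lat_pos[OF assms(2)]] by blast
  then have "of_real ((cmod v)\<^sup>2) = (of_real (of_int k * N) :: complex)"
    by (simp only: complex_norm_square of_real_mult of_real_of_int_eq)
  then have "(cmod v)\<^sup>2 = of_int k * N" by (simp only: of_real_eq_iff)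
  moreover from this have "k \<ge> 0"
    using lat_pos[OF assms(2)] zero_le_power2[of "cmod v"] by (simp add: zero_le_mult_iff del: zero_le_power2)
  ultimately show ?thesis
    by (intro exI[of _ "nat k"]) simp
qed

text \<open>Each norm lies in the order scaled by the other one, so each is an integer multiple of
  the other.\<close>

lemma lat_unique:
  assumes "disc D" "lat D N L" "lat D M L"
  shows "M = N"
proof -
  have *: "\<exists>k::int. M = k * N" if "lat D N L" "lat D M L" for M N
  proof -
    have "of_real M * 1 \<in> elts (zgen (of_real M) * qord D)"
      unfolding elts_zgen_mult by (rule imageI) simp
    then have "of_real M \<in> elts (zgen (of_real N) * qord D)"
      using lat_mult_cj[OF that(1)] lat_mult_cj[OF that(2)] by simp
    with zgen_of_real_mult_qord_real[OF assms(1) lat_pos[OF that(1)]]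
    obtain k where "of_real M = of_int k * (of_real N :: complex)" by (metis Im_complex_of_real)
    then have "of_real M = (of_real (of_int k * N) :: complex)" by simp
    then show ?thesis by (metis of_real_eq_iff)
  qed
  obtain k l :: int where k: "M = k * N" and l: "N = l * M"
    using *[OF assms(2,3)] *[OF assms(3,2)] by metis
  have "M > 0" "N > 0" using lat_pos assms by auto
  then have "k > 0" using k by (simp add: zero_less_mult_iff)
  have "real_of_int (l * k) = 1" using k l \<open>M > 0\<close> by (simp add: field_simps)
  then have "l * k = 1" by linarith
  with \<open>k > 0\<close> have "k = 1" by (metis pos_zmult_eq_1_iff mult.commute)
  with k show ?thesis by simp
qed

lemma lat_integral_norm:
  assumes "disc D" "lat D N J" "J \<le> qord D"
  shows "\<exists>n::nat. n > 0 \<and> N = real n \<and> of_nat n \<in> elts J"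
proof -
  have "J * cj J \<le> J * qord D"
    using cj_mono[OF assms(3)] by (intro zmod_mult_mono) auto
  then have "zgen (of_real N) * qord D \<le> J"
    by (simp only: lat_mult_cj[OF assms(2)] lat_qord_mult[OF assms(2)] mult.commute[of J "qord D"])
  moreover have "of_real N * 1 \<in> elts (zgen (of_real N) * qord D)"
    unfolding elts_zgen_mult by (rule imageI) simp
  ultimately have N: "of_real N \<in> elts J" by (auto dest: zmod_leD)
  then have "of_real N \<in> elts (qord D)" using assms(3) by (auto dest: zmod_leD)
  with real_in_qord[OF assms(1) this] obtain k where k: "complex_of_real N = of_int k" by auto
  then have "complex_of_real N = of_real (of_int k)" by simp
  then have "N = of_int k" by (simp only: of_real_eq_iff)
  then show ?thesis
    using N k lat_pos[OF assms(2)] by (intro exI[of _ "nat k"]) auto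
qed

lemma lat_integral_norm_one:
  assumes "disc D" "lat D 1 J" "J \<le> qord D"
  shows "J = qord D"
proof -
  have "1 \<in> elts J" using lat_integral_norm[OF assms] by auto
  then have "qord D * 1 \<le> qord D * J"
    by (intro zmod_mult_mono) (auto simp: zgen_le_iff simp flip: zgen_one)
  with assms(3) show ?thesis
    by (simp add: lat_qord_mult[OF assms(2)])
qed

text \<open>To contain is to divide: the quotient is \<open>A\<close> times the inverse of
  \<open>B\<close>, and it is integral because \<open>B\<close> times its inverse is the
  order.\<close>

lemma lat_divide:
  assumes "disc D" "lat D N A" "lat D M B" "A \<le> B"
  shows "\<exists>K. lat D (N / M) K \<and> K \<le> qord D \<and> A = B * K"
proof (intro exI[of _ "A * linv M B"] conjI)
  show "lat D (N / M) (A * linv M B)"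
    using lat_mult[OF assms(1,2) lat_linv[OF assms(3)]] by simp
  show "A * linv M B \<le> qord D"
    using zmod_mult_mono[OF assms(4) order_refl, of "linv M B"] by (simp add: lat_mult_linv[OF assms(3)])
  show "A = B * (A * linv M B)"
    by (metis assms(2,3) lat_mult_linv lat_qord_mult mult.assoc mult.commute)
qed

lemma lat_nonzero:
  assumes "lat D N L"
  shows "\<exists>v\<in>elts L. v \<noteq> 0"
proof (rule ccontr)
  assume "\<not> ?thesis"
  then have "L \<le> 0" by (auto simp: less_eq_zmod_def zero_zmod_def elts_zgen)
  moreover have "0 \<le> L" by (simp add: zero_zmod_def zgen_le_iff)
  ultimately have "L = 0" by simp
  then have "zgen (of_real N) * qord D = 0" using lat_mult_cj[OF assms] by simp
  moreover have "of_real N * 1 \<in> elts (zgen (of_real N) * qord D)"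
    unfolding elts_zgen_mult by (rule imageI) simp
  ultimately show False using lat_pos[OF assms] by (simp add: zero_zmod_def elts_zgen)
qed

text \<open>Homothety by any nonzero complex number, not only by elements of the quadratic field;
  this leaves room for the rotation by a square root in \<open>lat_ambiguous_real\<close>.\<close>

definition sim :: "zmod \<Rightarrow> zmod \<Rightarrow> bool" (infix "\<approx>" 50) where
  "A \<approx> B \<longleftrightarrow> (\<exists>z. z \<noteq> 0 \<and> A = zgen z * B)"

lemma sim_refl [simp]: "A \<approx> A"
  unfolding sim_def by (rule exI[of _ 1]) (simp add: zgen_one)

lemma sim_sym: "A \<approx> B \<Longrightarrow> B \<approx> A"
  unfolding sim_def using zgen_inverse_cancel
  by (elim exE conjE) (rule exI[of _ "1 / z" for z], auto)

lemma sim_trans [trans]: "A \<approx> B \<Longrightarrow> B \<approx> C \<Longrightarrow> A \<approx> C"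
  unfolding sim_def
  by (elim exE, rule_tac x = "z * za" in exI) (auto simp flip: zgen_mult simp: mult.assoc)

lemma sim_mult: "A * C \<approx> B * E" if "A \<approx> B" "C \<approx> E"
proof -
  from that obtain y z where "y \<noteq> 0" "A = zgen y * B" "z \<noteq> 0" "C = zgen z * E"
    by (auto simp: sim_def)
  then have "y * z \<noteq> 0" "A * C = zgen (y * z) * (B * E)"
    by (simp_all add: mult_ac flip: zgen_mult)
  then show ?thesis unfolding sim_def by blast
qed

lemma sim_zgen: "z \<noteq> 0 \<Longrightarrow> zgen z * A \<approx> A"
  by (auto simp: sim_def)

lemma sim_mult_cj: "lat D N L \<Longrightarrow> L * cj L \<approx> qord D"
  using lat_pos[of D N L] by (simp add: lat_mult_cj sim_zgen)

lemma sim_mult_cancel: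
  assumes "lat D N L" "L * A \<approx> L * B" "qord D * A = A" "qord D * B = B"
  shows "A \<approx> B"
proof -
  from assms(2) obtain z where z: "z \<noteq> 0" "L * A = zgen z * (L * B)"
    by (auto simp: sim_def)
  then have "L * A = L * (zgen z * B)" by (simp add: mult_ac)
  with lat_mult_cancel[OF assms(1), of A "zgen z * B"] assms have "A = zgen z * B"
    by (metis mult.left_commute)
  with z show ?thesis by (auto simp: sim_def)
qed

section \<open>Lattices of quadratic forms\<close>

text \<open>This is (b + sqrt D) / 2, with trace \<open>b\<close> and, for a form of discriminant
  \<open>D\<close>, norm \<open>a * c\<close>. If \<open>b\<close> has the parity of
  \<open>D\<close>, it generates the order just as \<open>om D\<close> does.\<close>

definition beta :: "int \<Rightarrow> int \<Rightarrow> complex" where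
  "beta D b = Complex (of_int b / 2) (sqrt (- of_int D) / 2)"

text \<open>On this lattice, the form with coefficients \<open>a, b, c\<close> is the squared modulus divided by \<open>a\<close>.\<close>

definition flat :: "int \<Rightarrow> int \<Rightarrow> int \<Rightarrow> zmod" where
  "flat D a b = zgen (of_int a) + zgen (beta D b)"

lemma Im_beta_pos: "disc D \<Longrightarrow> Im (beta D b) > 0"
  by (simp add: beta_def disc_def)

lemma beta_om: "beta D b = om D + of_int k" if "b = D + 2 * k"
  using that by (simp add: complex_eq_iff beta_def om_def)

lemma beta_cnj: "cnj (beta D b) = of_int b - beta D b"
  by (simp add: complex_eq_iff beta_def)

lemma beta_mult_cnj: "beta D b * cnj (beta D b) = of_int (a * c)"
  if "disc D" "b\<^sup>2 - 4 * a * c = D" for a b c :: int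
proof -
  have "D \<le> 0" using that by (simp add: disc_def)
  then have "sqrt (- of_int D) * sqrt (- of_int D) = - of_int D"
    by (simp flip: power2_eq_square)
  also have "- real_of_int D = 4 * of_int a * of_int c - of_int b * of_int b"
    unfolding that(2)[symmetric] by (simp add: power2_eq_square)
  finally show ?thesis
    by (simp add: complex_eq_iff beta_def field_simps)
qed

lemma beta_square: "beta D b * beta D b = of_int b * beta D b - of_int (a * c)"
  if "disc D" "b\<^sup>2 - 4 * a * c = D" for a b c :: int
  using beta_mult_cnj[OF that] unfolding beta_cnj by (simp add: algebra_simps)

lemma form_parity: "\<exists>k. b = D + 2 * k" if "b\<^sup>2 - 4 * a * c = D" for a b c :: int
proof -
  have "even (b - D)" unfolding that[symmetric] by (simp add: power2_eq_square)
  then show ?thesis by (metis dvdE diff_add_cancel add.commute)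
qed

lemma qord_eq_beta: "qord D = 1 + zgen (beta D b)" if "b = D + 2 * k"
proof (rule order_antisym)
  have "om D = beta D b - of_int k * 1" using beta_om[OF that] by simp
  moreover have "1 \<in> elts (1 + zgen (beta D b))" "beta D b \<in> elts (1 + zgen (beta D b))"
    using zmod_le_plus[of 1 "zgen (beta D b)"] zmod_le_plus[of "zgen (beta D b)" 1]
    by (simp_all add: zgen_le_iff add.commute flip: zgen_one)
  ultimately show "qord D \<le> 1 + zgen (beta D b)"
    by (auto simp: qord_def plus_le_iff zgen_le_iff zmod_le_plus intro!: elts_diff elts_of_int
        simp del: mult.right_neutral)
  show "1 + zgen (beta D b) \<le> qord D"
    by (simp add: plus_le_iff one_le_qord zgen_le_iff beta_om[OF that] elts_add)
qed

text \<open>The product with the conjugate is \<open>a\<close> times the group spanned by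
  \<open>a\<close>, \<open>c\<close>, \<open>beta D b\<close> and its conjugate. That group contains
  \<open>b\<close>, so primitivity puts 1 into it: primitive forms give invertible lattices.\<close>

lemma lat_flat:
  assumes "disc D" "b\<^sup>2 - 4 * a * c = D" "a > 0" "gcd a (gcd b c) = 1"
  shows "lat D (of_int a) (flat D a b)"
proof -
  obtain k where k: "b = D + 2 * k" using form_parity[OF assms(2)] by blast
  let ?b = "beta D b" and ?L = "flat D a b"
  note O = qord_eq_beta[OF k]
  have a: "of_int a \<in> elts ?L" and b: "?b \<in> elts ?L"
    using order_refl[of ?L] unfolding flat_def[of D a b] plus_le_iff zgen_le_iff by auto
  have ab: "of_int a * ?b \<in> elts ?L" using elts_of_int[OF b] .
  have bb: "?b * ?b \<in> elts ?L"
    unfolding beta_square[OF assms(1,2)] using elts_of_int[OF b, of b] elts_of_int[OF a, of c]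
    by (auto intro: elts_diff simp: mult.commute)
  have "zgen ?b * ?L \<le> ?L"
    by (simp add: flat_def[of D a b] distrib_left zgen_mult plus_le_iff zgen_le_iff mult.commute[of ?b "of_int a"])
       (simp add: ab bb flip: flat_def)
  then have "qord D * ?L \<le> ?L"
    unfolding O by (simp add: distrib_right plus_le_iff)
  moreover have "1 * ?L \<le> qord D * ?L"
    by (intro zmod_mult_mono one_le_qord) simp
  ultimately have 1: "qord D * ?L = ?L" by simp
  have cj: "cj ?L = zgen (of_int a) + zgen (cnj ?b)"
    by (simp add: flat_def cj_plus cj_zgen)
  have "?L * cj ?L = zgen (of_int a) * zgen (of_int a) + zgen (of_int a) * zgen (cnj ?b)
      + (zgen ?b * zgen (of_int a) + zgen ?b * zgen (cnj ?b))"
    unfolding cj by (simp add: flat_def algebra_simps)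
  also have "\<dots> = zgen (of_int a) * (zgen (of_int a) + zgen (cnj ?b) + (zgen ?b + zgen (of_int c)))"
    unfolding zgen_mult beta_mult_cnj[OF assms(1,2)] by (simp add: zgen_mult algebra_simps)
  also have "zgen (of_int a) + zgen (cnj ?b) + (zgen ?b + zgen (of_int c)) = qord D" (is "?S = _")
  proof (rule order_antisym)
    have "?b \<in> elts (qord D)" unfolding beta_om[OF k] by (intro elts_add) auto
    moreover have "cnj ?b \<in> elts (qord D)"
      unfolding beta_cnj by (intro elts_diff) (use calculation in auto)
    ultimately show "?S \<le> qord D" by (simp add: plus_le_iff zgen_le_iff)
    have S: "of_int a \<in> elts ?S" "cnj ?b \<in> elts ?S" "?b \<in> elts ?S" "of_int c \<in> elts ?S"
      using order_refl[of ?S] unfolding plus_le_iff zgen_le_iff by auto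
    have bS: "of_int b \<in> elts ?S"
      using elts_add[OF S(2,3)] unfolding beta_cnj by simp
    obtain x y where "a * x + gcd b c * y = 1"
      using bezout_int[of a "gcd b c"] assms(4) by (metis mult.commute)
    moreover obtain z w where "z * b + w * c = gcd b c"
      using bezout_int[of b c] by metis
    moreover have "x * a + (y * z) * b + (y * w) * c = a * x + (z * b + w * c) * y"
      by (simp add: algebra_simps)
    ultimately have e: "1 = x * a + (y * z) * b + (y * w) * c" by simp
    have "of_int (x * a + (y * z) * b + (y * w) * c) \<in> elts ?S"
      unfolding of_int_add of_int_mult[of x a] of_int_mult[of "y * z" b] of_int_mult[of "y * w" c]
      by (intro elts_add elts_of_int S bS)
    then have "1 \<in> elts ?S" unfolding e[symmetric] by simp
    then show "qord D \<le> ?S"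
      unfolding O by (simp add: plus_le_iff zgen_le_iff S flip: zgen_one)
  qed
  finally show ?thesis using assms 1 by (simp add: lat_def)
qed

lemma qord_beta_cases:
  assumes "b = D + 2 * k" "x \<in> elts (qord D)"
  obtains i j :: int where "x = of_int i + of_int j * beta D b"
  using assms by (auto simp: qord_eq_beta[OF assms(1)] elts_zgen_plus_zgen simp flip: zgen_one)

lemma flat_elts_iff:
  assumes "disc D"
  shows "of_int i + of_int j * beta D b \<in> elts (flat D a b) \<longleftrightarrow> a dvd i"
proof
  assume "of_int i + of_int j * beta D b \<in> elts (flat D a b)"
  then obtain k l :: int where e: "of_int i + of_int j * beta D b = of_int k * of_int a + of_int l * beta D b"
    by (auto simp: flat_def elts_zgen_plus_zgen)
  then have "Im (of_int i + of_int j * beta D b) = Im (of_int k * of_int a + of_int l * beta D b)"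
    by (rule arg_cong)
  then have "j = l" using Im_beta_pos[OF assms, of b] by simp
  with e have "of_int i = (of_int (k * a) :: complex)" by simp
  then show "a dvd i" by (simp only: of_int_eq_iff dvd_triv_right)
next
  assume "a dvd i"
  then obtain k where "i = a * k" by blast
  then show "of_int i + of_int j * beta D b \<in> elts (flat D a b)"
    unfolding flat_def elts_zgen_plus_zgen by (intro exI[of _ k] exI[of _ j]) (simp add: mult.commute)
qed

lemma flat_le_qord: "flat D a b \<le> qord D" if "b = D + 2 * k"
  by (simp add: flat_def plus_le_iff zgen_le_iff beta_om[OF that] elts_add)

text \<open>Because beta^2 = b beta - p c, reducing modulo \<open>p\<close> and sending beta to 0 is
  a ring homomorphism from the order onto the field with \<open>p\<close> elements.
  \<open>flat D p b\<close> is its kernel.\<close>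

lemma flat_prime:
  assumes "disc D" "b\<^sup>2 - 4 * p * c = D" "prime p"
    and "A \<le> qord D" "B \<le> qord D" "A * B \<le> flat D p b"
  shows "A \<le> flat D p b \<or> B \<le> flat D p b"
proof (rule ccontr)
  obtain k where k: "b = D + 2 * k" using form_parity[OF assms(2)] by blast
  assume "\<not> ?thesis"
  then obtain x y where xy: "x \<in> elts A" "x \<notin> elts (flat D p b)" "y \<in> elts B" "y \<notin> elts (flat D p b)"
    by (auto simp: less_eq_zmod_def)
  obtain i j where x: "x = of_int i + of_int j * beta D b"
    by (rule qord_beta_cases[OF k zmod_leD[OF assms(4) xy(1)]])
  obtain i' j' where y: "y = of_int i' + of_int j' * beta D b"
    by (rule qord_beta_cases[OF k zmod_leD[OF assms(5) xy(3)]])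
  have "x * y \<in> elts (flat D p b)"
    using elts_mult[OF xy(1,3)] assms(6) by (rule zmod_leD[rotated])
  moreover have "x * y = of_int i * of_int i' + (of_int i * of_int j' + of_int j * of_int i') * beta D b
      + of_int j * of_int j' * (beta D b * beta D b)"
    by (simp add: x y algebra_simps)
  then have "x * y = of_int (i * i' - j * j' * p * c) + of_int (i * j' + j * i' + j * j' * b) * beta D b"
    unfolding beta_square[OF assms(1,2)] by (simp add: algebra_simps)
  ultimately have "p dvd i * i' - j * j' * p * c"
    by (simp only: flat_elts_iff[OF assms(1)])
  then have "p dvd i * i'"
    by (metis dvd_diff_right_iff dvd_mult2 dvd_triv_right dvd_diff_left_iff)
  then have "p dvd i \<or> p dvd i'" using assms(3) by (simp add: prime_dvd_mult_iff)
  then show False using xy(2,4) by (simp add: x y flat_elts_iff[OF assms(1)])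
qed

text \<open>\<open>J * cj J\<close> is \<open>p * n\<close> times the order and so lies in the prime
  ideal, which must then contain one of the two factors.\<close>

lemma flat_prime_dvd_norm:
  assumes "disc D" "b\<^sup>2 - 4 * p * c = D" "prime p"
    and "lat D (of_int (p * n)) J" "J \<le> qord D"
  shows "J \<le> flat D p b \<or> J \<le> cj (flat D p b)"
proof -
  obtain k where k: "b = D + 2 * k" using form_parity[OF assms(2)] by blast
  have "of_int p * x \<in> elts (flat D p b)" if xO: "x \<in> elts (qord D)" for x
  proof -
    obtain i j where x: "x = of_int i + of_int j * beta D b"
      by (rule qord_beta_cases[OF k xO])
    have "of_int (p * i) + of_int (p * j) * beta D b \<in> elts (flat D p b)"
      by (simp only: flat_elts_iff[OF assms(1)] dvd_triv_left)
    then show ?thesis by (simp add: x algebra_simps)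
  qed
  then have "of_int n * (of_int p * x) \<in> elts (flat D p b)" if "x \<in> elts (qord D)" for x
    using that elts_of_int by blast
  then have "zgen (of_real (of_int (p * n))) * qord D \<le> flat D p b"
    unfolding less_eq_zmod_def elts_zgen_mult by (auto simp: mult_ac)
  then have "J * cj J \<le> flat D p b"
    by (simp only: lat_mult_cj[OF assms(4)])
  moreover have "cj J \<le> qord D" using cj_mono[OF assms(5)] by simp
  ultimately show ?thesis
    using flat_prime[OF assms(1,2,3,5)] by (metis cj_le_iff)
qed

lemma cj_flat_eq:
  assumes "disc D" "b\<^sup>2 - 4 * a * c = D" "a dvd b"
  shows "cj (flat D a b) = flat D a b"
proof -
  have *: "of_int b + of_int (- 1) * beta D b \<in> elts (flat D a b)"
    unfolding flat_elts_iff[OF assms(1)] by fact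
  have "of_int a + of_int 0 * beta D b \<in> elts (flat D a b)"
    unfolding flat_elts_iff[OF assms(1)] by simp
  moreover have "cj (flat D a b) = zgen (of_int a) + zgen (of_int b - beta D b)"
    by (simp add: flat_def cj_plus cj_zgen beta_cnj)
  ultimately have "cj (flat D a b) \<le> flat D a b"
    using * by (simp add: plus_le_iff zgen_le_iff)
  then show ?thesis using cj_mono[of "cj (flat D a b)" "flat D a b"] by simp
qed

section \<open>Ramified primes and absorbing ideals\<close>

definition absorbing :: "int \<Rightarrow> nat \<Rightarrow> zmod \<Rightarrow> bool" where
  "absorbing D d J \<longleftrightarrow> lat D (real d) J \<and> J \<le> qord D \<and>
     (\<forall>I k. lat D (real (d * k)) I \<longrightarrow> I \<le> qord D \<longrightarrow> I \<le> J)"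

text \<open>For a discriminant \<open>D\<close> this says that \<open>q\<close> divides the
  conductor: D / q^2 is again a discriminant. The fundamental discriminant does not have to be
  introduced.\<close>

definition conductor_dvd :: "int \<Rightarrow> nat \<Rightarrow> bool" where
  "conductor_dvd D q \<longleftrightarrow> (\<exists>D'. D = (int q)\<^sup>2 * D' \<and> (D' mod 4 = 0 \<or> D' mod 4 = 1))"

text \<open>A form (q, b, c) with \<open>q\<close> dividing \<open>b\<close> describes the
  self-conjugate ideal over \<open>q\<close>. If \<open>q\<close> divided \<open>c\<close> as well,
  D / q^2 would be a discriminant.\<close>

lemma ramified_form:
  fixes q :: nat
  assumes "disc D" "prime q" "int q dvd D" "\<not> conductor_dvd D q"
  shows "\<exists>b c. b\<^sup>2 - 4 * int q * c = D \<and> int q dvd b \<and> \<not> int q dvd c"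
proof (cases "q = 2")
  case True
  with assms(1,3) have "D mod 4 = 0" by (auto simp: disc_def) presburger
  then obtain D' where D': "D = 4 * D'" by auto
  have "\<not> (D' mod 4 = 0 \<or> D' mod 4 = 1)"
    using assms(4) unfolding conductor_dvd_def True D' by auto
  then have "(\<exists>e. D' = 4 * e + 2) \<or> (\<exists>e. D' = 4 * e + 3)" by presburger
  then consider "\<exists>e. D' = 4 * e + 2" | "\<exists>e. D' = 4 * e + 3" by blast
  then show ?thesis
  proof cases
    case 1
    then obtain e where "D' = 4 * e + 2" ..
    then show ?thesis
      unfolding True D' by (intro exI[of _ 0] exI[of _ "- 2 * e - 1"]) simp
  next
    case 2
    then obtain e where "D' = 4 * e + 3" ..
    then show ?thesis
      unfolding True D' by (intro exI[of _ 2] exI[of _ "- 2 * e - 1"]) simp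
  qed
next
  case False
  then have odd: "odd q" using assms(2) prime_odd_nat[of q] prime_gt_1_nat[of q] by fastforce
  define b where "b = (if even D then 0 else int q)"
  have q2: "(int q)\<^sup>2 mod 4 = 1"
  proof -
    obtain m where "int q = 2 * m + 1" using odd by (metis even_of_nat oddE)
    then have "(int q)\<^sup>2 = 4 * (m * m + m) + 1" by (simp add: power2_eq_square algebra_simps)
    then show ?thesis by presburger
  qed
  have "4 dvd b\<^sup>2 - D"
    using assms(1) q2 unfolding b_def disc_def by (auto simp: mod_eq_dvd_iff) presburger+
  moreover have "int q dvd b\<^sup>2 - D"
    using assms(3) by (simp add: b_def)
  moreover have "coprime (2 ^ 2) (int q)"
    using odd by (subst coprime_power_left_iff) simp
  then have "coprime 4 (int q)" by simp
  ultimately have "4 * int q dvd b\<^sup>2 - D" by (rule divides_mult)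
  then obtain c where c: "b\<^sup>2 - D = 4 * int q * c" by blast
  have "int q dvd b" by (simp add: b_def)
  moreover have "\<not> int q dvd c"
  proof
    assume "int q dvd c"
    with c have "(int q)\<^sup>2 dvd b\<^sup>2 - D" by (auto simp: power2_eq_square)
    moreover have "(int q)\<^sup>2 dvd b\<^sup>2" by (simp add: b_def)
    ultimately have "(int q)\<^sup>2 dvd D" by (metis dvd_diff_right_iff)
    then obtain E where E: "D = (int q)\<^sup>2 * E" by blast
    then have "D mod 4 = E mod 4" using q2 by (metis mod_mult_left_eq mult_1)
    with assms(1,4) E show False by (auto simp: conductor_dvd_def disc_def)
  qed
  ultimately show ?thesis using c by (intro exI[of _ b] exI[of _ c]) auto
qed

text \<open>The ideal over \<open>q\<close> equals its conjugate, so the two alternatives of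
  \<open>flat_prime_dvd_norm\<close> coincide.\<close>

lemma ramified_absorbing:
  assumes "disc D" "prime q" "int q dvd D" "\<not> conductor_dvd D q"
  shows "\<exists>J. absorbing D q J"
proof -
  obtain b c where bc: "b\<^sup>2 - 4 * int q * c = D" "int q dvd b" "\<not> int q dvd c"
    using ramified_form[OF assms] by blast
  have pq: "prime (int q)" using assms(2) by simp
  have q: "gcd (int q) (gcd b c) = 1"
    using bc(3) pq by (metis coprime_iff_gcd_eq_1 dvd_trans gcd_dvd2 prime_imp_coprime)
  have "int q > 0" using assms(2) prime_gt_0_nat by simp
  note L = lat_flat[OF assms(1) bc(1) this q]
  obtain k where k: "b = D + 2 * k" using form_parity[OF bc(1)] by blast
  have "absorbing D q (flat D q b)"
    unfolding absorbing_def
  proof (intro conjI allI impI)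
    fix I m assume "lat D (real (q * m)) I" "I \<le> qord D"
    then show "I \<le> flat D q b"
      using flat_prime_dvd_norm[OF assms(1) bc(1) pq, of "int m" I] cj_flat_eq[OF assms(1) bc(1,2)] by simp
  qed (use L flat_le_qord[OF k] in auto)
  then show ?thesis ..
qed

text \<open>Products of absorbing ideals are absorbing: one prime factor of \<open>n\<close> at a
  time, the same ideal is divided out of \<open>J\<close> and out of the ideal to be compared with
  it.\<close>

lemma absorbing_primes:
  assumes "disc D" "lat D (real n) J" "J \<le> qord D"
    and "\<And>q. prime q \<Longrightarrow> q dvd n \<Longrightarrow> \<exists>K. absorbing D q K"
  shows "absorbing D n J"
  using assms(2-)
proof (induction n arbitrary: J rule: less_induct)
  case (less n)
  have "n > 0" using lat_pos[OF less.prems(1)] by simp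
  show ?case
  proof (cases "n = 1")
    case True
    then have "J = qord D" using lat_integral_norm_one[OF assms(1)] less.prems by simp
    with True less.prems show ?thesis by (simp add: absorbing_def)
  next
    case False
    then obtain q where q: "prime q" "q dvd n" by (metis prime_factor_nat)
    then obtain m where m: "n = q * m" by blast
    have "m < n" using m \<open>n > 0\<close> prime_gt_1_nat[OF q(1)] by simp
    have "q > 0" using prime_gt_0_nat[OF q(1)] .
    obtain K where K: "absorbing D q K" using less.prems(3) q by blast
    have div: "\<exists>I'. lat D (real l) I' \<and> I' \<le> qord D \<and> I = K * I'"
      if "lat D (real (q * l)) I" "I \<le> qord D" for I l
      using lat_divide[OF assms(1) that(1), of q K] that K \<open>q > 0\<close>
      by (auto simp: absorbing_def)
    obtain J' where J': "lat D (real m) J'" "J' \<le> qord D" "J = K * J'"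
      using div[of m J] less.prems m by auto
    have "absorbing D m J'"
      by (rule less.IH[OF \<open>m < n\<close> J'(1,2)]) (use less.prems(3) m in auto)
    then have "I \<le> J" if I: "lat D (real (n * l)) I" "I \<le> qord D" for I l
    proof -
      obtain I' where I': "lat D (real (m * l)) I'" "I' \<le> qord D" "I = K * I'"
        using div[of "m * l" I] I m by (auto simp: mult.assoc)
      then have "I' \<le> J'" using \<open>absorbing D m J'\<close> by (auto simp: absorbing_def)
      then show ?thesis unfolding I' J' by (intro zmod_mult_mono) auto
    qed
    with less.prems show ?thesis by (auto simp: absorbing_def)
  qed
qed

section \<open>Finiteness of the class group\<close>

lemma one_plus_zgen_shift: "1 + zgen (u - of_int k) = 1 + zgen u"
proof -
  have le: "1 + zgen (u - of_int k) \<le> 1 + zgen u" for u k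
  proof -
    have "1 \<in> elts (1 + zgen u)" "u \<in> elts (1 + zgen u)"
      using order_refl[of "1 + zgen u"] unfolding plus_le_iff by (simp_all add: zgen_le_iff flip: zgen_one)
    then have "u - of_int k * 1 \<in> elts (1 + zgen u)"
      by (intro elts_diff elts_of_int)
    then show ?thesis
      by (simp add: plus_le_iff zgen_le_iff zmod_le_plus)
  qed
  show ?thesis
    using le[of u k] le[of "u - of_int k" "- k"] by (simp add: order_antisym)
qed

lemma lat_one_le:
  assumes "lat D N L" "1 \<in> elts L"
  shows "qord D \<le> L" "L \<le> zgen (of_real N) * qord D"
proof -
  have one: "1 \<le> L" using assms(2) by (simp add: zgen_le_iff flip: zgen_one)
  then show "qord D \<le> L"
    using zmod_mult_mono[OF order_refl one, of "qord D"] lat_qord_mult[OF assms(1)] by simp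
  have "1 \<le> cj L" using cj_mono[OF one] by simp
  then show "L \<le> zgen (of_real N) * qord D"
    using zmod_mult_mono[OF order_refl, of 1 "cj L" L] lat_mult_cj[OF assms(1)] by simp
qed

text \<open>\<open>u\<close> is an element of least positive imaginary part; subtracting a multiple
  of it from any element leaves a real one, hence an integer. The exact value of
  \<open>Im u\<close>, the covolume, is read off from \<open>L * cj L\<close>.\<close>

lemma lat_basis:
  assumes "disc D" "lat D N L" "1 \<in> elts L"
    and real: "\<And>x. x \<in> elts L \<Longrightarrow> Im x = 0 \<Longrightarrow> \<exists>k. x = of_int k"
  shows "\<exists>u. L = 1 + zgen u \<and> Im u = N * Im (om D)"
proof -
  define s where "s = Im (om D)"
  have s: "s > 0" using Im_om_pos[OF assms(1)] by (simp add: s_def)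
  have N: "N > 0" using lat_pos[OF assms(2)] .
  have im: "\<exists>k::int. Im v = k * (N * s)" if "v \<in> elts L" for v
  proof -
    have "v \<in> elts (zgen (of_real N) * qord D)"
      using lat_one_le(2)[OF assms(2,3)] that by (rule zmod_leD)
    then obtain y where y: "y \<in> elts (qord D)" "v = of_real N * y"
      by (auto simp: elts_zgen_mult)
    then obtain i j :: int where "v = of_real N * (of_int i + of_int j * om D)"
      unfolding elts_qord by blast
    then show ?thesis by (intro exI[of _ j]) (simp add: s_def)
  qed
  define T where "T = {t. (0::nat) < t \<and> (\<exists>v\<in>elts L. Im v = real t * (N * s))}"
  have om: "om D \<in> elts L"
    using lat_one_le(1)[OF assms(2,3)] by (rule zmod_leD) simp
  obtain k :: int where k: "s = k * (N * s)" using im[OF om] by (auto simp: s_def)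
  then have "k > 0" using s N by (metis mult_pos_pos of_int_0_less_iff zero_less_mult_pos2)
  then have "nat k \<in> T" using om k by (auto simp: T_def s_def intro!: bexI[of _ "om D"])
  define t where "t = (LEAST t. t \<in> T)"
  have "t \<in> T" unfolding t_def by (rule LeastI[where P = "\<lambda>t. t \<in> T", OF \<open>nat k \<in> T\<close>])
  then obtain u where t: "t > 0" and u: "u \<in> elts L" "Im u = t * (N * s)"
    by (auto simp: T_def)
  have least: "r \<notin> T" if "r < t" for r
    using that not_less_Least unfolding t_def by blast
  have "L \<le> 1 + zgen u"
  proof (rule zmod_leI)
    fix v assume v: "v \<in> elts L"
    then obtain k where k: "Im v = of_int k * (N * s)" using im by blast
    define w where "w = v - of_int (k div int t) * u"
    have w: "w \<in> elts L" unfolding w_def by (intro elts_diff elts_of_int v u)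
    have "real_of_int k = of_int (k div int t) * of_int (int t) + of_int (k mod int t)"
      unfolding of_int_mult[symmetric] of_int_add[symmetric] by simp
    then have "Im w = of_int (k mod int t) * (N * s)"
      by (simp add: w_def k u(2) algebra_simps)
    then have imw: "Im w = nat (k mod int t) * (N * s)" using t by simp
    have "nat (k mod int t) \<in> T" if "nat (k mod int t) > 0"
      using that w imw unfolding T_def by blast
    moreover have "nat (k mod int t) \<notin> T"
      using t by (intro least) (simp add: nat_less_iff)
    ultimately have "Im w = 0" using imw by (cases "nat (k mod int t)") auto
    then obtain m where "w = of_int m" using real[OF w] by blast
    then have "v = of_int m * 1 + of_int (k div int t) * u" by (simp add: w_def diff_eq_eq)
    then show "v \<in> elts (1 + zgen u)"
      unfolding zgen_one[symmetric] elts_zgen_plus_zgen by blast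
  qed
  moreover have "1 + zgen u \<le> L"
    using assms(3) u by (simp add: plus_le_iff zgen_le_iff flip: zgen_one)
  ultimately have L: "L = 1 + zgen u" by simp
  \<comment> \<open>\<open>L * cj L\<close> is spanned by 1, \<open>u\<close>, \<open>cnj u\<close>
    and a real number, so its imaginary parts are multiples of \<open>Im u\<close>. It also contains
    \<open>N\<close> times \<open>om D\<close>, of imaginary part \<open>N * s\<close>, which forces
    \<open>t = 1\<close>.\<close>
  let ?C = "{x. \<exists>k::int. Im x = of_int k * (t * (N * s))}"
  have C: "is_zmod ?C"
    by (auto simp: is_zmod_def intro: exI[of _ 0] simp flip: left_diff_distrib of_int_diff)
  have "L * cj L = 1 + zgen u + (zgen (cnj u) + zgen (u * cnj u))"
    by (simp add: L cj_plus cj_zgen zgen_mult algebra_simps)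
  also have "\<dots> \<le> Abs_zmod ?C"
    unfolding zgen_one[symmetric] plus_le_iff zgen_le_iff elts_Abs[OF C]
    using u(2) by (auto intro: exI[of _ 0] exI[of _ 1] exI[of _ "- 1"])
  finally have "zgen (of_real N) * qord D \<le> Abs_zmod ?C"
    by (simp add: lat_mult_cj[OF assms(2)])
  moreover have "of_real N * om D \<in> elts (zgen (of_real N) * qord D)"
    unfolding elts_zgen_mult by (rule imageI) simp
  ultimately have "of_real N * om D \<in> ?C"
    unfolding less_eq_zmod_def elts_Abs[OF C] by blast
  then obtain l :: int where l: "N * s = of_int l * (t * (N * s))" by (auto simp: s_def)
  then have "real_of_int (l * int t) = 1" using s N by (simp add: field_simps)
  then have "l * int t = 1" by linarith
  then have "int t dvd int 1" by (metis dvd_triv_right of_nat_1)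
  then have "t = 1" by (simp only: int_dvd_int_iff nat_dvd_1_iff_1)
  with L u show ?thesis by (auto simp: s_def)
qed

lemma real_elts_int:
  assumes "1 \<in> elts L" and "\<And>x. x \<in> elts L \<Longrightarrow> Im x = 0 \<Longrightarrow> x \<noteq> 0 \<Longrightarrow> cmod x \<ge> 1"
    and "x \<in> elts L" "Im x = 0"
  shows "\<exists>k. x = of_int k"
proof -
  define y where "y = x - of_int \<lfloor>Re x\<rfloor> * 1"
  have "y \<in> elts L" unfolding y_def by (intro elts_diff elts_of_int assms)
  moreover have "Im y = 0" by (simp add: y_def assms)
  moreover have "cmod y < 1"
    using \<open>Im y = 0\<close> by (simp add: cmod_eq_Re y_def) linarith
  ultimately have "y = 0" using assms(2) by fastforce
  then show ?thesis by (auto simp: y_def)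
qed

text \<open>Squared lengths are natural multiples of \<open>N\<close>, so a minimum exists under any
  restriction \<open>R\<close>. The trivial restriction serves reduction, the restriction to real
  elements serves self-conjugate lattices.\<close>

lemma lat_shortest:
  assumes "disc D" "lat D N L" "\<exists>v\<in>elts L. v \<noteq> 0 \<and> R v"
  obtains v m where "v \<in> elts L" "v \<noteq> 0" "R v" "m > 0" "(cmod v)\<^sup>2 = real m * N"
    "\<And>x. x \<in> elts L \<Longrightarrow> x \<noteq> 0 \<Longrightarrow> R x \<Longrightarrow> cmod v \<le> cmod x"
proof -
  have N: "N > 0" using lat_pos[OF assms(2)] .
  define M where "M = {m::nat. \<exists>v\<in>elts L. v \<noteq> 0 \<and> R v \<and> (cmod v)\<^sup>2 = real m * N}"
  have M: "\<exists>m. m \<in> M \<and> (cmod v)\<^sup>2 = real m * N" if "v \<in> elts L" "v \<noteq> 0" "R v" for v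
    using lat_norm_int[OF assms(1,2) that(1)] that by (auto simp: M_def)
  then obtain m0 where "m0 \<in> M" using assms(3) by blast
  define m where "m = (LEAST m. m \<in> M)"
  have "m \<in> M" unfolding m_def by (rule LeastI[where P = "\<lambda>m. m \<in> M", OF \<open>m0 \<in> M\<close>])
  then obtain v where v: "v \<in> elts L" "v \<noteq> 0" "R v" "(cmod v)\<^sup>2 = real m * N"
    by (auto simp: M_def)
  show thesis
  proof (rule that[OF v(1-3) _ v(4)])
    show "m > 0" using v by (cases m) auto
    fix x assume x: "x \<in> elts L" "x \<noteq> 0" "R x"
    then obtain n where n: "n \<in> M" "(cmod x)\<^sup>2 = real n * N" using M by blast
    then have "m \<le> n" unfolding m_def by (simp add: Least_le)
    then have "(cmod v)\<^sup>2 \<le> (cmod x)\<^sup>2"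
      unfolding v(4) n(2) using N by (intro mult_right_mono) auto
    then show "cmod v \<le> cmod x" by (simp add: abs_le_square_iff[symmetric])
  qed
qed

text \<open>Gauss reduction: with the shortest vector scaled to 1, a second basis vector of real
  part at most 1/2 in absolute value still has length at least 1. This bounds its imaginary part
  from below and so \<open>m\<close> from above.\<close>

lemma lat_reduced:
  assumes "disc D" "lat D N L"
  shows "\<exists>L' m. L' \<approx> L \<and> m > 0 \<and> lat D (1 / real m) L' \<and> int m * int m \<le> - D \<and> 1 \<in> elts L'
    \<and> (\<exists>u. L' = 1 + zgen u \<and> Im u = Im (om D) / real m)"
proof -
  have N: "N > 0" using lat_pos[OF assms(2)] .
  obtain v m where v: "v \<in> elts L" "v \<noteq> 0" "m > 0" "(cmod v)\<^sup>2 = real m * N"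
    "\<And>x. x \<in> elts L \<Longrightarrow> x \<noteq> 0 \<Longrightarrow> cmod v \<le> cmod x"
    using lat_shortest[OF assms, of "\<lambda>_. True"] lat_nonzero[OF assms(2)] by auto
  define L' where "L' = zgen (1 / v) * L"
  have elts_L': "x \<in> elts L' \<longleftrightarrow> v * x \<in> elts L" for x
    using v(2) by (auto simp: L'_def elts_zgen_mult image_iff intro!: bexI[of _ "v * x"])
  have one: "1 \<in> elts L'" using v by (simp add: elts_L')
  have short: "cmod x \<ge> 1" if "x \<in> elts L'" "x \<noteq> 0" for x
    using v(5)[of "v * x"] that v(2) by (simp add: elts_L' norm_mult)
  have lat': "lat D (1 / real m) L'"
    using lat_zgen[OF assms(2), of "1 / v"] v N by (simp add: L'_def norm_divide power_divide)
  obtain u where u: "L' = 1 + zgen u" "Im u = 1 / real m * Im (om D)"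
    using lat_basis[OF assms(1) lat' one] real_elts_int[OF one] short by blast
  define w where "w = u - of_int (round (Re u)) * 1"
  have "u \<in> elts L'" unfolding u(1) using zmod_le_plus(2)[of "zgen u" 1] by (simp add: zgen_le_iff)
  then have w: "w \<in> elts L'" unfolding w_def by (intro elts_diff elts_of_int one)
  have Imw: "Im w = Im (om D) / real m" by (simp add: w_def u(2))
  then have "w \<noteq> 0" using Im_om_pos[OF assms(1)] v(3) by auto
  then have "cmod w \<ge> 1" using short w by blast
  then have "1 \<le> (Re w)\<^sup>2 + (Im w)\<^sup>2"
    by (metis cmod_power2 one_le_power)
  moreover have "\<bar>Re w\<bar> \<le> 1 / 2"
    using of_int_round_abs_le[of "Re u"] by (simp add: w_def abs_minus_commute)
  then have "(Re w)\<^sup>2 \<le> (1 / 2)\<^sup>2" by (simp add: abs_le_square_iff[symmetric])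
  ultimately have "3 / 4 \<le> (Im w)\<^sup>2" by (simp add: power2_eq_square)
  also have "(Im w)\<^sup>2 = - of_int D / 4 / (real m)\<^sup>2"
    using disc_neg[OF assms(1)] by (simp add: Imw om_def power_divide)
  finally have "3 * (real m)\<^sup>2 \<le> - of_int D" using v(3) by (simp add: field_simps)
  then have "(real m)\<^sup>2 \<le> - of_int D" using zero_le_power2[of "real m"] by linarith
  then have "real_of_int (int m * int m) \<le> real_of_int (- D)" by (simp add: power2_eq_square)
  then have "int m * int m \<le> - D" by (simp only: of_int_le_iff)
  moreover have "L' \<approx> L" unfolding L'_def using v(2) by (intro sim_zgen) simp
  moreover have "Im u = Im (om D) / real m" using u(2) by simp
  ultimately show ?thesis using v(3) lat' one u(1) by blast
qed

text \<open>The converse of \<open>lat_flat\<close>: trace and norm of \<open>u\<close> lie in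
  \<open>M * cj M\<close>, so \<open>a\<close> times each of them is an integer. Primitivity holds
  because 1 / a itself lies in \<open>M * cj M\<close>.\<close>

lemma lat_basis_form:
  assumes "disc D" "a > 0" "lat D (1 / real a) M" "M = 1 + zgen u" "Im u = Im (om D) / real a"
  obtains b c where "of_nat a * u = beta D b" "b\<^sup>2 - 4 * int a * c = D" "gcd (int a) (gcd b c) = 1"
    "\<And>x y. real a * (cmod (of_int x + of_int y * u))\<^sup>2 = of_int (int a * x\<^sup>2 + b * x * y + c * y\<^sup>2)"
proof -
  have uM: "u \<in> elts M" and one: "1 \<in> elts M"
    using order_refl[of M] unfolding assms(4) plus_le_iff by (simp_all add: zgen_le_iff flip: zgen_one)
  have a: "1 / real a > 0" using assms(2) by simp
  have elt: "x * cnj y \<in> elts (zgen (of_real (1 / real a)) * qord D)" if "x \<in> elts M" "y \<in> elts M" for x y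
    using elts_mult[of x M "cnj y" "cj M"] that lat_mult_cj[OF assms(3)] by (simp add: cnj_in_cj)
  have "u + cnj u \<in> elts (zgen (of_real (1 / real a)) * qord D)"
    using elts_add[OF elt[OF uM one] elt[OF one uM]] by simp
  from zgen_of_real_mult_qord_real[OF assms(1) a this]
  obtain b where b: "u + cnj u = of_int b * of_real (1 / real a)" by auto
  from zgen_of_real_mult_qord_real[OF assms(1) a elt[OF uM uM]]
  obtain c where c: "u * cnj u = of_int c * of_real (1 / real a)" by auto
  have "of_real (2 * Re u) = (of_real (of_int b / real a) :: complex)"
    using b by (simp add: complex_add_cnj)
  then have re: "2 * Re u = of_int b / real a" by (simp only: of_real_eq_iff)
  have "of_real ((cmod u)\<^sup>2) = (of_real (of_int c / real a) :: complex)"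
    using c by (simp add: complex_norm_square del: of_real_power)
  then have norm_u: "(cmod u)\<^sup>2 = of_int c / real a" by (simp only: of_real_eq_iff)
  have "Re u = of_int b / (2 * real a)" using re by simp
  then have au: "of_nat a * u = beta D b"
    using assms(2) by (simp add: complex_eq_iff beta_def om_def assms(5))
  have "real_of_int D = - 4 * (real a)\<^sup>2 * (Im u)\<^sup>2"
    using disc_neg[OF assms(1)] assms(2) by (simp add: assms(5) om_def power_divide)
  also have "\<dots> = (real a)\<^sup>2 * (2 * Re u)\<^sup>2 - 4 * (real a)\<^sup>2 * (cmod u)\<^sup>2"
    by (simp add: cmod_power2 power_mult_distrib algebra_simps)
  also have "\<dots> = of_int (b\<^sup>2 - 4 * int a * c)"
    unfolding re norm_u using assms(2) by (simp add: power2_eq_square)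
  finally have D: "b\<^sup>2 - 4 * int a * c = D" by (simp only: of_int_eq_iff)
  have g: "gcd (int a) (gcd b c) = 1"
  proof -
    have "M * cj M = 1 + zgen u + (zgen (cnj u) + zgen (u * cnj u))"
      by (simp add: assms(4) cj_plus cj_zgen zgen_mult algebra_simps)
    moreover have "of_real (1 / real a) * 1 \<in> elts (M * cj M)"
      unfolding lat_mult_cj[OF assms(3)] elts_zgen_mult by (rule imageI) simp
    ultimately obtain x y z t :: int where
      "1 / of_nat a = of_int x + of_int y * u + (of_int z * cnj u + of_int t * (u * cnj u))"
      unfolding zgen_one[symmetric] by (auto simp: elts_plus elts_zgen)
    then have e1: "1 / of_nat a = of_int x + of_int y * u + (of_int z * cnj u + of_int t * (of_int c * of_real (1 / real a)))"
      unfolding c .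
    then have "Im (1 / of_nat a) = Im (of_int x + of_int y * u + (of_int z * cnj u + of_int t * (of_int c * of_real (1 / real a))))"
      by (rule arg_cong)
    then have "of_int y * Im u = of_int z * Im u" by simp
    moreover have "Im u \<noteq> 0" using assms(2,5) Im_om_pos[OF assms(1)] by simp
    ultimately have "y = z" by simp
    then have "1 / of_nat a = of_int x + of_int y * (u + cnj u) + of_int t * (of_int c * of_real (1 / real a))"
      by (subst e1) (simp only: distrib_left add.assoc)
    then have "(1 :: complex) = of_int (int a * x + (b * y + c * t))"
      unfolding b using assms(2) by (simp add: field_simps)
    then have "1 = int a * x + (b * y + c * t)" by (metis of_int_1 of_int_eq_iff)
    moreover have "gcd (int a) (gcd b c) dvd int a * x + (b * y + c * t)"
      by (intro dvd_add dvd_mult2 gcd_dvd1 dvd_trans[OF gcd_dvd2 gcd_dvd1] dvd_trans[OF gcd_dvd2 gcd_dvd2])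
    ultimately have "gcd (int a) (gcd b c) dvd 1" by simp
    then show ?thesis by simp
  qed
  have "real a * (cmod (of_int x + of_int y * u))\<^sup>2 = of_int (int a * x\<^sup>2 + b * x * y + c * y\<^sup>2)" for x y
  proof -
    have "(cmod (of_int x + of_int y * u))\<^sup>2 = (of_int x)\<^sup>2 + of_int x * of_int y * (2 * Re u) + (of_int y)\<^sup>2 * (cmod u)\<^sup>2"
      unfolding cmod_power2 by (simp add: power2_eq_square algebra_simps)
    then show ?thesis unfolding re norm_u using assms(2) by (simp add: field_simps)
  qed
  then show thesis by (rule that[OF au D g])
qed

text \<open>The two bounds have a quotient of order m^2, and a group between them is determined by
  which of the m^2 representatives indexed by \<open>B\<close> it contains.\<close>

lemma finite_between:
  assumes "m > 0"
  shows "finite {L. qord D \<le> L \<and> L \<le> zgen (1 / of_nat m) * qord D}"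
proof -
  define pt where "pt = (\<lambda>(x, y). (of_int x + of_int y * om D) / of_nat m)"
  define B where "B = {0..<int m} \<times> {0..<int m}"
  define f where "f L = {p \<in> B. pt p \<in> elts L}" for L
  let ?S = "{L. qord D \<le> L \<and> L \<le> zgen (1 / of_nat m) * qord D}"
  have le: "K \<le> L" if "qord D \<le> K" "K \<le> zgen (1 / of_nat m) * qord D" "qord D \<le> L" "f K = f L" for K L
  proof (rule zmod_leI)
    fix x assume x: "x \<in> elts K"
    then have "x \<in> elts (zgen (1 / of_nat m) * qord D)" using that(2) by (rule zmod_leD[rotated])
    then obtain y where y: "y \<in> elts (qord D)" "x = 1 / of_nat m * y"
      unfolding elts_zgen_mult by blast
    then obtain i j :: int where "y = of_int i + of_int j * om D"
      unfolding elts_qord by blast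
    with y have ij: "x = pt (i, j)" by (simp add: pt_def)
    define q where "q = of_int (i div int m) + of_int (j div int m) * om D"
    define p where "p = (i mod int m, j mod int m)"
    have q: "q \<in> elts (qord D)" by (auto simp: q_def elts_qord)
    have split: "(of_int k :: complex) = of_int (k div int m) * of_nat m + of_int (k mod int m)" for k
      by (metis div_mult_mod_eq of_int_add of_int_mult of_int_of_nat_eq)
    have eq: "x = q + pt p"
      unfolding ij q_def p_def pt_def using assms by (simp add: split[of i] split[of j] field_simps)
    have "p \<in> B" using assms by (simp add: B_def p_def)
    moreover have "pt p \<in> elts K"
      using elts_diff[OF x zmod_leD[OF that(1) q]] by (simp add: eq)
    ultimately have "p \<in> f L" using that(4) by (auto simp: f_def)
    then have "pt p \<in> elts L" by (simp add: f_def)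
    then show "x \<in> elts L"
      unfolding eq using zmod_leD[OF that(3) q] by (intro elts_add)
  qed
  have "inj_on f ?S"
    by (rule inj_onI) (auto intro!: order_antisym le)
  moreover have "f ` ?S \<subseteq> Pow B" by (auto simp: f_def)
  moreover have "finite (Pow B)" by (simp add: B_def)
  ultimately show ?thesis by (meson finite_imageD finite_subset)
qed

lemma finite_classes:
  assumes "disc D"
  obtains R where "finite R" "\<And>N L. lat D N L \<Longrightarrow> \<exists>L'\<in>R. L' \<approx> L"
proof
  define R where "R = (\<Union>m\<in>{1..nat (- D)}. {L. qord D \<le> L \<and> L \<le> zgen (1 / of_nat m) * qord D})"
  show "finite R" unfolding R_def by (intro finite_UN_I finite_between) auto
  fix N L assume "lat D N L"
  then obtain L' m where L': "L' \<approx> L" "m > 0" "lat D (1 / real m) L'" "int m * int m \<le> - D" "1 \<in> elts L'"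
    using lat_reduced[OF assms] by blast
  have "int m * 1 \<le> int m * int m" using L'(2) by (intro mult_left_mono) auto
  with L'(4) have "int m \<le> - D" by linarith
  with L'(2) have "m \<in> {1..nat (- D)}" by auto
  moreover have "L' \<le> zgen (1 / of_nat m) * qord D"
    using lat_one_le(2)[OF L'(3,5)] by simp
  ultimately show "\<exists>L'\<in>R. L' \<approx> L"
    using L'(1) lat_one_le(1)[OF L'(3,5)] unfolding R_def by blast
qed

text \<open>Two powers of \<open>P\<close> share one of the finitely many classes, and the lower
  power can be cancelled.\<close>

lemma finite_class_order:
  assumes "disc D" "lat D N P"
  shows "\<exists>h>0. qord D * P ^ h \<approx> qord D"
proof -
  obtain R where R: "finite R" "\<And>N L. lat D N L \<Longrightarrow> \<exists>L'\<in>R. L' \<approx> L"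
    using finite_classes[OF assms(1)] by blast
  have "\<forall>i. \<exists>L'\<in>R. L' \<approx> qord D * P ^ i"
    using R(2) lat_power[OF assms] by blast
  then obtain f where f: "\<And>i. f i \<in> R" "\<And>i. f i \<approx> qord D * P ^ i" by metis
  have "finite (range f)" using R(1) f(1) by (meson finite_subset image_subsetI)
  then have "\<not> inj f" using finite_imageD infinite_UNIV_nat by blast
  then obtain i j where "i < j" "f i = f j"
    unfolding inj_on_def by (metis linorder_neqE_nat)
  then have "qord D * P ^ j \<approx> qord D * P ^ i" using f(2) by (metis sim_sym sim_trans)
  moreover have "qord D * P ^ j = qord D * P ^ i * (qord D * P ^ (j - i))"
    using \<open>i < j\<close> qord_mult[OF assms(1)] by (simp add: mult_ac flip: power_add mult.assoc)
  moreover have "qord D * P ^ i = qord D * P ^ i * qord D"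
    using qord_mult[OF assms(1)] by (simp add: mult_ac flip: mult.assoc)
  ultimately have "qord D * P ^ i * (qord D * P ^ (j - i)) \<approx> qord D * P ^ i * qord D" by simp
  then have "qord D * P ^ (j - i) \<approx> qord D"
    by (rule sim_mult_cancel[OF lat_power[OF assms]])
       (simp_all add: qord_mult[OF assms(1)] flip: mult.assoc)
  with \<open>i < j\<close> show ?thesis by (intro exI[of _ "j - i"]) simp
qed

section \<open>Ambiguous classes\<close>

text \<open>
  Only the orders of discriminant \<open>- 3\<close> and \<open>- 4\<close> have units besides \<open>1\<close> and \<open>- 1\<close>. The condition
  says that removing a prime from the conductor always leads to one of these.
\<close>

definition no_bad_reduction :: "int \<Rightarrow> bool" where
  "no_bad_reduction D \<longleftrightarrow> (\<forall>q. prime q \<longrightarrow> conductor_dvd D q \<longrightarrow> D = - 3 * (int q)\<^sup>2 \<or> D = - 4 * (int q)\<^sup>2)"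

lemma three_squares_neq_four_squares:
  fixes q r :: nat
  assumes "prime q" "prime r"
  shows "3 * (int q)\<^sup>2 \<noteq> 4 * (int r)\<^sup>2"
proof
  assume eq: "3 * (int q)\<^sup>2 = 4 * (int r)\<^sup>2"
  then have "even (3 * (int q)\<^sup>2)" by simp
  then have "even q" by simp
  then have "q = 2" using assms(1) by (metis prime_odd_nat prime_gt_1_nat le_neq_implies_less prime_ge_2_nat)
  with eq have "(int r)\<^sup>2 = 3" by simp
  moreover have "(2::int)\<^sup>2 \<le> (int r)\<^sup>2"
    using prime_ge_2_nat[OF assms(2)] by (intro power_mono) auto
  ultimately show False by simp
qed

lemma bad_prime_unique:
  assumes "no_bad_reduction D" "prime q" "conductor_dvd D q" "prime r" "conductor_dvd D r"
  shows "q = r"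
proof -
  have q: "D = - 3 * (int q)\<^sup>2 \<or> D = - 4 * (int q)\<^sup>2" and r: "D = - 3 * (int r)\<^sup>2 \<or> D = - 4 * (int r)\<^sup>2"
    using assms by (auto simp: no_bad_reduction_def)
  have "(int q)\<^sup>2 = (int r)\<^sup>2"
    using q r three_squares_neq_four_squares[OF assms(2,4)] three_squares_neq_four_squares[OF assms(4,2)] by auto
  then show ?thesis by simp
qed

text \<open>The two numbers are norms of two ideals in one ambiguous class. Only one prime divides
  the conductor, so a failure means that this \<open>q\<close> divides both numbers; coprimality of
  \<open>a\<close> and \<open>c\<close> then forces \<open>e = 1\<close>, \<open>q = 2\<close> and
  \<open>D\<close> equal to -12 or -16.\<close>

lemma ambiguous_form_good:
  fixes a c :: int
  assumes "no_bad_reduction D" "disc D" "a > 0" "coprime a c" "e = 0 \<or> e = 1" "D = e * a\<^sup>2 - 4 * a * c"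
  shows "(\<forall>q. prime q \<longrightarrow> int q dvd a \<longrightarrow> \<not> conductor_dvd D q) \<or>
    (\<forall>q. prime q \<longrightarrow> int q dvd (if e = 0 then c else 4 * c - a) \<longrightarrow> \<not> conductor_dvd D q)"
proof (rule ccontr)
  assume "\<not> ?thesis"
  then obtain q r where q: "prime q" "int q dvd a" "conductor_dvd D q"
    and r: "prime r" "int r dvd (if e = 0 then c else 4 * c - a)" "conductor_dvd D r"
    by blast
  have "r = q" using bad_prime_unique[OF assms(1) r(1,3) q(1,3)] .
  note r = r[unfolded this]
  have pq: "prime (int q)" using q(1) by simp
  have nc: "\<not> int q dvd c" using assms(4) q(2) pq by (meson coprime_common_divisor not_prime_unit)
  with r(2) assms(5) have e: "e = 1" "int q dvd 4 * c - a" by (auto split: if_splits)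
  then have "int q dvd 4 * c" using q(2) by (metis dvd_diff_left_iff)
  then have "int q dvd 2 ^ 2" using nc prime_dvd_mult_iff[OF pq, of 4 c] by simp
  then have "int q dvd 2" using prime_dvd_power[OF pq] by blast
  then have "int q = 2" using zdvd_imp_le[of "int q" 2] prime_ge_2_nat[OF q(1)] by simp
  have "D = - 3 * (int q)\<^sup>2 \<or> D = - 4 * (int q)\<^sup>2"
    using assms(1) q(1,3) unfolding no_bad_reduction_def by blast
  then have "D = -12 \<or> D = -16" unfolding \<open>int q = 2\<close> by simp
  obtain b where b: "a = 2 * b" using q(2) \<open>int q = 2\<close> by auto
  have "b > 0" using assms(3) b by simp
  \<comment> \<open>For both discriminants every admissible divisor \<open>b\<close> of 3 or 4 leads
    to \<open>c = 2\<close>, although \<open>q = 2\<close> does not divide \<open>c\<close>.\<close>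
  have D: "D = 4 * (b * (b - 2 * c))" using assms(6) e(1) by (simp add: b power2_eq_square algebra_simps)
  with \<open>D = -12 \<or> D = -16\<close> have bc: "b * (2 * c - b) = 3 \<or> b * (2 * c - b) = 4" by (auto simp: algebra_simps)
  then have "b dvd 3 \<or> b dvd 4" by (metis dvd_triv_left)
  then have "b \<le> 4" using zdvd_imp_le[of b 3] zdvd_imp_le[of b 4] by auto
  with \<open>b > 0\<close> have "b \<in> {1, 2, 3, 4}" by auto
  with bc have "c = 2" by auto
  with nc \<open>int q = 2\<close> show False by simp
qed

text \<open>A value of the form attached to \<open>L\<close> becomes the norm of an integral ideal
  in the class of \<open>L\<close>: \<open>cnj v\<close> times \<open>L\<close> lies in
  \<open>cj L * L\<close>, which is the order divided by \<open>a\<close>.\<close>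

lemma lat_scale_elt:
  assumes "disc D" "lat D (1 / real a) L" "v \<in> elts L" "v \<noteq> 0" "a > 0"
  shows "lat D (real a * (cmod v)\<^sup>2) (zgen (of_nat a * cnj v) * L)" "zgen (of_nat a * cnj v) * L \<le> qord D"
proof -
  show "lat D (real a * (cmod v)\<^sup>2) (zgen (of_nat a * cnj v) * L)"
    using lat_zgen[OF assms(2), of "of_nat a * cnj v"] assms(4,5)
    by (simp add: norm_mult power_mult_distrib power2_eq_square mult_ac)
  have "zgen (cnj v) \<le> cj L" using assms(3) by (simp add: zgen_le_iff cnj_in_cj)
  then have "zgen (cnj v) * L \<le> zgen (1 / of_nat a) * qord D"
    using zmod_mult_mono[of "zgen (cnj v)" "cj L" L L] lat_mult_cj[OF assms(2)] by (simp add: mult.commute)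
  then have "zgen (of_nat a) * (zgen (cnj v) * L) \<le> zgen (of_nat a) * (zgen (1 / of_nat a) * qord D)"
    by (rule zmod_mult_mono[OF order_refl])
  then show "zgen (of_nat a * cnj v) * L \<le> qord D"
    using assms(5) by (simp add: zgen_mult zgen_one flip: mult.assoc)
qed

text \<open>Comparing norms in \<open>L = zgen z * cj L\<close> gives |z| = 1. Rotating by the
  conjugate of a square root of \<open>z\<close> splits the factor evenly between \<open>L\<close>
  and \<open>cj L\<close>, so that equivalence becomes equality.\<close>

lemma lat_ambiguous_real:
  assumes "disc D" "lat D N L" "L \<approx> cj L"
  shows "\<exists>M. M \<approx> L \<and> lat D N M \<and> cj M = M"
proof -
  from assms(3) obtain z where z: "z \<noteq> 0" "L = zgen z * cj L" by (auto simp: sim_def)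
  have "lat D (N * (cmod z)\<^sup>2) L"
    using lat_zgen[OF lat_cj[OF assms(2)] z(1)] unfolding z(2)[symmetric] .
  then have "N * (cmod z)\<^sup>2 = N" by (rule lat_unique[OF assms(1,2)])
  then have "(cmod z)\<^sup>2 = 1" using lat_pos[OF assms(2)] by simp
  then have "cmod z = 1" by (metis abs_norm_cancel abs_square_eq_1)
  define w where "w = csqrt z"
  have w: "w * w = z" by (simp add: w_def flip: power2_eq_square)
  have "cmod w * cmod w = 1" using \<open>cmod z = 1\<close> unfolding w[symmetric] by (simp add: norm_mult)
  then have cw: "cmod w = 1" by (metis abs_norm_cancel abs_square_eq_1 power2_eq_square)
  have wc: "w * cnj w = 1" using complex_norm_square[of w] cw by simp
  define M where "M = zgen (cnj w) * L"
  have "cj M = zgen w * cj L" by (simp add: M_def cj_mult cj_zgen)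
  also have "\<dots> = zgen (cnj w * z) * cj L"
    using wc by (simp add: w[symmetric] mult.assoc[symmetric] mult.commute)
  also have "\<dots> = zgen (cnj w) * L" by (subst (2) z(2)) (simp add: zgen_mult flip: mult.assoc)
  finally have "cj M = M" by (simp add: M_def)
  moreover have "cnj w \<noteq> 0" using cw by auto
  then have "M \<approx> L" "lat D N M"
    using lat_zgen[OF assms(2), of "cnj w"] cw by (simp_all add: M_def sim_zgen)
  ultimately show ?thesis by blast
qed

text \<open>These are the ambiguous forms (a, 0, c) and (a, a, c). Scaling the shortest real element
  to 1 keeps the lattice self-conjugate; then \<open>u + cnj u\<close> is a real element, hence an
  integer, and translating \<open>u\<close> leaves only 0 or 1.\<close>

lemma lat_ambiguous_normal:
  assumes "disc D" "lat D N L" "cj L = L"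
  obtains M a u e where "M \<approx> L" "a > 0" "lat D (1 / real a) M" "M = 1 + zgen u"
    "Im u = Im (om D) / real a" "2 * Re u = real_of_int e" "e = 0 \<or> e = 1"
proof -
  have N: "N > 0" using lat_pos[OF assms(2)] .
  have ex: "\<exists>v\<in>elts L. v \<noteq> 0 \<and> Im v = 0"
  proof -
    have re: ?thesis if x: "x \<in> elts L" "Re x \<noteq> 0" for x
    proof (rule bexI[of _ "x + cnj x"])
      show "x + cnj x \<in> elts L"
        using x(1) assms(3) by (metis cnj_in_cj elts_add)
    qed (use x(2) in \<open>simp add: complex_eq_iff\<close>)
    obtain v where v: "v \<in> elts L" "v \<noteq> 0" using lat_nonzero[OF assms(2)] by blast
    show ?thesis
    \<comment> \<open>Adding the conjugate gives a nonzero real element unless \<open>v\<close> is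
      purely imaginary; multiplication by \<open>om D\<close> moves such a \<open>v\<close> off the
      imaginary axis.\<close>
    proof (cases "Re v = 0")
      case True
      have "om D * v \<in> elts L"
        using elts_mult[of "om D" "qord D" v L] v lat_qord_mult[OF assms(2)] by simp
      moreover have "Re (om D * v) \<noteq> 0"
        using True v(2) Im_om_pos[OF assms(1)] by (simp add: complex_eq_iff)
      ultimately show ?thesis by (rule re)
    qed (use re v in blast)
  qed
  obtain r a where r: "r \<in> elts L" "r \<noteq> 0" "Im r = 0" "a > 0" "(cmod r)\<^sup>2 = real a * N"
    "\<And>x. x \<in> elts L \<Longrightarrow> x \<noteq> 0 \<Longrightarrow> Im x = 0 \<Longrightarrow> cmod r \<le> cmod x"
    by (rule lat_shortest[OF assms(1,2), where R = "\<lambda>v. Im v = 0", OF ex]) blast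
  define M where "M = zgen (1 / r) * L"
  have elts_M: "x \<in> elts M \<longleftrightarrow> r * x \<in> elts L" for x
    using r(2) by (auto simp: M_def elts_zgen_mult image_iff intro!: bexI[of _ "r * x"])
  have one: "1 \<in> elts M" using r by (simp add: elts_M)
  have cr: "cnj r = r" using r(3) by (simp add: complex_eq_iff)
  have cjM: "cj M = M" by (simp add: M_def cj_mult cj_zgen assms(3) cr)
  have short: "cmod x \<ge> 1" if "x \<in> elts M" "Im x = 0" "x \<noteq> 0" for x
    using r(6)[of "r * x"] that r(2,3) by (simp add: elts_M norm_mult)
  have latM: "lat D (1 / real a) M"
    using lat_zgen[OF assms(2), of "1 / r"] r N by (simp add: M_def norm_divide power_divide)
  note int = real_elts_int[OF one short]
  obtain u where u: "M = 1 + zgen u" "Im u = 1 / real a * Im (om D)"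
    using lat_basis[OF assms(1) latM one int] by blast
  have uM: "u \<in> elts M" unfolding u(1) using zmod_le_plus(2)[of "zgen u" 1] by (simp add: zgen_le_iff)
  then have "cnj u \<in> elts M" using cjM cnj_in_cj by metis
  with uM have "u + cnj u \<in> elts M" by (rule elts_add)
  then obtain k where "u + cnj u = of_int k" using int[of "u + cnj u"] by auto
  then have k: "2 * Re u = of_int k" by (auto simp: complex_eq_iff)
  show thesis
  proof (rule that)
    show "M \<approx> L" unfolding M_def using r(2) by (intro sim_zgen) simp
    show "M = 1 + zgen (u - of_int (k div 2))" by (simp only: one_plus_zgen_shift u(1))
    have "real_of_int k = 2 * of_int (k div 2) + of_int (k mod 2)"
      by (metis mult_div_mod_eq of_int_add of_int_mult of_int_numeral)
    then show "2 * Re (u - of_int (k div 2)) = of_int (k mod 2)" using k by simp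
    show "k mod 2 = 0 \<or> k mod 2 = 1" by presburger
  qed (use r(4) latM u(2) in auto)
qed

text \<open>The form takes the values \<open>a\<close> and, according to \<open>e\<close>,
  \<open>c\<close> or 4c - a. They divide \<open>D\<close>, so their prime factors are ramified; one
  of the two values avoids the conductor and yields an absorbing ideal.\<close>

lemma ambiguous_absorbing:
  assumes "disc D" "no_bad_reduction D" "lat D N L" "L \<approx> cj L"
  shows "\<exists>d J. absorbing D d J \<and> J \<approx> L"
proof -
  obtain L1 where L1: "L1 \<approx> L" "lat D N L1" "cj L1 = L1"
    using lat_ambiguous_real[OF assms(1,3,4)] by blast
  obtain M a u e where M: "M \<approx> L1" "a > 0" "lat D (1 / real a) M" "M = 1 + zgen u"
    "Im u = Im (om D) / real a" "2 * Re u = real_of_int e" "e = 0 \<or> e = 1"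
    using lat_ambiguous_normal[OF assms(1) L1(2,3)] .
  have uM: "u \<in> elts M" and one: "1 \<in> elts M"
    using order_refl[of M] unfolding M(4) plus_le_iff by (simp_all add: zgen_le_iff flip: zgen_one)
  obtain b c where form: "of_nat a * u = beta D b" "b\<^sup>2 - 4 * int a * c = D" "gcd (int a) (gcd b c) = 1"
    "\<And>x y. real a * (cmod (of_int x + of_int y * u))\<^sup>2 = of_int (int a * x\<^sup>2 + b * x * y + c * y\<^sup>2)"
    using lat_basis_form[OF assms(1) M(2-5)] by blast
  have "Re (of_nat a * u) = of_int b / 2" unfolding form(1) by (simp add: beta_def)
  then have "real a * (2 * Re u) = of_int b" by simp
  then have "real_of_int (int a * e) = of_int b" unfolding M(6) by simp
  then have b: "b = int a * e" by linarith
  have ee: "e * e = e" using M(7) by auto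
  have "b\<^sup>2 = (e * e) * (int a)\<^sup>2" by (simp add: b power2_eq_square mult_ac)
  then have D: "D = e * (int a)\<^sup>2 - 4 * int a * c"
    using form(2) unfolding ee by simp
  have "coprime (int a) c"
  proof (rule coprimeI)
    fix d assume "d dvd int a" "d dvd c"
    then have "d dvd gcd (int a) (gcd b c)" by (simp add: b)
    then show "is_unit d" by (simp only: form(3))
  qed
  then have good: "(\<forall>q. prime q \<longrightarrow> int q dvd int a \<longrightarrow> \<not> conductor_dvd D q) \<or>
    (\<forall>q. prime q \<longrightarrow> int q dvd (if e = 0 then c else 4 * c - int a) \<longrightarrow> \<not> conductor_dvd D q)"
    using ambiguous_form_good[OF assms(2,1) _ _ M(7) D] M(2) by simp
  have main: ?thesis if v: "v \<in> elts M" "v \<noteq> 0" "real a * (cmod v)\<^sup>2 = real_of_int n"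
    and n: "n dvd D" "\<And>q. prime q \<Longrightarrow> int q dvd n \<Longrightarrow> \<not> conductor_dvd D q" for v n
  proof -
    let ?J = "zgen (of_nat a * cnj v) * M"
    note J = lat_scale_elt[OF assms(1) M(3) v(1,2) M(2)]
    have "real_of_int n > 0" unfolding v(3)[symmetric] using v(2) M(2) by simp
    then have n0: "real_of_int n = real (nat n)" "n > 0" by auto
    have "absorbing D (nat n) ?J"
    proof (rule absorbing_primes[OF assms(1)])
      show "lat D (real (nat n)) ?J" using J(1) by (simp add: v(3) n0)
      show "?J \<le> qord D" by (fact J(2))
      fix q assume q: "prime q" "q dvd nat n"
      then have "int q dvd n" using n0(2) by (metis int_dvd_int_iff int_nat_eq less_imp_le)
      then show "\<exists>K. absorbing D q K"
        using ramified_absorbing[OF assms(1) q(1)] n dvd_trans q(1) by blast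
    qed
    moreover have "?J \<approx> L"
      using sim_trans[OF sim_trans[OF sim_zgen M(1)] L1(1)] v(2) M(2) by simp
    ultimately show ?thesis by blast
  qed
  from good show ?thesis
  proof
    assume "\<forall>q. prime q \<longrightarrow> int q dvd int a \<longrightarrow> \<not> conductor_dvd D q"
    moreover have "int a dvd D" unfolding D by (simp add: power2_eq_square)
    ultimately show ?thesis using main[OF one, of "int a"] by simp
  next
    assume 2: "\<forall>q. prime q \<longrightarrow> int q dvd (if e = 0 then c else 4 * c - int a) \<longrightarrow> \<not> conductor_dvd D q"
    have Imu: "Im u > 0" using M(2,5) Im_om_pos[OF assms(1)] by simp
    show ?thesis
    proof (cases "e = 0")
      case True
      have "c dvd D" unfolding D True by simp
      moreover have "u \<noteq> 0" using Imu by auto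
      moreover have "real a * (cmod u)\<^sup>2 = of_int c" using form(4)[of 0 1] by simp
      ultimately show ?thesis using main[OF uM, of c] 2 True by simp
    next
      case False
      then have e: "e = 1" using M(7) by simp
      \<comment> \<open>With \<open>b = a\<close> the form takes the value 4c - a at (-1, 2), and D
        = -a (4c - a).\<close>
      define v where "v = of_int (- 1) + of_int 2 * u"
      have "real a * (cmod v)\<^sup>2 = of_int (4 * c - int a)"
        unfolding v_def form(4) b e by simp
      moreover have "v \<in> elts M"
        unfolding v_def using elts_add[OF elts_of_int[OF one, of "- 1"] elts_of_int[OF uM, of 2]] by simp
      moreover have "v \<noteq> 0" using Imu by (auto simp: v_def complex_eq_iff)
      moreover have "4 * c - int a dvd D"
        by (rule dvdI[of _ _ "- int a"]) (simp add: D e power2_eq_square algebra_simps)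
      ultimately show ?thesis using main[of v "4 * c - int a"] 2 False by simp
    qed
  qed
qed

section \<open>Ideals of norm coprime to the discriminant and split primes\<close>

lemma lat_mult_power:
  "lat D (N * p ^ n) (X * P ^ n)" if "disc D" "lat D N X" "lat D p P"
proof -
  have "X * (qord D * P ^ n) = X * P ^ n"
    using lat_qord_mult[OF that(2)] by (metis mult.assoc mult.left_commute)
  then show ?thesis using lat_mult[OF that(1,2) lat_power[OF that(1,3), of n]] by simp
qed

lemma sim_cancel_power_cj:
  assumes "disc D" "lat D N P" "qord D * B = B"
  shows "B * (P ^ n * cj P ^ n) \<approx> B"
proof -
  have "(P * cj P) ^ n = zgen (of_real N) ^ n * qord D ^ n"
    unfolding lat_mult_cj[OF assms(2)] by (rule power_mult_distrib)
  moreover have "zgen (of_real N) ^ n = zgen (of_real N ^ n)"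
    by (induction n) (simp_all add: zgen_one zgen_mult)
  moreover have "B * qord D ^ n = B"
    by (induction n) (simp_all add: assms(3) mult.left_commute[of B] mult.commute[of B "qord D"])
  ultimately have "B * (P ^ n * cj P ^ n) = zgen (of_real N ^ n) * B"
    by (simp add: power_mult_distrib[symmetric] mult.left_commute[of B])
  then show ?thesis using lat_pos[OF assms(2)] by (simp add: sim_zgen)
qed

lemma qord_stable_plus: "qord D * A = A \<Longrightarrow> qord D * B = B \<Longrightarrow> qord D * (A + B) = A + B"
  by (simp add: distrib_left)

text \<open>\<open>u\<close> is the least positive integer in \<open>T\<close>. If x = i + j om lies
  in \<open>T\<close>, so do the integers x + conj(x) = 2i + jD and sqrt D (x - conj(x)) = jD, where
  sqrt D is \<open>of_int 2 * om D - of_int D\<close>. Being prime to 2D, \<open>u\<close> divides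
  \<open>j\<close> and \<open>i\<close>.\<close>

lemma conj_closed_principal:
  assumes "disc D" "T \<le> qord D" "qord D * T = T" "cj T = T"
    and "of_nat m \<in> elts T" "coprime (int m) (2 * D)"
  shows "\<exists>u>0. u dvd m \<and> T = zgen (of_nat u) * qord D"
proof -
  define G where "G = {k. (0::nat) < k \<and> of_nat k \<in> elts T}"
  have "m > 0" using assms(1,6) disc_neg by (cases "m = 0") fastforce+
  then have "m \<in> G" using assms(5) by (simp add: G_def)
  define u where "u = (LEAST k. k \<in> G)"
  have "u \<in> G" unfolding u_def by (rule LeastI[where P = "\<lambda>k. k \<in> G", OF \<open>m \<in> G\<close>])
  then have u: "u > 0" "of_nat u \<in> elts T" by (auto simp: G_def)
  have dvd: "int u dvd k" if "of_int k \<in> elts T" for k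
  proof -
    have "of_int k - of_int (k div int u) * of_nat u \<in> elts T"
      by (intro elts_diff elts_of_int u(2) that)
    moreover have "of_int k - of_int (k div int u) * (of_nat u :: complex) = of_int (k mod int u)"
      by (simp add: minus_div_mult_eq_mod[symmetric])
    moreover have "\<dots> = of_nat (nat (k mod int u))" using u(1) by simp
    ultimately have "nat (k mod int u) = 0 \<or> nat (k mod int u) \<in> G" unfolding G_def by auto
    moreover have "nat (k mod int u) < u" using u(1) by (simp add: nat_less_iff)
    then have "nat (k mod int u) \<notin> G" using not_less_Least unfolding u_def by blast
    ultimately have "k mod int u = 0" using u(1) by (metis nat_eq_iff2 of_nat_0_less_iff pos_mod_sign order.antisym of_nat_0)
    then show ?thesis by (simp add: dvd_eq_mod_eq_0)
  qed
  have "u dvd m" using dvd[of "int m"] assms(5) by simp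
  have "coprime (int u) (2 * D)"
    using assms(6) \<open>u dvd m\<close> by (meson coprime_divisors dvd_refl int_dvd_int_iff)
  then have cop: "coprime (int u) 2" "coprime (int u) D" by (simp_all add: coprime_mult_right_iff)
  have "T \<le> zgen (of_nat u) * qord D"
  proof (rule zmod_leI)
    fix x assume x: "x \<in> elts T"
    then obtain i j :: int where ij: "x = of_int i + of_int j * om D"
      using zmod_leD[OF assms(2)] elts_qord by blast
    have cx: "cnj x \<in> elts T" using x assms(4) cnj_in_cj by metis
    have "x + cnj x = of_int (2 * i + j * D)"
      unfolding ij by (simp add: cnj_om algebra_simps)
    then have 1: "int u dvd 2 * i + j * D" using dvd elts_add[OF x cx] by metis
    have "of_int 2 * om D - of_int D \<in> elts (qord D)" by (intro elts_diff elts_of_int) auto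
    then have "(of_int 2 * om D - of_int D) * (x - cnj x) \<in> elts (qord D * T)"
      by (rule elts_mult[OF _ elts_diff[OF x cx]])
    moreover have "(of_int 2 * om D - of_int D) * (x - cnj x) = of_int (j * D)"
    proof -
      have "x - cnj x = of_int j * (of_int 2 * om D - of_int D)"
        unfolding ij by (simp add: cnj_om algebra_simps)
      moreover have "(of_int 2 * om D - of_int D) * (of_int 2 * om D - of_int D) = of_int D"
        using disc_neg[OF assms(1)] by (simp add: om_def complex_eq_iff)
      ultimately show ?thesis by (simp add: mult.left_commute)
    qed
    ultimately have 2: "int u dvd j * D" using dvd assms(3) by metis
    then have "int u dvd j" using cop(2) by (simp add: coprime_dvd_mult_left_iff)
    moreover have "int u dvd 2 * i" using 1 2 by (metis dvd_add_left_iff)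
    then have "int u dvd i" using cop(1) by (simp add: coprime_dvd_mult_right_iff)
    ultimately obtain i' j' where "i = int u * i'" "j = int u * j'" by blast
    then have "x = of_nat u * (of_int i' + of_int j' * om D)" by (simp add: ij algebra_simps)
    then show "x \<in> elts (zgen (of_nat u) * qord D)"
      unfolding elts_zgen_mult by (intro image_eqI) (auto simp: elts_qord)
  qed
  moreover have "zgen (of_nat u) * qord D \<le> T"
    using zmod_mult_mono[of "zgen (of_nat u)" T "qord D" "qord D"] u(2) assms(3)
    by (simp add: zgen_le_iff mult.commute)
  ultimately show ?thesis using u(1) \<open>u dvd m\<close> by (intro exI[of _ u]) simp
qed

text \<open>In a non-maximal order a sum of invertible ideals can fail to be invertible. Here the
  sum times its conjugate is self-conjugate and contains \<open>m\<close>, so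
  \<open>conj_closed_principal\<close> provides an integer generator, which is the norm.\<close>

lemma coprime_lat_sum:
  assumes "disc D" "lat D (real m) A" "A \<le> qord D" "qord D * B = B" "B \<le> qord D"
    and "coprime (int m) (2 * D)"
  shows "\<exists>u. u dvd m \<and> lat D (real u) (A + B)"
proof -
  let ?U = "A + B"
  have UO: "?U \<le> qord D" using assms(3,5) by (simp add: plus_le_iff)
  have Ust: "qord D * ?U = ?U" using lat_qord_mult[OF assms(2)] assms(4) by (rule qord_stable_plus)
  have "A * cj A \<le> ?U * cj ?U" by (intro zmod_mult_mono cj_mono zmod_le_plus)
  moreover have "of_real (real m) * 1 \<in> elts (A * cj A)"
    unfolding lat_mult_cj[OF assms(2)] elts_zgen_mult by (rule imageI) simp
  ultimately have m: "of_nat m \<in> elts (?U * cj ?U)" by (auto dest: zmod_leD)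
  have "?U * cj ?U \<le> qord D"
    using zmod_mult_mono[OF UO, of "cj ?U" "qord D"] cj_mono[OF UO] qord_mult[OF assms(1)] by simp
  then obtain u where "u > 0" "u dvd m" "?U * cj ?U = zgen (of_nat u) * qord D"
    using conj_closed_principal[OF assms(1) _ _ _ m assms(6)] Ust
    by (auto simp: cj_mult mult.commute simp flip: mult.assoc)
  then show ?thesis using Ust by (auto simp: lat_def)
qed

text \<open>Multiplying \<open>cj V\<close> by \<open>V + W\<close> gives
  \<open>V * cj V + cj V * W\<close>. As the norms agree, the first term equals
  \<open>W * cj W\<close>, and everything lies in \<open>W\<close>.\<close>

lemma coprime_sum_conj:
  assumes "disc D" "lat D N V" "lat D N W" "V + W = qord D"
  shows "W = cj V"
proof -
  have le: "cj V \<le> W" if "lat D N V" "lat D N W" "V + W = qord D" for V W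
  proof -
    have WO: "W \<le> qord D" "V \<le> qord D" unfolding that(3)[symmetric] by (rule zmod_le_plus)+
    have "cj V = cj V * (V + W)"
      using lat_qord_mult[OF lat_cj[OF that(1)]] that(3) by (simp add: mult.commute)
    also have "\<dots> = W * cj W + cj V * W"
      using lat_mult_cj[OF that(1)] lat_mult_cj[OF that(2)] by (simp add: distrib_left mult.commute)
    also have "\<dots> \<le> W"
      unfolding plus_le_iff
      using zmod_mult_mono[OF order_refl[of W], of "cj W" "qord D"] zmod_mult_mono[OF _ order_refl[of W], of "cj V" "qord D"]
        cj_mono[OF WO(1)] cj_mono[OF WO(2)] lat_qord_mult[OF that(2)] by (simp add: mult.commute)
    finally show ?thesis .
  qed
  have "cj W \<le> V" by (rule le[OF assms(3,2)]) (use assms(4) in \<open>simp add: add.commute\<close>)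
  with le[OF assms(2-4)] show ?thesis by (simp add: cj_le_iff order_antisym)
qed

section \<open>Ambiguous classes and split primes\<close>

definition ambiguous :: "int \<Rightarrow> zmod \<Rightarrow> bool" where
  "ambiguous D A \<longleftrightarrow> (\<exists>N. lat D N A) \<and> A \<approx> cj A"

lemma ambiguous_qord: "disc D \<Longrightarrow> ambiguous D (qord D)"
  unfolding ambiguous_def using lat_qord by auto

lemma ambiguous_mult: "disc D \<Longrightarrow> ambiguous D A \<Longrightarrow> ambiguous D B \<Longrightarrow> ambiguous D (A * B)"
  unfolding ambiguous_def cj_mult using lat_mult sim_mult by blast

lemma ambiguous_cj: "ambiguous D A \<Longrightarrow> ambiguous D (cj A)"
  unfolding ambiguous_def using lat_cj sim_sym by auto

lemma ambiguous_square: "ambiguous D A \<Longrightarrow> A * A \<approx> qord D"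
  unfolding ambiguous_def using sim_mult[OF sim_refl[of A]] sim_mult_cj sim_trans by blast

definition split_prime :: "int \<Rightarrow> nat \<Rightarrow> zmod \<Rightarrow> bool" where
  "split_prime D p P \<longleftrightarrow> prime p \<and> coprime (int p) (2 * D) \<and> lat D (real p) P \<and> P \<le> qord D \<and>
    (\<forall>A B. A \<le> qord D \<longrightarrow> B \<le> qord D \<longrightarrow> A * B \<le> P \<longrightarrow> A \<le> P \<or> B \<le> P) \<and>
    (\<forall>n. of_nat n \<in> elts P \<longrightarrow> p dvd n) \<and> \<not> cj P \<le> P \<and>
    (\<forall>n J. lat D (real (p * n)) J \<longrightarrow> J \<le> qord D \<longrightarrow> J \<le> P \<or> J \<le> cj P)"

text \<open>Any prime \<open>p\<close> dividing 1 - 4D serves: it is prime to 4D, and modulo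
  \<open>p\<close> the number \<open>D\<close> is the square of the inverse of 2.\<close>

lemma split_prime_exists:
  assumes "disc D"
  shows "\<exists>p P. split_prime D p P"
proof -
  have "nat (1 - 4 * D) \<noteq> 1" using disc_neg[OF assms] by simp
  then obtain p where p: "prime p" "p dvd nat (1 - 4 * D)" by (metis prime_factor_nat)
  have pp: "prime (int p)" using p(1) by simp
  have pd: "int p dvd 1 - 4 * D" using p(2) disc_neg[OF assms] by (metis int_dvd_int_iff int_nat_eq diff_ge_0_iff_ge int_one_le_iff_zero_less less_imp_le mult_less_0_iff not_less zero_less_numeral less_diff_eq)
  have cop4: "coprime (int p) (4 * D)"
  proof (rule coprimeI)
    fix c assume "c dvd int p" "c dvd 4 * D"
    then have "c dvd 1 - 4 * D + 4 * D" using pd dvd_trans dvd_add by blast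
    then show "is_unit c" by simp
  qed
  then have cop: "coprime (int p) 2" "coprime (int p) D"
    using coprime_mult_right_iff[of "int p" 4 D] coprime_mult_right_iff[of "int p" 2 2] by auto
  then have "odd p" by simp
  \<comment> \<open>\<open>x\<close> is the inverse of 2 modulo \<open>p\<close>.\<close>
  define x where "x = (int p + 1) div 2"
  have x: "2 * x = int p + 1"
  proof -
    have "odd (int p)" using \<open>odd p\<close> by simp
    then show ?thesis unfolding x_def by presburger
  qed
  have eq: "4 * (x\<^sup>2 - D) = int p * (int p + 2) + (1 - 4 * D)"
  proof -
    have "4 * x\<^sup>2 = (2 * x)\<^sup>2" by (simp add: power2_eq_square)
    then show ?thesis unfolding x by (simp add: power2_eq_square algebra_simps)
  qed
  have "int p dvd 4 * (x\<^sup>2 - D)" unfolding eq by (intro dvd_add pd) simp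
  then have xD: "int p dvd x\<^sup>2 - D"
    using cop(1) coprime_dvd_mult_right_iff[of "int p" 4 "x\<^sup>2 - D"] coprime_mult_right_iff[of "int p" 2 2] by simp
  \<comment> \<open>Adding the odd number \<open>p\<close> gives \<open>b\<close> the parity of
    \<open>D\<close>, so that b^2 - D is divisible by 4, and keeps the residue modulo
    \<open>p\<close>.\<close>
  define b where "b = (if even (x - D) then x else x + int p)"
  have "even (b - D)" using \<open>odd p\<close> by (auto simp: b_def)
  then obtain k where k: "b = D + 2 * k" by (metis dvdE diff_add_cancel add.commute)
  have eq: "b\<^sup>2 - D = (D * D - D) + 4 * (D * k + k * k)" by (simp add: k power2_eq_square algebra_simps)
  have "4 dvd b\<^sup>2 - D" unfolding eq by (intro dvd_add disc_four_dvd assms) simp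
  moreover have pb: "int p dvd b\<^sup>2 - D"
  proof -
    have eq: "(x + int p)\<^sup>2 - D = (x\<^sup>2 - D) + int p * (2 * x + int p)" by (simp add: power2_eq_square algebra_simps)
    have "int p dvd (x + int p)\<^sup>2 - D" unfolding eq by (intro dvd_add xD) simp
    then show ?thesis using xD by (simp add: b_def)
  qed
  moreover have "coprime 4 (int p)" using cop4 by (simp add: coprime_mult_right_iff coprime_commute)
  ultimately have "4 * int p dvd b\<^sup>2 - D" by (intro divides_mult)
  then obtain c where "b\<^sup>2 - D = 4 * int p * c" by blast
  then have c: "b\<^sup>2 - 4 * int p * c = D" by simp
  have nb: "\<not> int p dvd b"
  proof
    assume "int p dvd b"
    then have "int p dvd b\<^sup>2" by (simp add: power2_eq_square)
    then have "int p dvd D" using pb by (metis dvd_diff_right_iff)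
    then show False using cop(2) pp by (meson coprime_common_divisor dvd_refl not_prime_unit)
  qed
  have gcd: "gcd (int p) (gcd b c) = 1"
    using nb pp by (metis coprime_iff_gcd_eq_1 dvd_trans gcd_dvd1 prime_imp_coprime)
  define P where "P = flat D (int p) b"
  have split_prime_of_nat: "p dvd n" if "of_nat n \<in> elts P" for n
    using flat_elts_iff[OF assms, of "int n" 0 b "int p"] that by (simp add: P_def)
  have "split_prime D p P"
    unfolding split_prime_def
  proof (intro conjI allI impI)
    show "lat D (real p) P"
      using lat_flat[OF assms c _ gcd] prime_gt_0_nat[OF p(1)] by (simp add: P_def)
    show "\<not> cj P \<le> P"
    proof
      assume le: "cj P \<le> P"
      have "of_int 0 + of_int 1 * beta D b \<in> elts P" unfolding P_def flat_elts_iff[OF assms] by simp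
      then have "beta D b \<in> elts P" by simp
      moreover from this have "cnj (beta D b) \<in> elts P" using le by (metis cnj_in_cj zmod_leD)
      ultimately have "beta D b + cnj (beta D b) \<in> elts P" by (rule elts_add)
      then have "of_int b + of_int 0 * beta D b \<in> elts P" by (simp add: beta_cnj)
      then show False using nb unfolding P_def flat_elts_iff[OF assms] by simp
    qed
    show "P \<le> qord D" using flat_le_qord[OF k] by (simp add: P_def)
    show "A \<le> P \<or> B \<le> P" if "A \<le> qord D" "B \<le> qord D" "A * B \<le> P" for A B
      using flat_prime[OF assms c pp] that by (simp add: P_def)
    show "J \<le> P \<or> J \<le> cj P" if "lat D (real (p * n)) J" "J \<le> qord D" for n J
      using flat_prime_dvd_norm[OF assms c pp, of "int n" J] that by (simp add: P_def)
  qed (use p(1) cop split_prime_of_nat in \<open>simp_all add: coprime_mult_right_iff\<close>)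
  then show ?thesis by blast
qed

section \<open>Powers of a split prime\<close>

definition reps :: "int \<Rightarrow> zmod \<Rightarrow> nat \<Rightarrow> zmod set" where
  "reps D X n = {J. lat D (real n) J \<and> J \<le> qord D \<and> J \<approx> X}"

lemma mult_le_qord: "disc D \<Longrightarrow> A \<le> qord D \<Longrightarrow> B \<le> qord D \<Longrightarrow> A * B \<le> qord D"
  using zmod_mult_mono[of A "qord D" B "qord D"] by (simp add: qord_mult)

text \<open>Multiplication by \<open>K\<close> is the bijection; it is onto because an ideal whose
  norm is a multiple of \<open>d\<close> lies in \<open>K\<close>, hence is divisible by
  \<open>K\<close>.\<close>

lemma card_reps_absorbing:
  assumes "disc D" "absorbing D d K" "qord D * Y = Y" "K * Y \<approx> X"
  shows "card (reps D X (d * n)) = card (reps D Y n)"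
proof -
  have K: "lat D (real d) K" "K \<le> qord D"
    "\<And>I k. lat D (real (d * k)) I \<Longrightarrow> I \<le> qord D \<Longrightarrow> I \<le> K"
    using assms(2) by (auto simp: absorbing_def)
  have "d > 0" using lat_pos[OF K(1)] by simp
  have "bij_betw ((*) K) (reps D Y n) (reps D X (d * n))"
    unfolding bij_betw_def
  proof
    show "inj_on ((*) K) (reps D Y n)"
      by (rule inj_onI) (auto simp: reps_def intro: lat_mult_cancel[OF K(1)] lat_qord_mult)
    show "(*) K ` reps D Y n = reps D X (d * n)"
    proof (intro equalityI subsetI)
      fix J assume "J \<in> (*) K ` reps D Y n"
      then obtain J' where J': "J = K * J'" "lat D (real n) J'" "J' \<le> qord D" "J' \<approx> Y"
        by (auto simp: reps_def)
      have "K * J' \<approx> X" using sim_trans[OF sim_mult[OF sim_refl J'(4)] assms(4)] .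
      then show "J \<in> reps D X (d * n)"
        using lat_mult[OF assms(1) K(1) J'(2)] mult_le_qord[OF assms(1) K(2) J'(3)]
        by (simp add: reps_def J'(1))
    next
      fix J assume J: "J \<in> reps D X (d * n)"
      then have "J \<le> K" using K(3) by (auto simp: reps_def)
      then obtain J' where J': "lat D (real (d * n) / real d) J'" "J' \<le> qord D" "J = K * J'"
        using lat_divide[OF assms(1) _ K(1)] J unfolding reps_def by blast
      have "K * J' \<approx> K * Y"
        using J J'(3) sim_trans[OF _ sim_sym[OF assms(4)]] by (auto simp: reps_def)
      then have "J' \<approx> Y"
        by (rule sim_mult_cancel[OF K(1)]) (use lat_qord_mult[OF J'(1)] assms(3) in auto)
      then show "J \<in> (*) K ` reps D Y n"
        using J' \<open>d > 0\<close> by (auto simp: reps_def)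
    qed
  qed
  then show ?thesis by (simp add: bij_betw_same_card)
qed

lemma zmod_power_double: "A ^ (2 * n) = A ^ n * A ^ n" for A :: zmod
  by (simp add: mult_2 power_add)

lemma sim_mult_right: "A \<approx> B \<Longrightarrow> A * C \<approx> B * C"
  by (rule sim_mult) auto

context
  fixes D :: int and p :: nat and P :: zmod
  assumes D: "disc D" and sp: "split_prime D p P"
begin

lemma split_prime_imp_prime: "prime p"
  and split_prime_lat: "lat D (real p) P"
  and split_prime_le: "P \<le> qord D"
  and split_prime_mult_leD: "A \<le> qord D \<Longrightarrow> B \<le> qord D \<Longrightarrow> A * B \<le> P \<Longrightarrow> A \<le> P \<or> B \<le> P"
  and split_prime_of_nat: "of_nat n \<in> elts P \<Longrightarrow> p dvd n"
  and split_prime_not_cj_le: "\<not> cj P \<le> P"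
  and split_prime_dvd_norm: "lat D (real (p * n)) J \<Longrightarrow> J \<le> qord D \<Longrightarrow> J \<le> P \<or> J \<le> cj P"
  using sp unfolding split_prime_def by blast+

lemma cj_split_prime_le: "cj P \<le> qord D"
  using cj_mono[OF split_prime_le] by simp

lemma split_divide:
  assumes "lat D (real (p * n)) J" "J \<le> qord D"
  obtains J' where "lat D (real n) J'" "J' \<le> qord D" "J = P * J' \<or> J = cj P * J'"
proof -
  have p: "real (p * n) / real p = real n" using prime_gt_0_nat[OF split_prime_imp_prime] by simp
  from split_prime_dvd_norm[OF assms] show thesis
  proof
    assume "J \<le> P"
    from lat_divide[OF D assms(1) split_prime_lat this] p that show thesis by auto
  next
    assume "J \<le> cj P"
    from lat_divide[OF D assms(1) lat_cj[OF split_prime_lat] this] p that show thesis by auto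
  qed
qed

lemma split_decomposition:
  assumes "lat D (real (p ^ N * m)) J" "J \<le> qord D"
  shows "\<exists>i J'. i \<le> N \<and> lat D (real m) J' \<and> J' \<le> qord D \<and> J = P ^ i * cj P ^ (N - i) * J'"
  using assms
proof (induction N arbitrary: J)
  case (Suc N)
  have "lat D (real (p * (p ^ N * m))) J" using Suc.prems(1) by (simp add: mult_ac)
  then obtain J1 where J1: "lat D (real (p ^ N * m)) J1" "J1 \<le> qord D" "J = P * J1 \<or> J = cj P * J1"
    using split_divide[OF _ Suc.prems(2)] by blast
  obtain i J' where i: "i \<le> N" "lat D (real m) J'" "J' \<le> qord D" "J1 = P ^ i * cj P ^ (N - i) * J'"
    using Suc.IH[OF J1(1,2)] by blast
  from J1(3) show ?case
  proof
    assume "J = P * J1"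
    then show ?thesis using i by (intro exI[of _ "Suc i"] exI[of _ J']) (simp add: mult.assoc)
  next
    assume "J = cj P * J1"
    then show ?thesis using i
      by (intro exI[of _ i] exI[of _ J']) (simp add: Suc_diff_le mult_ac)
  qed
qed auto

lemma power_mult_le_split_prime:
  assumes "A \<le> qord D" "B \<le> qord D" "A ^ n * B \<le> P"
  shows "A \<le> P \<or> B \<le> P"
  using assms(3)
proof (induction n)
  case (Suc n)
  have "A ^ n * B \<le> qord D" for n
    using assms by (induction n) (auto simp: mult.assoc intro: mult_le_qord[OF D])
  then show ?case using split_prime_mult_leD[OF assms(1), of "A ^ n * B"] Suc by (auto simp: mult.assoc)
qed simp

lemma lat_power_mult: "lat D (real (p ^ i * n)) (P ^ i * B)" "lat D (real (p ^ i * n)) (cj P ^ i * B)"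
  if "lat D (real n) B"
  using lat_mult_power[OF D that split_prime_lat, of i] lat_mult_power[OF D that lat_cj[OF split_prime_lat], of i]
  by (simp_all add: mult.commute)

text \<open>For i < j, cancelling common factors leaves \<open>cj P ^ e * J = P ^ e * J\<close>,
  which lies in \<open>P\<close>. As \<open>P\<close> is prime and does not contain
  \<open>cj P\<close>, it contains \<open>J\<close> and hence its norm \<open>m\<close>, which
  \<open>p\<close> does not divide.\<close>

lemma split_decomposition_unique:
  assumes "lat D (real m) J" "J \<le> qord D" "\<not> p dvd m" "i \<le> N" "j \<le> N"
    "P ^ i * cj P ^ (N - i) * J = P ^ j * cj P ^ (N - j) * J"
  shows "i = j"
proof -
  have neq: False if "i < j" "j \<le> N" "P ^ i * cj P ^ (N - i) * J = P ^ j * cj P ^ (N - j) * J" for i j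
  proof -
    define e where "e = j - i"
    have e: "j = i + e" "N - i = (N - j) + e" "e > 0" using that by (auto simp: e_def)
    let ?L = "P ^ i * (cj P ^ (N - j) * qord D)"
    have L: "\<exists>M. lat D M ?L"
      using lat_power_mult(1)[OF lat_power_mult(2)[where n = 1 and B = "qord D" and i = "N - j"], where i = i]
        lat_qord[OF D] by auto
    have st: "qord D * (A ^ e * J) = A ^ e * J" for A
      using lat_qord_mult[OF assms(1)] by (simp add: mult.left_commute[of "qord D"])
    have "?L * (cj P ^ e * J) = P ^ i * cj P ^ (N - i) * (qord D * J)"
      by (simp add: e(2) power_add mult_ac)
    also have "\<dots> = P ^ j * cj P ^ (N - j) * (qord D * J)"
      using that(3) by (simp add: lat_qord_mult[OF assms(1)])
    also have "\<dots> = ?L * (P ^ e * J)"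
      by (subst e(1)) (simp add: power_add mult_ac)
    finally have eq: "cj P ^ e * J = P ^ e * J"
      using L lat_mult_cancel st by blast
    have "P ^ e * J = P * (P ^ (e - 1) * J)"
      using e(3) by (simp add: power_eq_if mult.assoc)
    also have "\<dots> \<le> P * qord D"
    proof (rule zmod_mult_mono[OF order_refl])
      have "P ^ n * J \<le> qord D" for n
        using assms(2) split_prime_le by (induction n) (auto simp: mult.assoc intro: mult_le_qord[OF D])
      then show "P ^ (e - 1) * J \<le> qord D" .
    qed
    also have "\<dots> = P" using lat_qord_mult[OF split_prime_lat] by (simp add: mult.commute)
    finally have "cj P ^ e * J \<le> P" by (simp add: eq)
    then have "J \<le> P" using power_mult_le_split_prime[OF cj_split_prime_le assms(2)] split_prime_not_cj_le by blast
    moreover have "of_nat m \<in> elts J" using lat_integral_norm[OF D assms(1,2)] by auto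
    ultimately show False using split_prime_of_nat assms(3) zmod_leD by blast
  qed
  show ?thesis using neq[of i j] neq[of j i] assms(4-6) by (metis linorder_neqE_nat)
qed

text \<open>The coset of \<open>X\<close> modulo the subgroup generated by the ambiguous classes and
  the class of \<open>P\<close>. Natural exponents suffice because that class has finite
  order.\<close>

definition coset :: "zmod \<Rightarrow> zmod \<Rightarrow> bool" where
  "coset X J \<longleftrightarrow> (\<exists>A s. ambiguous D A \<and> J \<approx> X * A * P ^ s)"

lemma coset_sim: "coset X J \<Longrightarrow> K \<approx> J \<Longrightarrow> coset X K"
  unfolding coset_def using sim_trans by blast

lemma coset_ambiguous: "coset X J \<Longrightarrow> ambiguous D B \<Longrightarrow> coset X (J * B)"
  unfolding coset_def
proof (elim exE conjE)
  fix A s assume A: "ambiguous D B" "ambiguous D A" "J \<approx> X * A * P ^ s"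
  then have "J * B \<approx> X * (A * B) * P ^ s"
    using sim_mult_right[OF A(3), of B] by (simp add: mult_ac)
  then show "\<exists>A s. ambiguous D A \<and> J * B \<approx> X * A * P ^ s"
    using ambiguous_mult[OF D A(2,1)] by blast
qed

lemma coset_power: "coset X J \<Longrightarrow> coset X (J * P ^ n)"
  unfolding coset_def
proof (elim exE conjE)
  fix A s assume A: "ambiguous D A" "J \<approx> X * A * P ^ s"
  then have "J * P ^ n \<approx> X * A * P ^ (s + n)"
    using sim_mult_right[OF A(2), of "P ^ n"] by (simp add: power_add mult_ac)
  then show "\<exists>A s. ambiguous D A \<and> J * P ^ n \<approx> X * A * P ^ s"
    using A(1) by blast
qed

text \<open>Up to equivalence \<open>cj P\<close> is the inverse of \<open>P\<close>, hence the
  power of \<open>P\<close> with exponent \<open>h - 1\<close>.\<close>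

lemma coset_cj:
  assumes "coset X J" "qord D * J = J"
  shows "coset X (J * cj P)"
proof -
  obtain h where h: "h > 0" "qord D * P ^ h \<approx> qord D" using finite_class_order[OF D split_prime_lat] by blast
  have st: "qord D * (J * A) = J * A" for A using assms(2) by (simp flip: mult.assoc)
  have "J * P ^ (h - 1) * (P ^ 1 * cj P ^ 1) \<approx> J * P ^ (h - 1)"
    by (rule sim_cancel_power_cj[OF D split_prime_lat st])
  moreover have "J * P ^ (h - 1) * (P ^ 1 * cj P ^ 1) = J * cj P * (qord D * P ^ h)"
    using h(1) st[of "cj P * P ^ h"] by (simp add: power_eq_if mult_ac)
  moreover have "J * cj P * (qord D * P ^ h) \<approx> J * cj P"
    using sim_mult[OF sim_refl h(2), of "J * cj P"] st[of "cj P"] by (simp add: mult_ac)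
  ultimately have "J * cj P \<approx> J * P ^ (h - 1)" using sim_sym sim_trans by metis
  then show ?thesis using coset_sim[OF coset_power[OF assms(1)]] by blast
qed

lemma coset_cj_power:
  assumes "coset X J" "qord D * J = J"
  shows "coset X (J * cj P ^ n)"
proof (induction n)
  case (Suc n)
  have "qord D * (J * cj P ^ n) = J * cj P ^ n" using assms(2) by (simp flip: mult.assoc)
  from coset_cj[OF Suc this] show ?case by (simp add: mult_ac)
qed (use assms in simp)

text \<open>
  If two ideals of the same norm differ by an even power of \<open>P\<close> up to equivalence, then their
  sum lies in the same coset, and it has smaller norm unless the two ideals agree.
\<close>

lemma coset_minimal_unique:
  assumes J1: "lat D (real m) J1" "J1 \<le> qord D" "coset X J1"
    and J2: "lat D (real m) J2" "J2 \<le> qord D"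
    and m: "coprime (int m) (2 * D)"
    and minimal: "\<And>u J. lat D (real u) J \<Longrightarrow> J \<le> qord D \<Longrightarrow> coset X J \<Longrightarrow> coprime (int u) (2 * D) \<Longrightarrow> m \<le> u"
    and sim: "J1 \<approx> J2 * P ^ (2 * t)"
  shows "J1 = J2"
proof -
  let ?U = "J1 + J2"
  note stable = lat_qord_mult[OF J1(1)] lat_qord_mult[OF J2(1)]
  obtain u where u: "u dvd m" "lat D (real u) ?U"
    using coprime_lat_sum[OF D J1(1,2) stable(2) J2(2) m] by blast
  obtain V1 where V1: "lat D (real m / real u) V1" "V1 \<le> qord D" "J1 = ?U * V1"
    using lat_divide[OF D J1(1) u(2) zmod_le_plus(1)] by blast
  obtain V2 where V2: "lat D (real m / real u) V2" "V2 \<le> qord D" "J2 = ?U * V2"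
    using lat_divide[OF D J2(1) u(2) zmod_le_plus(2)] by blast
  have "?U * (V1 + V2) = ?U * qord D"
    using V1(3) V2(3) lat_qord_mult[OF u(2)] by (metis distrib_left mult.commute)
  then have "V1 + V2 = qord D"
    by (rule lat_mult_cancel[OF u(2)])
      (use lat_qord_mult[OF V1(1)] lat_qord_mult[OF V2(1)] in \<open>simp_all add: distrib_left qord_mult[OF D]\<close>)
  then have V2_eq: "V2 = cj V1" by (rule coprime_sum_conj[OF D V1(1) V2(1)])
  note stV = lat_qord_mult[OF V1(1)]
  note stcV = lat_qord_mult[OF lat_cj[OF V1(1)]]
  have "?U * V1 \<approx> ?U * (cj V1 * P ^ (2 * t))"
    using sim V1(3) V2(3) V2_eq by (metis mult.assoc)
  then have V: "V1 \<approx> cj V1 * P ^ (2 * t)"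
    by (rule sim_mult_cancel[OF u(2)]) (simp_all add: stV stcV flip: mult.assoc)
  \<comment> \<open>The exponent being even, half of the power can be moved to the left:
    \<open>V1 * cj P ^ t\<close> is equivalent to its own conjugate.\<close>
  define B where "B = V1 * cj P ^ t"
  have cjB: "cj B = cj V1 * P ^ t" by (simp add: B_def cj_mult cj_power)
  have "B \<approx> cj V1 * P ^ (2 * t) * cj P ^ t"
    unfolding B_def by (rule sim_mult_right[OF V])
  also have "cj V1 * P ^ (2 * t) * cj P ^ t = cj B * (P ^ t * cj P ^ t)"
    unfolding cjB zmod_power_double by (simp only: mult_ac)
  also have "\<dots> \<approx> cj B"
    by (rule sim_cancel_power_cj[OF D split_prime_lat]) (simp add: cjB stcV flip: mult.assoc)
  finally have "B \<approx> cj B" .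
  moreover have "\<exists>M. lat D M B"
    using lat_mult_power[OF D V1(1) lat_cj[OF split_prime_lat], of t] unfolding B_def by blast
  ultimately have B: "ambiguous D (cj B)" using ambiguous_cj by (simp add: ambiguous_def)
  have "coset X (J1 * cj B * cj P ^ t)"
  proof (rule coset_cj_power[OF coset_ambiguous[OF J1(3) B]])
    show "qord D * (J1 * cj B) = J1 * cj B" using stable(1) by (simp flip: mult.assoc)
  qed
  \<comment> \<open>\<open>J1\<close> is \<open>?U * V1\<close>, and \<open>cj B * cj P ^ t\<close>
    is equivalent to the inverse \<open>cj V1\<close> of \<open>V1\<close>, so \<open>V1\<close>
    cancels.\<close>
  moreover have "?U \<approx> J1 * cj B * cj P ^ t"
  proof -
    have "J1 * cj B * cj P ^ t = ?U * V1 * cj V1 * (P ^ t * cj P ^ t)"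
      unfolding cjB by (subst V1(3)) (simp add: mult_ac)
    also have "\<dots> \<approx> ?U * V1 * cj V1"
      by (rule sim_cancel_power_cj[OF D split_prime_lat]) (simp add: lat_qord_mult[OF u(2)] flip: mult.assoc)
    also have "?U * V1 * cj V1 = ?U * (V1 * cj V1)" by (rule mult.assoc)
    also have "\<dots> \<approx> ?U * qord D"
      by (rule sim_mult[OF sim_refl sim_mult_cj[OF V1(1)]])
    also have "?U * qord D = ?U" using lat_qord_mult[OF u(2)] by (simp add: mult.commute)
    finally show ?thesis by (rule sim_sym)
  qed
  ultimately have "coset X ?U" by (rule coset_sim)
  moreover have "coprime (int u) (2 * D)"
    using m u(1) by (meson coprime_divisors dvd_refl int_dvd_int_iff)
  ultimately have "m \<le> u" using minimal[OF u(2)] J1(2) J2(2) by (simp add: plus_le_iff)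
  have "m > 0" using lat_pos[OF J1(1)] by simp
  with u(1) \<open>m \<le> u\<close> have "u = m" by (simp add: dvd_imp_le order_antisym)
  with V1(1) \<open>m > 0\<close> have "lat D 1 V1" by simp
  then have "V1 = qord D" using lat_integral_norm_one[OF D] V1(2) by blast
  with V2_eq have "V2 = V1" by simp
  with V1(3) V2(3) show ?thesis by simp
qed

text \<open>\<open>h\<close> is the order of the class of P^2. The class of \<open>P ^ h\<close>
  then has order at most two, so multiples of \<open>h\<close> in an exponent can be traded for
  ambiguous classes.\<close>

lemma power_period: "\<exists>h>0. \<forall>i. qord D * P ^ (2 * i) \<approx> qord D \<longleftrightarrow> h dvd i"
proof -
  define H where "H = {h. (0::nat) < h \<and> qord D * P ^ (2 * h) \<approx> qord D}"
  have add: "qord D * P ^ (2 * (i + j)) \<approx> qord D * P ^ (2 * j)" if "qord D * P ^ (2 * i) \<approx> qord D" for i j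
    using sim_mult_right[OF that, of "P ^ (2 * j)"] by (simp add: distrib_left power_add mult_ac)
  obtain h0 where h0: "h0 > 0" "qord D * P ^ h0 \<approx> qord D" using finite_class_order[OF D split_prime_lat] by blast
  have "qord D * P ^ (2 * h0) \<approx> qord D * P ^ h0"
    using sim_mult_right[OF h0(2), of "P ^ h0"] unfolding zmod_power_double by (simp only: mult_ac)
  then have "h0 \<in> H" using h0 sim_trans by (auto simp: H_def)
  define h where "h = (LEAST h. h \<in> H)"
  have "h \<in> H" unfolding h_def by (rule LeastI[where P = "\<lambda>h. h \<in> H", OF \<open>h0 \<in> H\<close>])
  then have h: "h > 0" "qord D * P ^ (2 * h) \<approx> qord D" by (auto simp: H_def)
  have mult: "qord D * P ^ (2 * (h * k)) \<approx> qord D" for k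
  proof (induction k)
    case (Suc k)
    from sim_trans[OF add[OF h(2)] Suc] show ?case by simp
  qed simp
  show ?thesis
  proof (intro exI[of _ h] conjI allI h(1))
    fix i
    show "qord D * P ^ (2 * i) \<approx> qord D \<longleftrightarrow> h dvd i"
    proof
      assume i: "qord D * P ^ (2 * i) \<approx> qord D"
      have "qord D * P ^ (2 * i) \<approx> qord D * P ^ (2 * (i mod h))"
        using add[OF mult[of "i div h"], of "i mod h"] by simp
      then have "qord D * P ^ (2 * (i mod h)) \<approx> qord D" using i sim_sym sim_trans by blast
      moreover have "i mod h < h" using h(1) by simp
      then have "i mod h \<notin> H" using not_less_Least unfolding h_def by blast
      ultimately show "h dvd i" by (auto simp: H_def)
    qed (use mult in auto)
  qed
qed

lemma ambiguous_power:
  assumes "qord D * P ^ (2 * i) \<approx> qord D"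
  shows "ambiguous D (qord D * P ^ i)"
proof -
  have "qord D * cj P ^ i * (P ^ i * P ^ i) \<approx> qord D * cj P ^ i"
    using sim_mult_right[OF assms, of "cj P ^ i"] unfolding zmod_power_double by (simp only: mult_ac)
  moreover have "qord D * cj P ^ i * (P ^ i * P ^ i) = qord D * P ^ i * (P ^ i * cj P ^ i)"
    by (simp only: mult_ac)
  moreover have "\<dots> \<approx> qord D * P ^ i"
    by (rule sim_cancel_power_cj[OF D split_prime_lat]) (simp add: qord_mult[OF D] flip: mult.assoc)
  ultimately have "qord D * P ^ i \<approx> qord D * cj P ^ i" using sim_sym sim_trans by metis
  then show ?thesis
    using lat_power[OF D split_prime_lat, of i] by (auto simp: ambiguous_def cj_mult cj_power)
qed

end

section \<open>Counting ideals in a class\<close>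

text \<open>The multiples are 0, h, ..., (k - 1) h; the excess \<open>r\<close> is too small for
  another one. It stands for the residue of the exponent modulo \<open>h\<close> that cannot be
  shifted away.\<close>

lemma card_multiples_le: "card {i::nat. i \<le> (k - 1) * h + r \<and> h dvd i} = k" if "k > 0" "r < h"
proof -
  have "{i. i \<le> (k - 1) * h + r \<and> h dvd i} = (*) h ` {..<k}"
  proof (intro equalityI subsetI)
    fix i assume "i \<in> {i. i \<le> (k - 1) * h + r \<and> h dvd i}"
    then obtain j where j: "i = h * j" "h * j \<le> (k - 1) * h + r" by auto
    have "h * j < h * k"
    proof -
      have "(k - 1) * h + h = h * k" using that(1) by (cases k) (auto simp: mult.commute)
      with j(2) that(2) show ?thesis by linarith
    qed
    with j(1) show "i \<in> (*) h ` {..<k}" by auto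
  next
    fix i assume "i \<in> (*) h ` {..<k}"
    then obtain j where "i = h * j" "j \<le> k - 1" by fastforce
    then show "i \<in> {i. i \<le> (k - 1) * h + r \<and> h dvd i}"
      by (simp add: mult.commute[of h] trans_le_add1)
  qed
  moreover have "inj_on ((*) h) {..<k}" using that(2) by (intro inj_onI) simp
  ultimately show ?thesis by (simp add: card_image)
qed

text \<open>Up to equivalence, multiplying by \<open>P ^ N\<close> turns
  \<open>P ^ i * cj P ^ (N - i) * J'\<close> into \<open>J' * P ^ (2 * i)\<close>. So the cofactor
  \<open>J'\<close> of a counted ideal differs from \<open>J0\<close> by an even power and equals
  \<open>J0\<close>; then P^(2i) is principal, that is, \<open>h\<close> divides
  \<open>i\<close>.\<close>

lemma reps_split_prime_power:
  assumes "disc D" "split_prime D p P"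
    and "lat D (real m) J0" "J0 \<le> qord D" "qord D * Y = Y" "J0 \<approx> Y * P ^ N" "\<not> p dvd m"
    and unique: "\<And>J t. lat D (real m) J \<Longrightarrow> J \<le> qord D \<Longrightarrow> J0 \<approx> J * P ^ (2 * t) \<Longrightarrow> J0 = J"
    and period: "\<And>i. qord D * P ^ (2 * i) \<approx> qord D \<longleftrightarrow> h dvd i"
  shows "reps D Y (p ^ N * m) = (\<lambda>i. P ^ i * cj P ^ (N - i) * J0) ` {i. i \<le> N \<and> h dvd i}"
    (is "_ = ?f ` ?S")
proof -
  note P = split_prime_lat[OF assms(1,2)] split_prime_le[OF assms(1,2)] cj_split_prime_le[OF assms(1,2)]
  have cancel: "B * (P ^ n * cj P ^ n) \<approx> B" if "qord D * B = B" for B n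
    by (rule sim_cancel_power_cj[OF assms(1) P(1) that])
  have YP: "qord D * (Y * A) = Y * A" for A using assms(5) by (simp flip: mult.assoc)
  have JP: "qord D * (J * A) = J * A" if "lat D n J" for n J A
    using lat_qord_mult[OF that] by (simp flip: mult.assoc)
  show ?thesis
  proof (intro equalityI subsetI)
    fix J assume "J \<in> reps D Y (p ^ N * m)"
    then have J: "lat D (real (p ^ N * m)) J" "J \<le> qord D" "J \<approx> Y" by (auto simp: reps_def)
    obtain i J' where i: "i \<le> N" "lat D (real m) J'" "J' \<le> qord D" "J = P ^ i * cj P ^ (N - i) * J'"
      using split_decomposition[OF assms(1,2) J(1,2)] by blast
    have PN: "P ^ N = P ^ i * P ^ (N - i)" using i(1) by (simp flip: power_add)
    have "J' * P ^ (2 * i) * (P ^ (N - i) * cj P ^ (N - i)) = J * P ^ N"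
      unfolding i(4) PN zmod_power_double by (simp only: mult_ac)
    also have "\<dots> \<approx> Y * P ^ N" by (rule sim_mult_right[OF J(3)])
    also have "\<dots> \<approx> J0" by (rule sim_sym[OF assms(6)])
    finally have "J' * P ^ (2 * i) * (P ^ (N - i) * cj P ^ (N - i)) \<approx> J0" .
    then have sim: "J0 \<approx> J' * P ^ (2 * i)"
      using cancel[OF JP[OF i(2)], of "P ^ (2 * i)" "N - i"] sim_sym sim_trans by blast
    then have J': "J' = J0" using unique[OF i(2,3) sim] by simp
    have "J0 * (qord D * P ^ (2 * i)) \<approx> J0 * qord D"
      using sim_sym[OF sim] lat_qord_mult[OF assms(3)]
      by (simp add: J' mult.commute[of J0 "qord D"] mult.left_commute[of J0 "qord D"] JP[OF assms(3)])
    then have "qord D * P ^ (2 * i) \<approx> qord D"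
      by (rule sim_mult_cancel[OF assms(3)]) (simp_all add: qord_mult[OF assms(1)] flip: mult.assoc)
    then show "J \<in> ?f ` ?S" using period i(1,4) J' by auto
  next
    fix J assume "J \<in> ?f ` ?S"
    then obtain i where i: "i \<le> N" "h dvd i" "J = P ^ i * cj P ^ (N - i) * J0" by auto
    have PN: "P ^ N = P ^ i * P ^ (N - i)" using i(1) by (simp flip: power_add)
    have "p ^ i * (p ^ (N - i) * m) = p ^ N * m"
      using i(1) by (simp add: power_add[symmetric] flip: mult.assoc)
    then have "lat D (real (p ^ N * m)) J"
      using lat_power_mult(1)[OF assms(1,2) lat_power_mult(2)[OF assms(1,2,3)], of i "N - i"] i(3)
      by (simp only: mult.assoc)
    moreover have "J \<le> qord D"
    proof -
      have pow: "A ^ n * B \<le> qord D" if "A \<le> qord D" "B \<le> qord D" for A B n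
        using that by (induction n) (auto simp: mult.assoc intro: mult_le_qord[OF assms(1)])
      show ?thesis unfolding i(3) mult.assoc by (intro pow P assms(4))
    qed
    moreover have "J \<approx> Y"
    proof -
      have "J \<approx> P ^ i * cj P ^ (N - i) * (Y * P ^ N)"
        unfolding i(3) by (rule sim_mult[OF sim_refl assms(6)])
      also have "P ^ i * cj P ^ (N - i) * (Y * P ^ N) = Y * P ^ (2 * i) * (P ^ (N - i) * cj P ^ (N - i))"
        unfolding PN zmod_power_double by (simp only: mult_ac)
      also have "\<dots> \<approx> Y * P ^ (2 * i)" by (rule cancel[OF YP])
      also have "\<dots> = Y * (qord D * P ^ (2 * i))"
        using assms(5) by (simp add: mult.left_commute[of Y] YP)
      also have "\<dots> \<approx> Y * qord D"
        using period i(2) by (intro sim_mult sim_refl) blast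
      also have "\<dots> = Y" using assms(5) by (simp add: mult.commute)
      finally show ?thesis .
    qed
    ultimately show "J \<in> reps D Y (p ^ N * m)" by (simp add: reps_def)
  qed
qed

lemma card_reps_attained:
  assumes "disc D" "no_bad_reduction D" "lat D N X"
    and J: "lat D (real m0) J" "J \<le> qord D" "J \<approx> X" "coprime (int m0) (2 * D)"
    and "k > 0"
  shows "\<exists>n>0. card (reps D X n) = k"
proof -
  obtain p P where sp: "split_prime D p P" using split_prime_exists[OF assms(1)] by blast
  note p = split_prime_imp_prime[OF assms(1) sp]
  note P = split_prime_lat[OF assms(1) sp]
  have XA: "qord D * (X * A) = X * A" for A using lat_qord_mult[OF assms(3)] by (simp flip: mult.assoc)
  define M where "M = {m. coprime (int m) (2 * D) \<and> (\<exists>J. lat D (real m) J \<and> J \<le> qord D \<and> coset D P X J)}"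
  have "X * qord D * P ^ 0 = X" using lat_qord_mult[OF assms(3)] by (simp add: mult.commute)
  then have "coset D P X J"
    unfolding coset_def[OF assms(1) sp] using ambiguous_qord[OF assms(1)] J(3) by metis
  then have "m0 \<in> M" using J by (auto simp: M_def)
  define m where "m = (LEAST m. m \<in> M)"
  have "m \<in> M" unfolding m_def by (rule LeastI[where P = "\<lambda>m. m \<in> M", OF \<open>m0 \<in> M\<close>])
  then obtain J0 where J0: "lat D (real m) J0" "J0 \<le> qord D" "coset D P X J0"
    and m: "coprime (int m) (2 * D)"
    by (auto simp: M_def)
  have minimal: "m \<le> u" if "lat D (real u) J" "J \<le> qord D" "coset D P X J" "coprime (int u) (2 * D)" for u J
    unfolding m_def by (rule Least_le) (use that in \<open>auto simp: M_def\<close>)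
  have m0: "m > 0" using lat_pos[OF J0(1)] by simp
  \<comment> \<open>Otherwise a factor \<open>P\<close> or \<open>cj P\<close> could be stripped
    from \<open>J0\<close> without leaving the coset, against minimality.\<close>
  have "\<not> p dvd m"
  proof
    assume "p dvd m"
    then obtain n where n: "m = p * n" by blast
    obtain J' where J': "lat D (real n) J'" "J' \<le> qord D" "J0 = P * J' \<or> J0 = cj P * J'"
      using split_divide[OF assms(1) sp, of n J0] J0 n by blast
    have PcP: "J' * (P ^ 1 * cj P ^ 1) \<approx> J'"
      by (rule sim_cancel_power_cj[OF assms(1) P lat_qord_mult[OF J'(1)]])
    from J'(3) have "coset D P X J'"
    proof
      assume "J0 = P * J'"
      then have "J0 * cj P = J' * (P ^ 1 * cj P ^ 1)" by (simp add: mult_ac)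
      then show ?thesis
        using coset_cj[OF assms(1) sp J0(3) lat_qord_mult[OF J0(1)]] PcP coset_sim[OF assms(1) sp] sim_sym by metis
    next
      assume "J0 = cj P * J'"
      then have "J0 * P ^ 1 = J' * (P ^ 1 * cj P ^ 1)" by (simp add: mult_ac)
      then show ?thesis
        using coset_power[OF assms(1) sp J0(3), of 1] PcP coset_sim[OF assms(1) sp] sim_sym by metis
    qed
    moreover have "coprime (int n) (2 * D)" using m by (simp add: n)
    ultimately have "m \<le> n" using minimal J'(1,2) by blast
    then show False using m0 prime_gt_1_nat[OF p] by (simp add: n)
  qed
  obtain A s where A: "ambiguous D A" "J0 \<approx> X * A * P ^ s"
    using J0(3) unfolding coset_def[OF assms(1) sp] by blast
  obtain h where h: "h > 0" "\<And>i. qord D * P ^ (2 * i) \<approx> qord D \<longleftrightarrow> h dvd i"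
    using power_period[OF assms(1) sp] by blast
  \<comment> \<open>In \<open>s = q + r\<close> the part \<open>q\<close> is a multiple of
    \<open>h\<close>, so \<open>P ^ q\<close> is ambiguous and can be put into \<open>B\<close>. The
    inverse of \<open>P ^ e\<close> goes there too, which raises the remaining exponent from
    \<open>r\<close> to \<open>e + r\<close>; exactly \<open>k\<close> multiples of \<open>h\<close>
    are at most that.\<close>
  define q r e where "q = s div h * h" and "r = s mod h" and "e = (k - 1) * h"
  define B where "B = A * (qord D * P ^ q) * cj (qord D * P ^ e)"
  have "h dvd q" "h dvd e" by (simp_all add: q_def e_def)
  then have "ambiguous D (qord D * P ^ q)" "ambiguous D (qord D * P ^ e)"
    unfolding h(2)[symmetric] by (blast intro: ambiguous_power[OF assms(1) sp])+
  then have B: "ambiguous D B"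
    unfolding B_def using ambiguous_mult[OF assms(1)] ambiguous_cj A(1) by blast
  have s: "P ^ s = P ^ q * P ^ r" by (simp add: q_def r_def flip: power_add)
  have "X * B * P ^ (e + r) = qord D * (qord D * (X * (A * P ^ q * P ^ r * (P ^ e * cj P ^ e))))"
    unfolding B_def power_add cj_mult cj_power cj_qord by (simp only: mult_ac)
  also have "\<dots> = X * A * P ^ s * (P ^ e * cj P ^ e)"
    unfolding XA s by (simp only: mult_ac)
  also have "\<dots> \<approx> X * A * P ^ s"
    by (rule sim_cancel_power_cj[OF assms(1) P]) (simp add: XA mult.assoc)
  also have "\<dots> \<approx> J0" by (rule sim_sym[OF A(2)])
  finally have J0_sim: "J0 \<approx> X * B * P ^ (e + r)" by (rule sim_sym)
  have "reps D (X * B) (p ^ (e + r) * m)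
      = (\<lambda>i. P ^ i * cj P ^ (e + r - i) * J0) ` {i. i \<le> e + r \<and> h dvd i}"
    by (rule reps_split_prime_power[OF assms(1) sp J0(1,2) XA J0_sim \<open>\<not> p dvd m\<close> _ h(2)])
      (rule coset_minimal_unique[OF assms(1) sp J0 _ _ m minimal])
  moreover have "inj_on (\<lambda>i. P ^ i * cj P ^ (e + r - i) * J0) {i. i \<le> e + r \<and> h dvd i}"
    by (rule inj_onI) (auto intro: split_decomposition_unique[OF assms(1) sp J0(1,2) \<open>\<not> p dvd m\<close>])
  moreover have "card {i. i \<le> e + r \<and> h dvd i} = k"
    unfolding e_def r_def using assms(8) h(1) by (intro card_multiples_le) auto
  ultimately have "card (reps D (X * B) (p ^ (e + r) * m)) = k"
    by (simp add: card_image)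
  moreover obtain d K where K: "absorbing D d K" "K \<approx> B"
    using ambiguous_absorbing[OF assms(1,2)] B unfolding ambiguous_def by blast
  \<comment> \<open>The class of \<open>B\<close> is its own inverse, so multiplication by
    \<open>K\<close> undoes the passage from \<open>X\<close> to \<open>X * B\<close>.\<close>
  moreover have "K * (X * B) \<approx> X"
  proof -
    have "K * (X * B) \<approx> B * (X * B)" by (rule sim_mult_right[OF K(2)])
    also have "B * (X * B) = X * (B * B)" by (simp only: mult_ac)
    also have "\<dots> \<approx> X * qord D" by (rule sim_mult[OF sim_refl ambiguous_square[OF B]])
    also have "\<dots> = X" using lat_qord_mult[OF assms(3)] by (simp add: mult.commute)
    finally show ?thesis .
  qed
  ultimately have "card (reps D X (d * (p ^ (e + r) * m))) = k"
    using card_reps_absorbing[OF assms(1) K(1) XA] by simp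
  moreover have "d > 0" using K(1) lat_pos by (force simp: absorbing_def)
  ultimately show ?thesis
    using m0 prime_gt_0_nat[OF p] by (intro exI[of _ "d * (p ^ (e + r) * m)"]) simp
qed

section \<open>Reduction to orders of smaller discriminant\<close>

text \<open>Modulo each prime \<open>q\<close> of \<open>M\<close> exactly one term survives: the
  x^2 term if \<open>q\<close> does not divide \<open>a\<close>, the y^2 term if it divides
  \<open>a\<close> but not \<open>c\<close>, the mixed term if it divides both. \<open>x\<close> and
  \<open>y\<close> collect the primes that kill the other terms.\<close>

lemma form_represents_coprime:
  fixes a b c M :: int
  assumes "gcd a (gcd b c) = 1" "M \<noteq> 0"
  shows "\<exists>x y. coprime (a * x\<^sup>2 + b * x * y + c * y\<^sup>2) M"
proof -
  define S where "S = prime_factors M"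
  define x where "x = \<Prod>{q \<in> S. q dvd a \<and> \<not> q dvd c}"
  define y where "y = \<Prod>{q \<in> S. \<not> q dvd a}"
  have S: "q \<in> S \<longleftrightarrow> prime q \<and> q dvd M" for q
    using assms(2) by (auto simp: S_def prime_factors_dvd)
  have fin: "finite S" by (simp add: S_def)
  have dvd_prod: "q dvd \<Prod>T \<longleftrightarrow> q \<in> T" if T: "T \<subseteq> S" and q: "prime q" for q T
  proof -
    have fT: "finite T" using T fin by (rule finite_subset)
    have "r = q" if "r \<in> T" "q dvd r" for r
      using that T S q primes_dvd_imp_eq by blast
    then have "(\<exists>r\<in>T. q dvd r) \<longleftrightarrow> q \<in> T" using dvd_refl by blast
    then show ?thesis
      using prime_dvd_prod_iff[OF fT q, of "\<lambda>x. x"] by simp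
  qed
  have np: "\<not> q dvd a * x\<^sup>2 + b * x * y + c * y\<^sup>2" if q: "prime q" "q dvd M" for q
  proof
    assume v: "q dvd a * x\<^sup>2 + b * x * y + c * y\<^sup>2"
    have qS: "q \<in> S" using S q by blast
    have qx: "q dvd x \<longleftrightarrow> q dvd a \<and> \<not> q dvd c"
      unfolding x_def using dvd_prod[of "{q \<in> S. q dvd a \<and> \<not> q dvd c}" q] q(1) qS by auto
    have qy: "q dvd y \<longleftrightarrow> \<not> q dvd a"
      unfolding y_def using dvd_prod[of "{q \<in> S. \<not> q dvd a}" q] q(1) qS by auto
    consider "\<not> q dvd a" | "q dvd a" "\<not> q dvd c" | "q dvd a" "q dvd c" by blast
    then show False
    proof cases
      case 1
      then have "q dvd b * x * y + c * y\<^sup>2" using qy by (simp add: power2_eq_square)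
      then have "q dvd a * x\<^sup>2" using v by (simp add: add.assoc dvd_add_left_iff)
      then show False using 1 qx q(1) by (simp add: prime_dvd_mult_iff prime_dvd_power_iff)
    next
      case 2
      then have "q dvd a * x\<^sup>2 + b * x * y" using qx by (simp add: mult.assoc)
      then have "q dvd c * y\<^sup>2" using v by (simp add: dvd_add_right_iff)
      then show False using 2 qy q(1) by (simp add: prime_dvd_mult_iff prime_dvd_power_iff)
    next
      case 3
      then have "q dvd a * x\<^sup>2 + c * y\<^sup>2" by simp
      moreover have "a * x\<^sup>2 + b * x * y + c * y\<^sup>2 = (a * x\<^sup>2 + c * y\<^sup>2) + b * x * y" by simp
      ultimately have "q dvd b * x * y" using v by (metis dvd_add_right_iff)
      then have "q dvd b" using 3 qx qy q(1) by (simp add: prime_dvd_mult_iff)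
      with 3 have "q dvd gcd a (gcd b c)" by simp
      then show False using assms(1) q(1) by (simp add: not_prime_unit)
    qed
  qed
  have "coprime (a * x\<^sup>2 + b * x * y + c * y\<^sup>2) M"
  proof (intro coprimeI, rule ccontr)
    fix d assume d: "d dvd a * x\<^sup>2 + b * x * y + c * y\<^sup>2" "d dvd M" "\<not> is_unit d"
    have "d \<noteq> 0" using d(2) assms(2) by auto
    then obtain q where "prime q" "q dvd d" using prime_divisorE[OF _ d(3)] by blast
    then show False using np d dvd_trans by blast
  qed
  then show ?thesis by blast
qed

lemma class_has_coprime_norm:
  assumes "disc D" "lat D N X"
  shows "\<exists>m J. lat D (real m) J \<and> J \<le> qord D \<and> J \<approx> X \<and> coprime (int m) (2 * D)"
proof -
  obtain M a u where M: "M \<approx> X" "a > 0" "lat D (1 / real a) M" "M = 1 + zgen u" "Im u = Im (om D) / real a"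
    using lat_reduced[OF assms] by blast
  obtain b c where form: "of_nat a * u = beta D b" "b\<^sup>2 - 4 * int a * c = D" "gcd (int a) (gcd b c) = 1"
    "\<And>x y. real a * (cmod (of_int x + of_int y * u))\<^sup>2 = of_int (int a * x\<^sup>2 + b * x * y + c * y\<^sup>2)"
    using lat_basis_form[OF assms(1) M(2-5)] by blast
  have "2 * D \<noteq> 0" using disc_neg[OF assms(1)] by simp
  then obtain x y where xy: "coprime (int a * x\<^sup>2 + b * x * y + c * y\<^sup>2) (2 * D)"
    using form_represents_coprime[OF form(3)] by blast
  define v where "v = of_int x + of_int y * u"
  have "u \<in> elts M" "1 \<in> elts M"
    using order_refl[of M] unfolding M(4) plus_le_iff by (simp_all add: zgen_le_iff flip: zgen_one)
  then have vM: "v \<in> elts M"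
    unfolding v_def using elts_of_int[of 1 M x] by (intro elts_add elts_of_int) auto
  have v0: "v \<noteq> 0"
  proof
    assume "v = 0"
    then have "real_of_int (int a * x\<^sup>2 + b * x * y + c * y\<^sup>2) = 0"
      unfolding form(4)[symmetric] v_def[symmetric] by simp
    then have "int a * x\<^sup>2 + b * x * y + c * y\<^sup>2 = 0" by (simp only: of_int_eq_0_iff)
    with xy show False by (simp add: is_unit_mult_iff)
  qed
  define m where "m = nat (int a * x\<^sup>2 + b * x * y + c * y\<^sup>2)"
  have "real_of_int (int a * x\<^sup>2 + b * x * y + c * y\<^sup>2) > 0"
    unfolding form(4)[symmetric] v_def[symmetric] using v0 M(2) by simp
  then have pos: "int a * x\<^sup>2 + b * x * y + c * y\<^sup>2 > 0" by (simp only: of_int_0_less_iff)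
  then have m: "real a * (cmod v)\<^sup>2 = real m" "coprime (int m) (2 * D)"
    using form(4)[of x y] xy by (simp_all add: v_def m_def)
  have "zgen (of_nat a * cnj v) * M \<approx> X"
    using sim_trans[OF sim_zgen M(1)] v0 M(2) by simp
  then show ?thesis
    using lat_scale_elt[OF assms(1) M(3) vM v0 M(2)] m by metis
qed

text \<open>For z = i + j om of modulus 1 the imaginary part gives j^2 (-D) at most 4, so j =
  0.\<close>

lemma qord_unit:
  assumes "disc D" "D < - 4" "z \<in> elts (qord D)" "cmod z = 1"
  shows "z = 1 \<or> z = - 1"
proof -
  obtain i j :: int where ij: "z = of_int i + of_int j * om D" using assms(3) elts_qord by blast
  have "\<bar>Im z\<bar> \<le> 1" using abs_Im_le_cmod[of z] assms(4) by simp
  then have "\<bar>of_int j * sqrt (- of_int D)\<bar> \<le> 2" by (simp add: ij om_def)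
  then have "(of_int j * sqrt (- of_int D))\<^sup>2 \<le> 2\<^sup>2"
    using abs_le_square_iff[of "of_int j * sqrt (- of_int D)" 2] by simp
  then have "real_of_int (j\<^sup>2 * (- D)) \<le> real_of_int 4"
    using assms(2) by (simp add: power_mult_distrib)
  then have le: "j\<^sup>2 * (- D) \<le> 4" by (simp only: of_int_le_iff)
  have "j = 0"
  proof (rule ccontr)
    assume "j \<noteq> 0"
    then have "1 * (- D) \<le> j\<^sup>2 * (- D)" using assms(2) by (intro mult_right_mono) (auto simp: int_one_le_iff_zero_less)
    with le assms(2) show False by linarith
  qed
  then have z: "z = of_int i" by (simp add: ij)
  then have "\<bar>i\<bar> = 1" using assms(4) by (simp add: norm_of_int)
  then show ?thesis using z by (auto simp: abs_if split: if_splits)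
qed

lemma zgen_minus_one: "zgen (- 1) = 1"
proof (rule order_antisym)
  have one: "1 \<in> elts (zgen (- 1))" using elts_of_int[of "- 1" "zgen (- 1)" "- 1"] by (simp flip: zgen_le_iff)
  then show "1 \<le> zgen (- 1)" by (simp add: zgen_le_iff flip: zgen_one)
  have "- 1 \<in> elts (zgen 1)" using elts_of_int[of 1 "zgen 1" "- 1"] by (simp flip: zgen_le_iff)
  then show "zgen (- 1) \<le> 1" by (simp add: zgen_le_iff flip: zgen_one)
qed

section \<open>An order and the order of index \<open>q\<close> inside it\<close>

context
  fixes D D' :: int and q :: nat
  assumes D': "disc D'" and q: "prime q" and D: "D = (int q)\<^sup>2 * D'"
begin

lemma om_suborder: "\<exists>t. om D = of_nat q * om D' + of_int t"
proof -
  \<comment> \<open>The translation q D' (q - 1) / 2 is an integer for either parity of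
    \<open>q\<close>.\<close>
  have "even (int q * D' * (int q - 1))" by (cases "even q") auto
  then obtain t where t: "int q * D' * (int q - 1) = 2 * t" by blast
  have "sqrt (- of_int D) = sqrt ((real q)\<^sup>2 * (- of_int D'))" by (simp add: D)
  also have "\<dots> = real q * sqrt (- of_int D')" by (simp only: real_sqrt_mult real_sqrt_abs abs_of_nat)
  finally have s: "sqrt (- of_int D) = real q * sqrt (- of_int D')" .
  have "real_of_int (int q * D' * (int q - 1)) = real_of_int (2 * t)" by (simp only: t)
  then have "of_int D / 2 = real q * (of_int D' / 2) + of_int t"
    by (simp add: D power2_eq_square algebra_simps)
  then have "Re (om D) = Re (of_nat q * om D' + of_int t)" by (simp add: om_def)
  moreover have "Im (om D) = Im (of_nat q * om D' + of_int t)" by (simp add: om_def s)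
  ultimately have "om D = of_nat q * om D' + of_int t" by (rule complex_eqI)
  then show ?thesis ..
qed

lemma disc_suborder: "disc D"
proof -
  have "(int q)\<^sup>2 mod 4 = 0 \<or> (int q)\<^sup>2 mod 4 = 1"
  proof (cases "even q")
    case True
    then obtain k where "int q = 2 * k" by (metis even_of_nat dvdE)
    then show ?thesis by (simp add: power2_eq_square)
  next
    case False
    then obtain k where k: "int q = 2 * k + 1" by (metis even_of_nat oddE)
    have "(int q)\<^sup>2 = 4 * (k * k + k) + 1" unfolding k by (simp add: power2_eq_square algebra_simps)
    then show ?thesis by presburger
  qed
  moreover have "D mod 4 = ((int q)\<^sup>2 mod 4) * (D' mod 4) mod 4" by (simp add: D mod_mult_eq)
  ultimately have "D mod 4 = 0 \<or> D mod 4 = 1" using D' by (auto simp: disc_def)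
  moreover have "D < 0" using disc_neg[OF D'] prime_gt_0_nat[OF q] by (simp add: D mult_pos_neg)
  ultimately show ?thesis by (simp add: disc_def)
qed

lemma suborder_le: "qord D \<le> qord D'"
proof -
  obtain t where t: "om D = of_nat q * om D' + of_int t" using om_suborder ..
  have "om D \<in> elts (qord D')" unfolding t by (intro elts_add elts_of_nat) auto
  then show ?thesis by (simp add: qord_def[of D] plus_le_iff one_le_qord zgen_le_iff)
qed

lemma conductor_le: "zgen (of_nat q) * qord D' \<le> qord D"
proof (rule zmod_leI)
  obtain t where t: "om D = of_nat q * om D' + of_int t" using om_suborder ..
  fix x assume "x \<in> elts (zgen (of_nat q) * qord D')"
  then obtain y where y: "y \<in> elts (qord D')" "x = of_nat q * y"
    by (auto simp: elts_zgen_mult)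
  then obtain i j :: int where "y = of_int i + of_int j * om D'"
    unfolding elts_qord by blast
  then have x: "x = of_int (int q * i) + of_int j * (om D - of_int t)"
    by (simp add: y t algebra_simps)
  show "x \<in> elts (qord D)"
    unfolding x by (rule elts_add[OF of_int_in_qord elts_of_int[OF elts_diff[OF om_in_qord of_int_in_qord]]])
qed

lemma suborder_mult: "qord D * qord D' = qord D'"
proof (rule order_antisym)
  show "qord D * qord D' \<le> qord D'"
    using zmod_mult_mono[OF suborder_le order_refl, of "qord D'"] by (simp add: qord_mult[OF D'])
  show "qord D' \<le> qord D * qord D'"
    using zmod_mult_mono[OF one_le_qord order_refl, of "qord D'" D] by simp
qed

lemma lat_extend: "lat D N X \<Longrightarrow> lat D' N (X * qord D')"
proof -
  assume X: "lat D N X"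
  have "X * qord D' * cj (X * qord D') = (X * cj X) * (qord D' * qord D')"
    by (simp add: cj_mult mult_ac)
  also have "\<dots> = zgen (of_real N) * qord D'"
    unfolding lat_mult_cj[OF X] qord_mult[OF D'] by (simp add: mult.assoc suborder_mult)
  finally show ?thesis
    using lat_pos[OF X] by (simp add: lat_def mult.left_commute[of "qord D'" X] qord_mult[OF D'])
qed

text \<open>For x = r + j q om, with om taken for \<open>D'\<close>, the squared modulus is
  divisible by q^2, and every term of its expansion except r^2 carries a factor \<open>q\<close>.
  Hence \<open>q\<close> divides \<open>r\<close>.\<close>

lemma ideal_norm_square_dvd:
  assumes "lat D (real (q\<^sup>2 * n)) J" "J \<le> qord D"
  shows "J \<le> zgen (of_nat q) * qord D'"
proof (rule zmod_leI)
  fix x assume x: "x \<in> elts J"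
  obtain t where t: "om D = of_nat q * om D' + of_int t" using om_suborder ..
  obtain i j :: int where "x = of_int i + of_int j * om D"
    using zmod_leD[OF assms(2) x] elts_qord by blast
  then have x_eq: "x = of_int (i + j * t) + of_int (j * int q) * om D'"
    by (simp add: t algebra_simps)
  define r where "r = i + j * t"
  obtain k where k: "(cmod x)\<^sup>2 = real k * real (q\<^sup>2 * n)"
    using lat_norm_int[OF disc_suborder assms(1) x] by blast
  have "of_real ((cmod x)\<^sup>2) = x * cnj x" by (rule complex_norm_square)
  also have "\<dots> = of_int (r\<^sup>2) + of_int (r * (j * int q)) * (om D' + cnj (om D'))
      + of_int ((j * int q)\<^sup>2) * (om D' * cnj (om D'))"
    by (simp add: x_eq r_def[symmetric] power2_eq_square algebra_simps)
  also have "\<dots> = of_int (r\<^sup>2 + r * (j * int q) * D' + (j * int q)\<^sup>2 * ((D' * D' - D') div 4))"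
    unfolding om_mult_cnj[OF D'] by (simp add: cnj_om)
  finally have "(of_int (int k * (int q)\<^sup>2 * int n) :: complex)
      = of_int (r\<^sup>2 + r * (j * int q) * D' + (j * int q)\<^sup>2 * ((D' * D' - D') div 4))"
    unfolding k by (simp add: mult.assoc)
  then have "int k * (int q)\<^sup>2 * int n = r\<^sup>2 + r * (j * int q) * D' + (j * int q)\<^sup>2 * ((D' * D' - D') div 4)"
    by (simp only: of_int_eq_iff)
  then have "r\<^sup>2 = int q * (int k * int q * int n - r * j * D' - j * (j * int q) * ((D' * D' - D') div 4))"
    by (simp add: power2_eq_square algebra_simps)
  then have "int q dvd r\<^sup>2" by (metis dvd_triv_left)
  then have "int q dvd r" using q prime_dvd_power[of "int q"] by simp
  then obtain s where "r = int q * s" by blast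
  then have "x = of_nat q * (of_int s + of_int j * om D')"
    by (simp add: x_eq r_def[symmetric] algebra_simps)
  then show "x \<in> elts (zgen (of_nat q) * qord D')"
    unfolding elts_zgen_mult by (intro image_eqI) (auto simp: elts_qord)
qed

text \<open>The bijection extends \<open>J\<close> to the larger order and divides by
  \<open>q\<close>. Equivalent ideals of equal norm with the same extension differ by a unit of the
  larger order, which is 1 or -1 for \<open>D' < - 4\<close>. Conversely
  \<open>zgen z * (X * qord D')\<close> comes from \<open>zgen (of_nat q * z) * X\<close>, integral
  by \<open>conductor_le\<close>.\<close>

lemma card_reps_suborder:
  assumes "D' < - 4" "lat D N X"
  shows "card (reps D X (q\<^sup>2 * n)) = card (reps D' (X * qord D') n)"
proof -
  note disc = disc_suborder
  have q0: "q > 0" using prime_gt_0_nat[OF q] .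
  note latE = lat_extend[OF assms(2)]
  let ?f = "\<lambda>J. zgen (1 / of_nat q) * (J * qord D')"
  have "bij_betw ?f (reps D X (q\<^sup>2 * n)) (reps D' (X * qord D') n)"
    unfolding bij_betw_def
  proof
    show "inj_on ?f (reps D X (q\<^sup>2 * n))"
    proof (rule inj_onI)
      fix J K assume J: "J \<in> reps D X (q\<^sup>2 * n)" and K: "K \<in> reps D X (q\<^sup>2 * n)" and eq: "?f J = ?f K"
      have "zgen (of_nat q) * ?f J = zgen (of_nat q) * ?f K" by (simp only: eq)
      then have eq: "J * qord D' = K * qord D'"
        using q0 by (simp add: zgen_mult zgen_one flip: mult.assoc)
      have JK: "lat D (real (q\<^sup>2 * n)) J" "lat D (real (q\<^sup>2 * n)) K"
        using J K by (simp_all add: reps_def)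
      have "J \<approx> X" "X \<approx> K" using J K sim_sym by (simp_all add: reps_def)
      then have "J \<approx> K" by (rule sim_trans)
      then obtain z where z: "z \<noteq> 0" "J = zgen z * K" by (auto simp: sim_def)
      have "lat D (real (q\<^sup>2 * n) * (cmod z)\<^sup>2) J" using lat_zgen[OF JK(2) z(1)] z(2) by simp
      then have "real (q\<^sup>2 * n) * (cmod z)\<^sup>2 = real (q\<^sup>2 * n)" by (rule lat_unique[OF disc JK(1)])
      then have "(cmod z)\<^sup>2 = 1" using lat_pos[OF JK(1)] by auto
      then have z1: "cmod z = 1" by (metis abs_norm_cancel abs_square_eq_1)
      have "K * qord D' * (zgen z * qord D') = J * (qord D' * qord D')"
        unfolding z(2) by (simp only: mult_ac)
      also have "\<dots> = K * qord D' * qord D'" by (simp add: qord_mult[OF D'] eq mult.assoc)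
      finally have "zgen z * qord D' = qord D'"
        by (rule lat_mult_cancel[OF lat_extend[OF JK(2)]])
          (simp_all add: qord_mult[OF D'] mult.left_commute[of "qord D'"])
      moreover have "z * 1 \<in> elts (zgen z * qord D')" unfolding elts_zgen_mult by (rule imageI) simp
      ultimately have "z \<in> elts (qord D')" by simp
      then have "z = 1 \<or> z = - 1" using qord_unit[OF D' assms(1) _ z1] by blast
      then show "J = K" using z(2) by (auto simp: zgen_one zgen_minus_one)
    qed
    show "?f ` reps D X (q\<^sup>2 * n) = reps D' (X * qord D') n"
    proof (intro equalityI subsetI)
      fix J' assume "J' \<in> ?f ` reps D X (q\<^sup>2 * n)"
      then obtain J where J: "J' = ?f J" "lat D (real (q\<^sup>2 * n)) J" "J \<le> qord D" "J \<approx> X"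
        by (auto simp: reps_def)
      have "lat D' (real n) J'"
        using lat_zgen[OF lat_extend[OF J(2)], of "1 / of_nat q"] q0
        by (simp add: J(1) norm_divide power_divide)
      moreover have "J' \<le> qord D'"
      proof -
        have "J * qord D' \<le> zgen (of_nat q) * qord D' * qord D'"
          by (rule zmod_mult_mono[OF ideal_norm_square_dvd[OF J(2,3)] order_refl])
        then have "J * qord D' \<le> zgen (of_nat q) * qord D'"
          by (simp add: mult.assoc qord_mult[OF D'])
        then have "J' \<le> zgen (1 / of_nat q) * (zgen (of_nat q) * qord D')"
          unfolding J(1) by (rule zmod_mult_mono[OF order_refl])
        then show ?thesis using q0 zgen_inverse_cancel[of "of_nat q" "qord D'"] by simp
      qed
      moreover have "J' \<approx> X * qord D'"
        unfolding J(1) using sim_trans[OF sim_zgen sim_mult_right[OF J(4)]] q0 by simp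
      ultimately show "J' \<in> reps D' (X * qord D') n" by (simp add: reps_def)
    next
      fix J' assume "J' \<in> reps D' (X * qord D') n"
      then obtain z where J': "lat D' (real n) J'" "J' \<le> qord D'" "z \<noteq> 0" "J' = zgen z * (X * qord D')"
        by (auto simp: reps_def sim_def)
      define J where "J = zgen (of_nat q * z) * X"
      have "real n = N * (cmod z)\<^sup>2"
        using lat_unique[OF D' lat_zgen[OF latE J'(3)]] J'(1,4) by simp
      then have "lat D (real (q\<^sup>2 * n)) J"
        using lat_zgen[OF assms(2), of "of_nat q * z"] J'(3) q0
        by (simp add: J_def norm_mult power_mult_distrib mult_ac)
      moreover have "J \<le> qord D"
      proof -
        have "J * 1 \<le> J * qord D'" by (intro zmod_mult_mono one_le_qord) simp
        also have "J * qord D' = zgen (of_nat q) * J'"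
          by (simp add: J_def J'(4) mult.assoc flip: zgen_mult)
        also have "\<dots> \<le> zgen (of_nat q) * qord D'" by (rule zmod_mult_mono[OF order_refl J'(2)])
        also have "\<dots> \<le> qord D" by (rule conductor_le)
        finally show ?thesis by simp
      qed
      moreover have "J \<approx> X" unfolding J_def using J'(3) q0 by (intro sim_zgen) simp
      moreover have "J' = ?f J"
        using q0 by (simp add: J_def J'(4) zgen_mult flip: mult.assoc)
      ultimately show "J' \<in> ?f ` reps D X (q\<^sup>2 * n)" by (auto simp: reps_def)
    qed
  qed
  then show ?thesis by (rule bij_betw_same_card)
qed

end

text \<open>While some prime of the conductor leads to a discriminant below -4 it is removed, which
  lowers -D; otherwise \<open>no_bad_reduction\<close> holds.\<close>

lemma card_reps_surj:
  assumes "disc D" "lat D N X" "k > 0"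
  shows "\<exists>n>0. card (reps D X n) = k"
  using assms(1,2)
proof (induction "nat (- D)" arbitrary: D X rule: less_induct)
  case less
  show ?case
  proof (cases "no_bad_reduction D")
    case True
    then show ?thesis
      using class_has_coprime_norm[OF less.prems] card_reps_attained[OF less.prems(1) True less.prems(2)] assms(3)
      by blast
  next
    case False
    then obtain q where q: "prime q" "conductor_dvd D q" "\<not> (D = - 3 * (int q)\<^sup>2 \<or> D = - 4 * (int q)\<^sup>2)"
      by (auto simp: no_bad_reduction_def)
    then obtain D' where D': "D = (int q)\<^sup>2 * D'" "D' mod 4 = 0 \<or> D' mod 4 = 1"
      by (auto simp: conductor_dvd_def)
    have "q > 1" using prime_gt_1_nat[OF q(1)] .
    then have q2: "(int q)\<^sup>2 > 1" by simp
    have "D \<ge> 0" if "D' \<ge> 0" unfolding D'(1) using that by simp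
    then have "D' < 0" using disc_neg[OF less.prems(1)] by linarith
    then have disc': "disc D'" using D'(2) by (simp add: disc_def)
    have "D' \<noteq> - 3" "D' \<noteq> - 4" using q(3) D'(1) by auto
    then have "D' < - 4" using disc' D'(2) \<open>D' < 0\<close> by presburger
    have "1 * (- D') < (int q)\<^sup>2 * (- D')" using q2 \<open>D' < 0\<close> by (intro mult_strict_right_mono) auto
    then have "- D' < - D" unfolding D'(1) by simp
    then have "nat (- D') < nat (- D)" using \<open>D' < 0\<close> by linarith
    from less.hyps[OF this disc' lat_extend[OF disc' q(1) D'(1) less.prems(2)]]
    obtain n where "n > 0" "card (reps D' (X * qord D') n) = k" by blast
    then have "q\<^sup>2 * n > 0" "card (reps D X (q\<^sup>2 * n)) = k"
      using card_reps_suborder[OF disc' q(1) D'(1) \<open>D' < - 4\<close> less.prems(2)] \<open>q > 1\<close> by simp_all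
    then show ?thesis by blast
  qed
qed

section \<open>Orbits of representations as ideals\<close>

text \<open>Both images are the quotient of \<open>S\<close> by the same equivalence
  relation.\<close>

lemma card_image_eq:
  assumes "\<And>x y. x \<in> S \<Longrightarrow> y \<in> S \<Longrightarrow> f x = f y \<longleftrightarrow> g x = g y"
  shows "card (f ` S) = card (g ` S)"
proof -
  let ?h = "\<lambda>u. g (inv_into S f u)"
  have h: "?h (f x) = g x" if "x \<in> S" for x
    using assms[of "inv_into S f (f x)" x] that f_inv_into_f[of "f x" f S] inv_into_into[of "f x" f S] by simp
  have "inj_on ?h (f ` S)"
    by (rule inj_onI) (auto simp: h assms)
  moreover have "?h ` f ` S = g ` S"
    using h by (auto simp: image_image)
  ultimately show ?thesis using card_image by fastforce
qed

lemma det_eq_one_invertible: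
  fixes A :: "int ^ 2 ^ 2"
  assumes "det A = 1"
  shows "invertible A"
proof -
  define B :: "int ^ 2 ^ 2" where "B = vector [vector [A$2$2, - A$1$2], vector [- A$2$1, A$1$1]]"
  have d: "A$1$1 * A$2$2 - A$1$2 * A$2$1 = 1" using assms by (simp add: det_2)
  then have "A ** B = mat 1" "B ** A = mat 1"
    by (simp_all add: vec_eq_iff matrix_matrix_mult_def mat_def B_def sum_2 forall_2 algebra_simps)
  then show ?thesis by (auto simp: invertible_def)
qed

lemma matrix_vector_mult_2:
  "(A *v v) $ 1 = A$1$1 * v$1 + A$1$2 * v$2" "(A *v v) $ 2 = A$2$1 * v$1 + A$2$2 * v$2"
  for A :: "int ^ 2 ^ 2"
  by (simp_all add: matrix_vector_mult_def sum_2)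

lemma carrier_proper_Aut:
  "A \<in> carrier (proper_Aut Q) \<longleftrightarrow> det A = 1 \<and> (\<forall>v. Q (A *v v) = Q v)"
  using det_eq_one_invertible[of A] by (auto simp: proper_Aut_def Aut_def)

lemma orbit_proper_Aut_eq_iff:
  "orbit (proper_Aut Q) (*v) v = orbit (proper_Aut Q) (*v) w \<longleftrightarrow> (\<exists>A\<in>carrier (proper_Aut Q). w = A *v v)"
proof
  let ?G = "carrier (proper_Aut Q)"
  have one: "mat 1 \<in> ?G" by (simp add: carrier_proper_Aut)
  have mult: "A ** B \<in> ?G" if "A \<in> ?G" "B \<in> ?G" for A B
    using that by (simp add: carrier_proper_Aut det_mul flip: matrix_vector_mul_assoc)
  {
    assume "orbit (proper_Aut Q) (*v) v = orbit (proper_Aut Q) (*v) w"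
    moreover have "w \<in> orbit (proper_Aut Q) (*v) w"
      using one by (force simp: orbit_def)
    ultimately show "\<exists>A\<in>?G. w = A *v v" by (auto simp: orbit_def)
  next
    have le: "orbit (proper_Aut Q) (*v) (A *v v) \<subseteq> orbit (proper_Aut Q) (*v) v" if "A \<in> ?G" for A v
      using mult that by (auto simp: orbit_def matrix_vector_mul_assoc)
    assume "\<exists>A\<in>?G. w = A *v v"
    then obtain A where A: "A \<in> ?G" "w = A *v v" by blast
    then obtain B where B: "A ** B = mat 1" "B ** A = mat 1"
      using det_eq_one_invertible[of A] by (auto simp: carrier_proper_Aut invertible_def)
    have "Q (B *v x) = Q x" for x
    proof -
      have "Q (A *v (B *v x)) = Q (B *v x)" using A(1) by (simp add: carrier_proper_Aut)
      then show ?thesis by (simp add: matrix_vector_mul_assoc B)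
    qed
    moreover have "det (A ** B) = 1" by (simp add: B)
    then have "det B = 1" using A(1) by (simp add: det_mul carrier_proper_Aut)
    ultimately have "B \<in> ?G" by (simp add: carrier_proper_Aut)
    moreover have "v = B *v w" by (simp add: A(2) matrix_vector_mul_assoc B)
    ultimately show "orbit (proper_Aut Q) (*v) v = orbit (proper_Aut Q) (*v) w"
      using le[of B w] le[OF A(1), of v] A(2) by auto
  }
qed

section \<open>Proper automorphisms as rotations of the lattice of the form\<close>

context
  fixes a b c D :: int
  assumes D: "disc D" and form: "b\<^sup>2 - 4 * a * c = D" and a: "a > 0" and prim: "gcd a (gcd b c) = 1"
begin

definition emb :: "int ^ 2 \<Rightarrow> complex" where
  "emb v = of_int (v $ 1) * of_int a + of_int (v $ 2) * beta D b"

lemma flat_lat: "lat D (of_int a) (flat D a b)"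
  by (rule lat_flat[OF D form a prim])

lemma elts_flat: "x \<in> elts (flat D a b) \<longleftrightarrow> (\<exists>v. x = emb v)"
proof
  assume "x \<in> elts (flat D a b)"
  then obtain i j :: int where "x = of_int i * of_int a + of_int j * beta D b"
    by (auto simp: flat_def elts_zgen_plus_zgen)
  then have "x = emb (vector [i, j])" by (simp add: emb_def)
  then show "\<exists>v. x = emb v" ..
qed (auto simp: emb_def flat_def elts_zgen_plus_zgen)

lemma emb_eq_iff: "emb v = emb w \<longleftrightarrow> v = w"
proof
  assume eq: "emb v = emb w"
  then have "Im (emb v) = Im (emb w)" by simp
  then have 2: "v $ 2 = w $ 2" using Im_beta_pos[OF D, of b] by (simp add: emb_def)
  with eq have "of_int (v $ 1 * a) = (of_int (w $ 1 * a) :: complex)" by (simp add: emb_def)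
  then have "v $ 1 * a = w $ 1 * a" by (simp only: of_int_eq_iff)
  with 2 a show "v = w" by (simp add: vec_eq_iff forall_2)
qed simp

lemma cmod_emb: "(cmod (emb v))\<^sup>2 = of_int (a * binary_form a b c v)"
proof -
  have "of_real ((cmod (emb v))\<^sup>2) = emb v * cnj (emb v)" by (rule complex_norm_square)
  also have "\<dots> = of_int ((v$1 * a)\<^sup>2) + of_int (v$1 * a * v$2) * (beta D b + cnj (beta D b))
      + of_int ((v$2)\<^sup>2) * (beta D b * cnj (beta D b))"
    by (simp add: emb_def power2_eq_square algebra_simps)
  also have "\<dots> = of_int (a * binary_form a b c v)"
    unfolding beta_mult_cnj[OF D form] by (simp add: beta_cnj binary_form_def power2_eq_square algebra_simps)
  also have "\<dots> = of_real (of_int (a * binary_form a b c v))" by simp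
  finally show ?thesis by (simp only: of_real_eq_iff)
qed

text \<open>The factor \<open>u\<close> is determined by the image of \<open>a\<close>. That it also
  carries \<open>beta D b\<close> to its image amounts to two identities, which rest on the
  determinant being 1; determinant -1 would give a reflection.\<close>

lemma proper_Aut_rotation:
  assumes "A \<in> carrier (proper_Aut (binary_form a b c))"
  shows "\<exists>u. cmod u = 1 \<and> (\<forall>v. emb (A *v v) = u * emb v)"
proof -
  define p q r s where "p = A$1$1" and "q = A$1$2" and "r = A$2$1" and "s = A$2$2"
  have det: "p * s - q * r = 1"
    using assms by (simp add: carrier_proper_Aut det_2 p_def q_def r_def s_def)
  have Q: "a * (p * x + q * y)\<^sup>2 + b * (p * x + q * y) * (r * x + s * y) + c * (r * x + s * y)\<^sup>2
      = a * x\<^sup>2 + b * x * y + c * y\<^sup>2" for x y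
  proof -
    have "binary_form a b c (A *v vector [x, y]) = binary_form a b c (vector [x, y])"
      using assms by (simp add: carrier_proper_Aut)
    then show ?thesis by (simp add: binary_form_def matrix_vector_mult_2 p_def q_def r_def s_def)
  qed
  have Q11: "a * p\<^sup>2 + b * p * r + c * r\<^sup>2 = a" using Q[of 1 0] by simp
  have Q22: "a * q\<^sup>2 + b * q * s + c * s\<^sup>2 = c" using Q[of 0 1] by simp
  have Q12: "2 * a * p * q + b * (p * s + q * r) + 2 * c * r * s = b"
    using Q[of 1 1] Q11 Q22 by (simp add: power2_eq_square algebra_simps)
  \<comment> \<open>Let G be the Gram matrix with rows (2a, b) and (b, 2c). Invariance says that G A
    is the inverse transpose of A times G. The facts \<open>1\<close> and \<open>2\<close> are the
    first row of this equation; the multipliers s and -r are the first row of the inverse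
    transpose.\<close>
  have 1: "a * p + b * r = a * s"
  proof -
    have "2 * (a * p + b * r) - 2 * (a * s) = 2 * s * (a * p\<^sup>2 + b * p * r + c * r\<^sup>2 - a)
        - r * (2 * a * p * q + b * (p * s + q * r) + 2 * c * r * s - b)
        + (1 - (p * s - q * r)) * (2 * a * p + b * r)"
      by (simp add: power2_eq_square algebra_simps)
    also have "\<dots> = 0" unfolding Q11 Q12 det by simp
    finally show ?thesis by simp
  qed
  have 2: "a * q = - (c * r)"
  proof -
    have "2 * (a * q) + 2 * (c * r) = s * (2 * a * p * q + b * (p * s + q * r) + 2 * c * r * s - b)
        - 2 * r * (a * q\<^sup>2 + b * q * s + c * s\<^sup>2 - c)
        + (1 - (p * s - q * r)) * (2 * a * q + b * s)"
      by (simp add: power2_eq_square algebra_simps)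
    also have "\<dots> = 0" unfolding Q22 Q12 det by simp
    finally show ?thesis by simp
  qed
  define u where "u = of_int p + of_int r * beta D b / of_int a"
  have a0: "(of_int a :: complex) \<noteq> 0" using a by simp
  have u1: "u * of_int a = of_int p * of_int a + of_int r * beta D b"
    using a0 by (simp add: u_def field_simps)
  have "of_int a * (u * beta D b) = u * of_int a * beta D b" by (simp only: mult_ac)
  also have "\<dots> = of_int (a * p) * beta D b + of_int r * (beta D b * beta D b)"
    unfolding u1 by (simp add: algebra_simps)
  also have "\<dots> = of_int (a * p + b * r) * beta D b + of_int a * of_int (- (c * r))"
    unfolding beta_square[OF D form] by (simp add: algebra_simps)
  also have "\<dots> = of_int a * (of_int q * of_int a + of_int s * beta D b)"
    unfolding 1 2[symmetric] by (simp add: algebra_simps)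
  finally have u2: "u * beta D b = of_int q * of_int a + of_int s * beta D b"
    using a0 by simp
  have emb: "emb (A *v v) = u * emb v" for v
  proof -
    have "u * emb v = of_int (v$1) * (u * of_int a) + of_int (v$2) * (u * beta D b)"
      by (simp add: emb_def algebra_simps)
    then show ?thesis
      unfolding u1 u2 by (simp add: emb_def matrix_vector_mult_2 p_def q_def r_def s_def algebra_simps)
  qed
  define e :: "int ^ 2" where "e = vector [1, 0]"
  have "cmod u * real_of_int a = real_of_int a"
  proof -
    have "(cmod (u * emb e))\<^sup>2 = (cmod (emb e))\<^sup>2"
      unfolding emb[symmetric] cmod_emb using assms by (simp add: carrier_proper_Aut)
    then have "cmod (u * emb e) = cmod (emb e)" by (metis norm_ge_zero power2_eq_iff_nonneg)
    then show ?thesis using a by (simp add: emb_def e_def norm_mult)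
  qed
  then have "cmod u = 1" using a by simp
  with emb show ?thesis by blast
qed

lemma proper_Aut_of_unit:
  assumes "cmod u = 1" "zgen u * flat D a b = flat D a b"
  shows "\<exists>A\<in>carrier (proper_Aut (binary_form a b c)). \<forall>v. emb (A *v v) = u * emb v"
proof -
  have in_lat: "u * x \<in> elts (flat D a b)" if "x \<in> elts (flat D a b)" for x
    using assms(2) that elts_zgen_mult by (metis image_eqI)
  have "of_int a \<in> elts (flat D a b)" "beta D b \<in> elts (flat D a b)"
    using order_refl[of "flat D a b"] unfolding flat_def plus_le_iff zgen_le_iff by auto
  then obtain x y where x: "u * of_int a = emb x" and y: "u * beta D b = emb y"
    using in_lat elts_flat by blast
  define A :: "int ^ 2 ^ 2" where "A = vector [vector [x$1, y$1], vector [x$2, y$2]]"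
  have emb: "emb (A *v v) = u * emb v" for v
  proof -
    have "u * emb v = of_int (v$1) * emb x + of_int (v$2) * emb y"
      by (simp add: emb_def[of v] algebra_simps flip: x y)
    then show ?thesis by (simp add: emb_def matrix_vector_mult_2 A_def algebra_simps)
  qed
  have "binary_form a b c (A *v v) = binary_form a b c v" for v
  proof -
    have "(cmod (emb (A *v v)))\<^sup>2 = (cmod (emb v))\<^sup>2" by (simp add: emb norm_mult assms(1))
    then have "a * binary_form a b c (A *v v) = a * binary_form a b c v"
      unfolding cmod_emb by (simp only: of_int_eq_iff)
    then show ?thesis using a by simp
  qed
  \<comment> \<open>\<open>Im (cnj x * y)\<close> is an oriented area, which multiplication by
    \<open>u\<close> preserves; comparing the basis with its image therefore also fixes the sign of
    the determinant.\<close>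
  moreover have "det A = 1"
  proof -
    have "cnj u * u = 1" using complex_norm_square[of u] assms(1) by (simp add: mult.commute)
    then have "cnj (emb x) * emb y = of_int a * beta D b"
      unfolding x[symmetric] y[symmetric] by (simp add: mult_ac)
    then have "Im (cnj (emb x) * emb y) = of_int a * Im (beta D b)" by simp
    moreover have "Im (cnj (emb x) * emb y) = of_int (x$1 * y$2 - x$2 * y$1) * (of_int a * Im (beta D b))"
      by (simp add: emb_def algebra_simps)
    ultimately have "real_of_int (x$1 * y$2 - x$2 * y$1) = 1"
      using a Im_beta_pos[OF D, of b] by simp
    then have "x$1 * y$2 - x$2 * y$1 = 1" by linarith
    then show ?thesis by (simp add: det_2 A_def mult.commute)
  qed
  ultimately have "A \<in> carrier (proper_Aut (binary_form a b c))" by (simp add: carrier_proper_Aut)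
  with emb show ?thesis by blast
qed

text \<open>A representation \<open>v\<close> corresponds to \<open>emb v\<close> times the inverse
  lattice, which is the conjugate lattice divided by \<open>a\<close>; this is where the conjugate
  class comes from. The norm of that ideal is |emb v|^2 / a = n, and \<open>n > 0\<close> keeps the
  zero vector away.\<close>

lemma proper_rep_count_eq_card_reps:
  assumes "n > 0"
  shows "proper_rep_count (binary_form a b c) n = card (reps D (cj (flat D a b)) n)"
proof -
  let ?Q = "binary_form a b c" and ?L = "flat D a b"
  let ?R = "representations ?Q n"
  define I where "I v = zgen (emb v / of_int a) * cj ?L" for v
  note L = flat_lat
  have a0: "(of_int a :: complex) \<noteq> 0" using a by simp
  have R: "v \<in> ?R \<longleftrightarrow> (cmod (emb v))\<^sup>2 = of_int a * real n" for v
  proof -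
    have "(cmod (emb v))\<^sup>2 = of_int a * real n \<longleftrightarrow> real_of_int (a * ?Q v) = real_of_int (a * int n)"
      unfolding cmod_emb by simp
    then show ?thesis using a by (simp add: representations_def del: of_int_mult)
  qed
  have R0: "emb v \<noteq> 0" if "v \<in> ?R" for v
    using that assms a by (auto simp: R)
  have "I ` ?R = reps D (cj ?L) n"
  proof (intro equalityI subsetI)
    fix J assume "J \<in> I ` ?R"
    then obtain v where v: "v \<in> ?R" "J = zgen (emb v / of_int a) * cj ?L" by (auto simp: I_def)
    have "lat D (of_int a * (cmod (emb v / of_int a))\<^sup>2) J"
      unfolding v(2) by (rule lat_zgen[OF lat_cj[OF L]]) (use R0[OF v(1)] a0 in simp)
    then have "lat D (real n) J"
      using v(1) a by (simp add: R norm_divide power_divide power2_eq_square)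
    moreover have "J \<le> qord D"
    proof -
      have "zgen (emb v) * cj ?L \<le> ?L * cj ?L"
        by (rule zmod_mult_mono) (auto simp: zgen_le_iff elts_flat)
      then have "zgen (1 / of_int a) * (zgen (emb v) * cj ?L) \<le> zgen (1 / of_int a) * (?L * cj ?L)"
        by (rule zmod_mult_mono[OF order_refl])
      also have "\<dots> = qord D"
        unfolding lat_mult_cj[OF L] of_real_of_int_eq by (rule zgen_inverse_cancel[OF a0])
      finally show ?thesis
        unfolding v(2) by (simp add: zgen_mult flip: mult.assoc)
    qed
    moreover have "J \<approx> cj ?L" unfolding v(2) using R0[OF v(1)] a0 by (intro sim_zgen) simp
    ultimately show "J \<in> reps D (cj ?L) n" by (simp add: reps_def)
  next
    fix J assume "J \<in> reps D (cj ?L) n"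
    then obtain z where J: "lat D (real n) J" "J \<le> qord D" "z \<noteq> 0" "J = zgen z * cj ?L"
      by (auto simp: reps_def sim_def)
    have "J * ?L \<le> qord D * ?L" by (rule zmod_mult_mono[OF J(2) order_refl])
    then have "J * ?L \<le> ?L" by (simp add: lat_qord_mult[OF L])
    moreover have "J * ?L = zgen z * (zgen (of_int a) * qord D)"
      unfolding J(4) using lat_mult_cj[OF L] by (simp add: mult_ac)
    moreover have "z * (of_int a * 1) \<in> elts (zgen z * (zgen (of_int a) * qord D))"
      unfolding elts_zgen_mult by (intro imageI) simp
    ultimately obtain v where v: "z * of_int a = emb v"
      using elts_flat by (metis mult.right_neutral zmod_leD)
    then have z: "z = emb v / of_int a" using a0 by (simp add: field_simps)
    have n: "of_int a * (cmod z)\<^sup>2 = real n"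
      using lat_unique[OF D J(1)] lat_zgen[OF lat_cj[OF L] J(3)] J(4) by simp
    have "(cmod (emb v))\<^sup>2 = of_int a * (of_int a * (cmod z)\<^sup>2)"
      unfolding v[symmetric] using a by (simp add: norm_mult power2_eq_square mult_ac)
    then have "(cmod (emb v))\<^sup>2 = of_int a * real n" unfolding n .
    then show "J \<in> I ` ?R" unfolding I_def J(4) z using R by blast
  qed
  moreover have "orbit (proper_Aut ?Q) (*v) v = orbit (proper_Aut ?Q) (*v) w \<longleftrightarrow> I v = I w"
    if v: "v \<in> ?R" and w: "w \<in> ?R" for v w
  proof
    assume "orbit (proper_Aut ?Q) (*v) v = orbit (proper_Aut ?Q) (*v) w"
    then obtain A where A: "A \<in> carrier (proper_Aut ?Q)" "w = A *v v"
      using orbit_proper_Aut_eq_iff by blast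
    obtain u where u: "cmod u = 1" "\<And>v. emb (A *v v) = u * emb v"
      using proper_Aut_rotation[OF A(1)] by blast
    have uu: "u * cnj u = 1" using complex_norm_square[of u] u(1) by simp
    have "u * x \<in> elts ?L" if "x \<in> elts ?L" for x
      using that u(2) by (metis elts_flat)
    then have "zgen u * ?L \<le> ?L"
      unfolding less_eq_zmod_def elts_zgen_mult by blast
    then have "zgen (cnj u) * cj ?L \<le> cj ?L"
      using cj_mono[of "zgen u * ?L" ?L] by (simp add: cj_mult cj_zgen)
    then have "zgen u * (zgen (cnj u) * cj ?L) \<le> zgen u * cj ?L"
      by (rule zmod_mult_mono[OF order_refl])
    \<comment> \<open>Inclusion between lattices of equal norm is equality, since their quotient is
      an integral ideal of norm 1.\<close>
    then have 1: "cj ?L \<le> zgen u * cj ?L" by (simp add: zgen_mult uu zgen_one flip: mult.assoc)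
    have "u \<noteq> 0" using u(1) by auto
    then have "lat D (of_int a) (zgen u * cj ?L)"
      using lat_zgen[OF lat_cj[OF L], of u] u(1) by simp
    from lat_divide[OF D lat_cj[OF L] this 1] obtain K
      where K: "lat D (of_int a / of_int a) K" "K \<le> qord D" "cj ?L = zgen u * cj ?L * K" by blast
    then have "K = qord D" using lat_integral_norm_one[OF D] a by simp
    with K(3) have "cj ?L = zgen u * cj ?L"
      using lat_qord_mult[OF lat_cj[OF L]] by (metis mult.assoc mult.commute)
    moreover have "I w = zgen (emb v / of_int a) * (zgen u * cj ?L)"
      by (simp add: I_def A(2) u(2) zgen_mult mult.commute[of u] flip: mult.assoc)
    ultimately show "I v = I w" by (simp add: I_def)
  next
    assume eq: "I v = I w"
    define u where "u = emb w / emb v"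
    note v0 = R0[OF v] and w0 = R0[OF w]
    have "(cmod u)\<^sup>2 = 1" using v w a assms by (simp add: u_def norm_divide power_divide R)
    then have u1: "cmod u = 1" by (metis abs_norm_cancel abs_square_eq_1)
    have "zgen (of_int a / emb v) * I v = zgen (of_int a / emb v) * I w" by (simp only: eq)
    then have "cj ?L = zgen u * cj ?L"
      using v0 a0 by (simp add: I_def u_def zgen_mult zgen_one flip: mult.assoc)
    then have "?L = zgen (cnj u) * ?L" using cj_mult cj_zgen cj_cj by metis
    then have "zgen u * ?L = zgen u * (zgen (cnj u) * ?L)" by simp
    also have "\<dots> = ?L"
      using complex_norm_square[of u] u1 by (simp add: zgen_mult zgen_one flip: mult.assoc)
    finally obtain A where A: "A \<in> carrier (proper_Aut ?Q)" "\<And>v. emb (A *v v) = u * emb v"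
      using proper_Aut_of_unit[OF u1] by blast
    have "emb w = emb (A *v v)" unfolding A(2) using v0 by (simp add: u_def)
    then have "w = A *v v" by (simp add: emb_eq_iff)
    then show "orbit (proper_Aut ?Q) (*v) v = orbit (proper_Aut ?Q) (*v) w"
      using orbit_proper_Aut_eq_iff A(1) by blast
  qed
  then have "card ((\<lambda>v. orbit (proper_Aut ?Q) (*v) v) ` ?R) = card (I ` ?R)"
    by (rule card_image_eq)
  moreover have "orbits (proper_Aut ?Q) ?R (*v) = (\<lambda>v. orbit (proper_Aut ?Q) (*v) v) ` ?R"
    by (auto simp: orbits_def)
  ultimately show ?thesis by (simp add: proper_rep_count_def)
qed

end

text \<open>Once 1 is represented, composition reduces every value \<open>n\<close> to 4n = x^2 - D
  y^2. As 8 is not a square, n = 2 forces -D to be at most 8, and each of -3, -4, -7, -8 misses one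
  of 2, 3, 5.\<close>

lemma not_universal:
  assumes "b\<^sup>2 - 4 * a * c = D" "disc D"
  shows "\<exists>n::nat. \<forall>v. binary_form a b c v \<noteq> int n"
proof (rule ccontr)
  assume "\<not> ?thesis"
  then have all: "\<exists>v. binary_form a b c v = int n" for n by blast
  obtain w where w: "binary_form a b c w = 1" using all[of 1] by auto
  have norm_form: "\<exists>x y. 4 * int n = x\<^sup>2 - D * y\<^sup>2" for n
  proof -
    obtain v where v: "binary_form a b c v = int n" using all by blast
    \<comment> \<open>Four times a product of two values is the square of the polar form minus
      \<open>D\<close> times the square of the determinant of the two vectors.\<close>
    have "4 * binary_form a b c w * binary_form a b c v
        = (2 * a * w$1 * v$1 + b * (w$1 * v$2 + w$2 * v$1) + 2 * c * w$2 * v$2)\<^sup>2 - D * (w$1 * v$2 - w$2 * v$1)\<^sup>2"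
      unfolding assms(1)[symmetric] binary_form_def by (simp add: power2_eq_square algebra_simps)
    then show ?thesis unfolding v w by auto
  qed
  have D: "D < 0" "D mod 4 = 0 \<or> D mod 4 = 1" using assms(2) by (auto simp: disc_def)
  have no_square: "x\<^sup>2 \<noteq> k" if "m\<^sup>2 < k" "k < (m + 1)\<^sup>2" "m \<ge> 0" for x k m :: int
  proof
    assume k: "x\<^sup>2 = k"
    have "\<bar>m\<bar> < \<bar>x\<bar>" using that(1) unfolding k[symmetric] by (simp add: abs_le_square_iff not_le[symmetric])
    moreover have "\<bar>x\<bar> < \<bar>m + 1\<bar>" using that(2) unfolding k[symmetric] by (simp add: abs_le_square_iff not_le[symmetric])
    ultimately show False using that(3) by linarith
  qed
  have small: "y\<^sup>2 = 0 \<or> y\<^sup>2 = 1 \<or> y\<^sup>2 = 4 \<or> y\<^sup>2 \<ge> 9" for y :: int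
  proof -
    consider "y = 0" | "y = 1 \<or> y = - 1" | "y = 2 \<or> y = - 2" | "\<bar>3\<bar> \<le> \<bar>y\<bar>" by linarith
    then show ?thesis
    proof cases
      case 4
      then have "3\<^sup>2 \<le> y\<^sup>2" by (simp only: abs_le_square_iff)
      then show ?thesis by simp
    qed auto
  qed
  have ns: "x\<^sup>2 \<noteq> 5" "x\<^sup>2 \<noteq> 8" "x\<^sup>2 \<noteq> 12" "x\<^sup>2 \<noteq> 20" for x :: int
    using no_square[of 2 5 x] no_square[of 2 8 x] no_square[of 3 12 x] no_square[of 4 20 x] by auto
  obtain x2 y2 where e2: "8 = x2\<^sup>2 - D * y2\<^sup>2" using norm_form[of 2] by auto
  obtain x3 y3 where e3: "12 = x3\<^sup>2 - D * y3\<^sup>2" using norm_form[of 3] by auto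
  obtain x5 y5 where e5: "20 = x5\<^sup>2 - D * y5\<^sup>2" using norm_form[of 5] by auto
  have "y2\<^sup>2 \<noteq> 0" using e2 ns(2)[of x2] by auto
  then have "y2\<^sup>2 \<ge> 1" using small[of y2] by auto
  then have "1 * (- D) \<le> y2\<^sup>2 * (- D)" using D(1) by (intro mult_right_mono) auto
  moreover have "y2\<^sup>2 * (- D) = - (D * y2\<^sup>2)" by simp
  ultimately have "- D \<le> 8" using e2 zero_le_power2[of x2] by linarith
  then have "D = -3 \<or> D = -4 \<or> D = -7 \<or> D = -8" using D by presburger
  then show False
  proof (elim disjE)
    assume "D = -3"
    then show False using e2 ns(1,2)[of x2] small[of y2] zero_le_power2[of x2] by auto
  next
    assume "D = -4"
    then show False using e3 ns(2,3)[of x3] small[of y3] zero_le_power2[of x3] by auto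
  next
    assume "D = -7"
    then show False using e3 ns(1,3)[of x3] small[of y3] zero_le_power2[of x3] by auto
  next
    assume "D = -8"
    then show False using e5 ns(3,4)[of x5] small[of y5] zero_le_power2[of x5] by auto
  qed
qed

theorem theorem1p4:
  fixes a b c :: int
  assumes "primitive_form a b c"
    and "positive_definite (binary_form a b c)"
  shows "surj (proper_rep_count (binary_form a b c))"
proof -
  define D where "D = b\<^sup>2 - 4 * a * c"
  have pos: "binary_form a b c v > 0" if "v \<noteq> 0" for v
    using assms(2) that by (simp add: positive_definite_def)
  have "vector [1, 0] \<noteq> (0 :: int ^ 2)" by (simp add: vec_eq_iff forall_2)
  from pos[OF this] have a: "a > 0" by (simp add: binary_form_def)
  \<comment> \<open>Completing the square suggests this vector: the form takes the value -aD
    there.\<close>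
  have "vector [- b, 2 * a] \<noteq> (0 :: int ^ 2)" using a by (simp add: vec_eq_iff forall_2)
  from pos[OF this] have "a * (- D) > 0"
    by (simp add: binary_form_def D_def power2_eq_square algebra_simps)
  then have "D < 0" using zero_less_mult_pos[of a "- D"] a by simp
  moreover have "D mod 4 = 0 \<or> D mod 4 = 1"
  proof -
    have "D mod 4 = b\<^sup>2 mod 4" unfolding D_def by (simp add: mod_eq_dvd_iff mult.assoc)
    moreover have "b\<^sup>2 mod 4 = 0 \<or> b\<^sup>2 mod 4 = 1"
    proof (cases "even b")
      case False
      then obtain k where k: "b = 2 * k + 1" by (metis oddE)
      have "b\<^sup>2 = 4 * (k * k + k) + 1" unfolding k by (simp add: power2_eq_square algebra_simps)
      then show ?thesis by presburger
    qed (auto simp: power2_eq_square elim!: evenE)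
    ultimately show ?thesis by simp
  qed
  ultimately have disc: "disc D" by (simp add: disc_def)
  have prim: "gcd a (gcd b c) = 1" using assms(1) by (simp add: primitive_form_def)
  note form = D_def[symmetric]
  show ?thesis
    unfolding surj_def
  proof
    fix k
    show "\<exists>n. k = proper_rep_count (binary_form a b c) n"
    proof (cases "k = 0")
      case True
      obtain n :: nat where "\<And>v. binary_form a b c v \<noteq> int n" using not_universal[OF form disc] by blast
      then have "representations (binary_form a b c) n = {}" by (simp add: representations_def)
      then have "proper_rep_count (binary_form a b c) n = 0" by (simp add: proper_rep_count_def orbits_def)
      with True show ?thesis by metis
    next
      case False
      then obtain n where "n > 0" "card (reps D (cj (flat D a b)) n) = k"
        using card_reps_surj[OF disc lat_cj[OF flat_lat[OF disc form a prim]]] by blast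
      then show ?thesis using proper_rep_count_eq_card_reps[OF disc form a prim] by metis
    qed
  qed
qed

end
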